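(* Let $k\in\mathbb{Z}$ and $\ell\in\mathbb{Z}\setminus\{0\}$ be fixed, and let $\rho_{N,\alpha}$ be the law of the normalised Birkhoff sum $X_{N,\alpha}$ of $\psi_{k,\ell}$. (i) Fix $\alpha\in\mathbb{R}$. Then, for every weakly convergent subsequence $(\rho_{N_i,\alpha})_i$ of $(\rho_{N,\alpha})_{N\in\mathbb{N}}$ there exists $\nu\in\mathcal{P}$ such that $\rho_{N_i,\alpha}\xrightarrow{w}\nu$. (ii) There is a Lebesgue null set $\mathcal{N}\subset\mathbb{R}$ such that for every $\alpha\in\mathbb{R}\setminus\mathcal{N}$ the following holds. For every $\nu\in\mathcal{P}$ there exists a convergent subsequence $(\rho_{N_i,\alpha})_i$ such that $\rho_{N_i,\alpha}\xrightarrow{w}\nu$.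
   Context: $\mathbb{N}=\{1,2,3,\dots\}$, $e(x):=\mathrm{e}^{2\pi\mathrm{i}x}$, $\mathbb{T}=\mathbb{R}/\mathbb{Z}$. $\xrightarrow{w}$ denotes weak convergence of probability measures on $\mathbb{C}$. Birkhoff sums. For $\alpha\in\mathbb{R}$ let $\Lambda_\alpha:\mathbb{T}^2\to\mathbb{T}^2$, $(p,q)\mapsto(p+\alpha,q+p)$; let $\psi_{k,\ell}(p,q)=e(kp+\ell q)$ and $S_{N,\alpha}[\psi]=\sum_{n=1}^N\psi\circ\Lambda_\alpha^n$. Let $X_{N,\alpha}=N^{-1/2}S_{N,\alpha}[\psi_{k,\ell}](p,q)$ with $(p,q)$ uniformly distributed in $\mathbb{T}^2$ (Lebesgue measure), and let $\rho_{N,\alpha}$ be the probability measure on $\mathbb{C}$ describing the distribution of $X_{N,\alpha}$. Theta functions. Let $G=\mathrm{SL}(2,\mathbb{R})$ and $\Gamma=\mathrm{SL}(2,\mathbb{Z})$. Every $M\in G$ has a unique Iwasawa decomposition $$M=\begin{pmatrix}1&u\\0&1\end{pmatrix}\begin{pmatrix}v^{1/2}&0\\0&v^{-1/2}\end{pmatrix}\begin{pmatrix}\cos\phi&-\sin\phi\\ \sin\phi&\cos\phi\end{pmatrix},\quad u\in\mathbb{R},\ v>0,\ \phi\in[0,2\pi),$$ and is identified with $(\tau,\phi)=(u+\mathrm{i}v,\phi)$. Let $\chi$ be the characteristic function of $(0,1]$. Set $\chi_\phi(w)=\chi(w)$ if $\phi=0\bmod 2\pi$, $\chi_\phi(w)=\chi(-w)$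 if $\phi=\pi\bmod 2\pi$, and otherwise $$\chi_\phi(w)=|\sin\phi|^{-1/2}\int_{\mathbb{R}}e\left[\frac{\tfrac12(w^2+w'^2)\cos\phi-ww'}{\sin\phi}\right]\chi(w')\,dw'.$$ For $\xi=(x,y)^{\mathrm t}\in\mathbb{R}^2$ let $$\Theta_\chi(M;\xi)=v^{1/4}\sum_{n\in\mathbb{Z}}\chi_\phi\big((n-y)v^{1/2}\big)\,e\big(\tfrac12(n-y)^2u+nx\big),$$ where, for almost every $y$, the series is understood as converging in $L^2(\mathbb{T},dx)$ (so $\Theta_\chi(M;\cdot)$ is defined almost everywhere). The modulus $|\Theta_\chi(M;\xi)|$ is $\mathbb{Z}^2$-periodic in $\xi$. The limit family. For $M\in\Gamma\backslash G$ (represented by an element of $G$, on whose choice the following does not depend), $\nu_M$ is the probability measure on $\mathbb{C}$ given, for bounded continuous $F:\mathbb{C}\to\mathbb{R}$, by $$\nu_M(F)=\int_{\mathbb{T}^3}F\big(e(t)|\Theta_\chi(M;\xi)|\big)\,dt\,d\xi .$$ Set $\mathcal{P}=\{\nu_M: M\in\Gamma\backslash G\}\cup\{\delta_0\}$, where $\delta_0$ is the Dirac mass at $0$. *)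

theory Defs
  imports "HOL-Probability.Probability"
begin

definition e2pi :: "real \<Rightarrow> complex" where
  "e2pi x = exp (2 * of_real pi * \<i> * of_real x)"

(* The torus R/Z is represented by the fundamental domain [0,1), with addition modulo 1. *)
definition circle :: "real measure" where
  "circle = restrict_space lborel {0..<1}"


subsection \<open>Birkhoff sums of the skew translation\<close>

definition skew :: "real \<Rightarrow> real \<times> real \<Rightarrow> real \<times> real" where
  "skew \<alpha> = (\<lambda>(p, q). (frac (p + \<alpha>), frac (q + p)))"

definition psi :: "int \<Rightarrow> int \<Rightarrow> real \<times> real \<Rightarrow> complex" where
  "psi k l = (\<lambda>(p, q). e2pi (of_int k * p + of_int l * q))"

definition birkhoff_sum :: "nat \<Rightarrow> real \<Rightarrow> (real \<times> real \<Rightarrow> complex) \<Rightarrow> real \<times> real \<Rightarrow> complex" where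
  "birkhoff_sum N \<alpha> f = (\<lambda>pq. \<Sum>n=1..N. f ((skew \<alpha> ^^ n) pq))"

definition rho :: "int \<Rightarrow> int \<Rightarrow> nat \<Rightarrow> real \<Rightarrow> complex measure" where
  "rho k l N \<alpha> = distr (circle \<Otimes>\<^sub>M circle) borel
     (\<lambda>pq. of_real (real N powr (-1/2)) * birkhoff_sum N \<alpha> (psi k l) pq)"


subsection \<open>Weak convergence on the complex plane\<close>

(* The library's weak convergence is restricted to measures on the real line. *)
definition weak_conv_complex :: "(nat \<Rightarrow> complex measure) \<Rightarrow> complex measure \<Rightarrow> bool" where
  "weak_conv_complex \<mu> \<nu> \<longleftrightarrow>
     (\<forall>F :: complex \<Rightarrow> real. continuous_on UNIV F \<and> bounded (range F) \<longrightarrow>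
        (\<lambda>i. \<integral>z. F z \<partial>\<mu> i) \<longlonglongrightarrow> (\<integral>z. F z \<partial>\<nu>))"

definition weakly_convergent_complex :: "(nat \<Rightarrow> complex measure) \<Rightarrow> bool" where
  "weakly_convergent_complex \<mu> \<longleftrightarrow>
     (\<exists>\<nu>. prob_space \<nu> \<and> sets \<nu> = sets borel \<and> weak_conv_complex \<mu> \<nu>)"


subsection \<open>The groups and the Iwasawa decomposition\<close>

definition SL2R :: "(real^2^2) set" where
  "SL2R = {M. det M = 1}"

definition SL2Z :: "(real^2^2) set" where
  "SL2Z = {A. det A = 1 \<and> (\<forall>i j. A $ i $ j \<in> \<int>)}"

(* The elements are the cosets SL2Z M, as sets of matrices. *)
definition modular_quotient :: "(real^2^2) set set" where
  "modular_quotient =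
     SL2R // {(M, M'). M \<in> SL2R \<and> M' \<in> SL2R \<and> (\<exists>A\<in>SL2Z. M' = A ** M)}"

definition mat2 :: "real \<Rightarrow> real \<Rightarrow> real \<Rightarrow> real \<Rightarrow> real^2^2" where
  "mat2 a b c d = vector [vector [a, b], vector [c, d]]"

definition iwasawa :: "real \<Rightarrow> real \<Rightarrow> real \<Rightarrow> real^2^2" where
  "iwasawa u v \<phi> =
     mat2 1 u 0 1 ** mat2 (v powr (1/2)) 0 0 (v powr (-1/2))
       ** mat2 (cos \<phi>) (- sin \<phi>) (sin \<phi>) (cos \<phi>)"

definition iwasawa_coords :: "real^2^2 \<Rightarrow> real \<times> real \<times> real" where
  "iwasawa_coords M =
     (THE (u, v, \<phi>). v > 0 \<and> 0 \<le> \<phi> \<and> \<phi> < 2 * pi \<and> M = iwasawa u v \<phi>)"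


subsection \<open>Theta functions\<close>

definition chi :: "real \<Rightarrow> real" where
  "chi = indicator {0<..1}"

definition chi_rot :: "real \<Rightarrow> real \<Rightarrow> complex" where
  "chi_rot \<phi> w =
     (if \<exists>j::int. \<phi> = 2 * pi * of_int j then of_real (chi w)
      else if \<exists>j::int. \<phi> = pi + 2 * pi * of_int j then of_real (chi (- w))
      else of_real (\<bar>sin \<phi>\<bar> powr (-1/2)) *
        (\<integral>w'. e2pi (((w\<^sup>2 + w'\<^sup>2) / 2 * cos \<phi> - w * w') / sin \<phi>) * of_real (chi w') \<partial>lborel))"

definition theta_term :: "real^2^2 \<Rightarrow> int \<Rightarrow> real \<times> real \<Rightarrow> complex" where
  "theta_term M n = (\<lambda>(x, y). case iwasawa_coords M of (u, v, \<phi>) \<Rightarrow>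
     of_real (v powr (1/4)) * chi_rot \<phi> ((of_int n - y) * v powr (1/2))
       * e2pi ((of_int n - y)\<^sup>2 / 2 * u + of_int n * x))"

(* Summation over the integers is unconditional, in L^2 of the circle in the variable x.
   This determines f only almost everywhere; joint measurability selects a version
   for which the image measure below makes sense. *)
definition is_theta :: "real^2^2 \<Rightarrow> (real \<times> real \<Rightarrow> complex) \<Rightarrow> bool" where
  "is_theta M f \<longleftrightarrow>
     f \<in> borel_measurable borel \<and> (\<forall>x y. f (x + 1, y) = f (x, y)) \<and>
     (AE y in lborel.
       ((\<lambda>A. \<integral>\<^sup>+x. ennreal ((cmod (f (x, y) - (\<Sum>n\<in>A. theta_term M n (x, y))))\<^sup>2) \<partial>circle)
          \<longlongrightarrow> 0) (finite_subsets_at_top UNIV))"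

definition Theta :: "real^2^2 \<Rightarrow> real \<times> real \<Rightarrow> complex" where
  "Theta M = (SOME f. is_theta M f)"


subsection \<open>The limit family\<close>

definition nu :: "real^2^2 \<Rightarrow> complex measure" where
  "nu M = distr (circle \<Otimes>\<^sub>M (circle \<Otimes>\<^sub>M circle)) borel
     (\<lambda>(t, \<xi>). e2pi t * of_real (cmod (Theta M \<xi>)))"

(* nu depends only on the coset of M, so any representative may be used. *)
definition limit_family :: "complex measure set" where
  "limit_family = {nu M | M C. C \<in> modular_quotient \<and> M \<in> C} \<union> {return borel 0}"

end

theory Submission
  imports Defs "HOL-Analysis.Vitali_Covering_Theorem" "HOL-Analysis.Kronecker_Approximation_Theorem"
begin

text \<open>With \<open>u = l \<alpha>\<close>, the modulus of the normalised Birkhoff sum is that of a quadratic Weyl sum, which is the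
  theta function at the point \<open>u + \<i> / N\<^sup>2\<close> of the lifted horocycle. For each matrix the theta function is
  the Zak transform of a Weil transform \<open>K\<close> of \<open>\<chi>\<close>; the Zak transform is an isometry, so \<open>L\<^sup>2\<close> bounds for \<open>K\<close>
  control the laws. A single integration by parts gives the decay of \<open>K\<close>, hence continuity of the law
  wherever the lower left entry is nonzero, and convergence to \<open>\<delta>\<^sub>0\<close> when the lower row tends to \<open>0\<close>.

  Invariance under the modular group is needed only for upper triangular matrices, where \<open>K\<close> has compact support:
  there the \<open>x\<close>-Fourier coefficients of the transformed Zak transform are computed by unfolding and a Gauss sum,
  and Fourier uniqueness identifies the two functions.

  For the first claim, Dirichlet approximation moves every horocycle point to a matrix with lower
  row in \<open>[-1, 1]\<^sup>2\<close>, so a subsequence converges or escapes into the cusp. For the second claim, the set of \<open>u\<close> whose horocycle points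
  approach a given matrix contains, near each irrational \<open>u\<close> and at every scale given by a Dirichlet approximation \<open>p / q\<close>, an
  interval of length comparable to \<open>1 / q\<^sup>2\<close>; its complement is porous, hence null by Vitali's theorem.\<close>

section \<open>Exponentials and the circle\<close>

text \<open>The jumps of \<open>chi\<close> shape the argument: for c \<noteq> 0 its transforms
  decay only like 1/|w|, so the theta series converges in mean square but need not converge
  absolutely, and theta is determined only almost everywhere. All comparisons are therefore made on
  the fibres y = const, through sums of squares of the coefficients K(n - y), and are integrated in
  y only after a truncation. The limit laws carry an independent uniform phase t, so only the
  modulus of theta matters. Unimodular factors and measure preserving changes of (x, y) drop out,
  and no multiplier system has to be determined. Writing the kernel in matrix entries instead of
  Iwasawa coordinates gives one formula on the whole region c \<noteq> 0. This formula degenerates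
  at c = 0. Limits there are avoided by multiplying with a quarter turn, which exchanges the rows up
  to sign and so makes the lower left entry nonzero.\<close>

lemma e2pi_add: "e2pi (x + y) = e2pi x * e2pi y"
  by (simp add: e2pi_def exp_add distrib_left)

lemma e2pi_minus: "e2pi (- x) = cnj (e2pi x)"
  by (simp add: e2pi_def exp_cnj)

lemma e2pi_zero [simp]: "e2pi 0 = 1"
  by (simp add: e2pi_def)

lemma norm_e2pi [simp]: "cmod (e2pi x) = 1"
  by (simp add: e2pi_def)

lemma e2pi_cis: "e2pi x = cis (2 * pi * x)"
  by (simp add: e2pi_def cis_conv_exp mult_ac)

lemma e2pi_int [simp]: "e2pi (of_int n) = 1"
  unfolding e2pi_cis by (rule cis_multiple_2pi) simp

lemma e2pi_Ints: "x \<in> \<int> \<Longrightarrow> e2pi x = 1"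
  by (auto elim!: Ints_cases)

lemma e2pi_cong_Ints: "x - y \<in> \<int> \<Longrightarrow> e2pi x = e2pi y"
  using e2pi_add[of "x - y" y] e2pi_Ints[of "x - y"] by simp

lemma continuous_on_e2pi [continuous_intros]: "continuous_on A f \<Longrightarrow> continuous_on A (\<lambda>x. e2pi (f x))"
  unfolding e2pi_def by (intro continuous_intros)

lemma tendsto_e2pi [tendsto_intros]: "(f \<longlongrightarrow> a) F \<Longrightarrow> ((\<lambda>x. e2pi (f x)) \<longlongrightarrow> e2pi a) F"
  unfolding e2pi_def by (intro tendsto_intros)

lemma measurable_e2pi [measurable]: "e2pi \<in> borel_measurable borel"
  by (intro borel_measurable_continuous_onI continuous_intros)

lemma has_vector_derivative_e2pi:
  assumes "(f has_real_derivative f') (at x within A)"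
  shows "((\<lambda>x. e2pi (f x)) has_vector_derivative (2 * of_real pi * \<i> * of_real f' * e2pi (f x))) (at x within A)"
proof -
  have 1: "((\<lambda>x. complex_of_real (f x)) has_vector_derivative of_real f') (at x within A)"
    using assms by (intro has_vector_derivative_of_real) (simp add: has_real_derivative_iff_has_vector_derivative)
  have 2: "((\<lambda>x. 2 * of_real pi * \<i> * of_real (f x)) has_vector_derivative (2 * of_real pi * \<i> * of_real f')) (at x within A)"
    by (rule has_vector_derivative_mult_right[OF 1])
  note field_vector_diff_chain_within[OF 2 DERIV_exp[THEN has_field_derivative_at_within]]
  then show ?thesis by (simp add: e2pi_def o_def)
qed

lemma space_circle [simp]: "space circle = {0..<1}"
  by (simp add: circle_def space_restrict_space)

lemma prob_space_circle: "prob_space circle"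
  by (intro prob_spaceI) (simp add: circle_def emeasure_restrict_space space_restrict_space)

interpretation circle: prob_space circle by (rule prob_space_circle)
interpretation circle2: pair_prob_space circle circle ..
interpretation circle3: pair_prob_space circle "circle \<Otimes>\<^sub>M circle" ..

lemma measurable_id_circle [measurable]: "(\<lambda>x. x) \<in> measurable circle borel"
  by (simp add: circle_def measurable_restrict_space1)

lemma measurable_circle: "f \<in> measurable borel M \<Longrightarrow> f \<in> measurable circle M"
  using measurable_compose[OF measurable_id_circle] by auto

lemma measurable_circle2: "f \<in> measurable borel M \<Longrightarrow> f \<in> measurable (circle \<Otimes>\<^sub>M circle) M"
proof -
  assume f: "f \<in> measurable borel M"
  have "(\<lambda>(x, y). (x, y)) \<in> measurable (circle \<Otimes>\<^sub>M circle) (borel \<Otimes>\<^sub>M (borel :: real measure))"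
    by measurable
  then have "(\<lambda>z. z) \<in> measurable (circle \<Otimes>\<^sub>M circle) (borel :: (real \<times> real) measure)"
    by (simp add: borel_prod case_prod_beta')
  then show ?thesis using f by (rule measurable_compose)
qed

lemma integral_circle: 
  fixes f :: "real \<Rightarrow> 'a :: {banach, second_countable_topology}"
  shows "(\<integral>x. f x \<partial>circle) = (\<integral>x. indicator {0..<1} x *\<^sub>R f x \<partial>lborel)"
  unfolding circle_def by (subst integral_restrict_space) (auto simp: set_lebesgue_integral_def)

lemma nn_integral_circle: "(\<integral>\<^sup>+x. f x \<partial>circle) = (\<integral>\<^sup>+x. f x * indicator {0..<1} x \<partial>lborel)"
  unfolding circle_def by (subst nn_integral_restrict_space) auto

lemma AE_circle: "AE x in lborel. P x \<Longrightarrow> AE x in circle. P x"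
  unfolding circle_def by (subst AE_restrict_space_iff) auto

section \<open>Integration over the torus\<close>

lemma periodic_int:
  fixes f :: "real \<Rightarrow> 'a"
  assumes "\<And>x. f (x + 1) = f x"
  shows "f (x + of_int n) = f x"
proof -
  have nat: "f (x + of_nat k) = f x" for x k
  proof (induction k)
    case (Suc k)
    have "f (x + of_nat (Suc k)) = f ((x + of_nat k) + 1)" by (simp add: algebra_simps)
    with Suc assms show ?case by simp
  qed simp
  show ?thesis
  proof (cases "n \<ge> 0")
    case True
    with nat[of x "nat n"] show ?thesis by simp
  next
    case False
    with nat[of "x + of_int n" "nat (- n)"] show ?thesis by simp
  qed
qed

lemma periodic_frac:
  fixes f :: "real \<Rightarrow> 'a"
  assumes "\<And>x. f (x + 1) = f x"
  shows "f (frac x) = f x"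
  using periodic_int[of f "frac x" "\<lfloor>x\<rfloor>", OF assms] by (simp add: frac_def)

text \<open>Only the fractional part \<open>r\<close> of the shift matters. The translated window
  \<open>{r..<1 + r}\<close> is cut at 1 and its upper piece is moved back by one period.\<close>

lemma nn_integral_circle_shift:
  fixes f :: "real \<Rightarrow> ennreal"
  assumes [measurable]: "f \<in> borel_measurable borel" and per: "\<And>x. f (x + 1) = f x"
  shows "(\<integral>\<^sup>+x. f (x + s) \<partial>circle) = (\<integral>\<^sup>+x. f x \<partial>circle)"
proof -
  define r where "r = frac s"
  have r: "0 \<le> r" "r < 1" by (auto simp: r_def frac_lt_1)
  have *: "f (x + s) = f (x + r)" for x
    using periodic_int[of f "x + r" "\<lfloor>s\<rfloor>", OF per] by (simp add: r_def frac_def)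
  have "(\<integral>\<^sup>+x. f (x + s) \<partial>circle) = (\<integral>\<^sup>+x. f (r + 1 * x) * indicator {r..<1 + r} (r + 1 * x) \<partial>lborel)"
    unfolding nn_integral_circle * by (intro nn_integral_cong) (auto simp: indicator_def add.commute)
  also have "\<dots> = (\<integral>\<^sup>+x. f x * indicator {r..<1 + r} x \<partial>lborel)"
    using nn_integral_real_affine[of "\<lambda>x. f x * indicator {r..<1 + r} x" 1 r] by simp
  also have "\<dots> = (\<integral>\<^sup>+x. f x * indicator {r..<1} x + f x * indicator {1..<1 + r} x \<partial>lborel)"
    using r by (intro nn_integral_cong) (auto simp: indicator_def)
  also have "\<dots> = (\<integral>\<^sup>+x. f x * indicator {r..<1} x \<partial>lborel) + (\<integral>\<^sup>+x. f x * indicator {1..<1 + r} x \<partial>lborel)"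
    by (intro nn_integral_add) auto
  also have "(\<integral>\<^sup>+x. f x * indicator {1..<1 + r} x \<partial>lborel) = 
      (\<integral>\<^sup>+x. f (1 + 1 * x) * indicator {1..<1 + r} (1 + 1 * x) \<partial>lborel)"
    using nn_integral_real_affine[of "\<lambda>x. f x * indicator {1..<1 + r} x" 1 1] by simp
  also have "\<dots> = (\<integral>\<^sup>+x. f x * indicator {0..<r} x \<partial>lborel)"
    using per by (intro nn_integral_cong) (auto simp: indicator_def add.commute)
  also have "(\<integral>\<^sup>+x. f x * indicator {r..<1} x \<partial>lborel) + \<dots> =
      (\<integral>\<^sup>+x. f x * indicator {r..<1} x + f x * indicator {0..<r} x \<partial>lborel)"
    by (intro nn_integral_add[symmetric]) auto
  also have "\<dots> = (\<integral>\<^sup>+x. f x \<partial>circle)"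
    unfolding nn_integral_circle using r by (intro nn_integral_cong) (auto simp: indicator_def)
  finally show ?thesis .
qed

abbreviation torus :: "(real \<times> real) measure" where "torus \<equiv> circle \<Otimes>\<^sub>M circle"

lemma nn_integral_torus_shift:
  fixes f :: "real \<times> real \<Rightarrow> ennreal"
  assumes f: "f \<in> borel_measurable borel"
    and per: "\<And>x y. f (x + 1, y) = f (x, y)" "\<And>x y. f (x, y + 1) = f (x, y)"
  shows "(\<integral>\<^sup>+z. f (fst z + s, snd z + t) \<partial>torus) = (\<integral>\<^sup>+z. f z \<partial>torus)"
proof -
  have f'[measurable]: "f \<in> borel_measurable (borel \<Otimes>\<^sub>M borel)"
    using f by (simp add: borel_prod)
  have fib: "(\<integral>\<^sup>+z. g z \<partial>torus) = (\<integral>\<^sup>+x. \<integral>\<^sup>+y. g (x, y) \<partial>circle \<partial>circle)" if "g \<in> borel_measurable borel" for g :: "real \<times> real \<Rightarrow> ennreal"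
    by (subst circle.nn_integral_fst) (auto intro: measurable_circle2 that)
  have m1: "(\<lambda>z. f (fst z + s, snd z + t)) \<in> borel_measurable borel"
    unfolding borel_prod[symmetric] by measurable
  have "(\<integral>\<^sup>+z. f (fst z + s, snd z + t) \<partial>torus) = (\<integral>\<^sup>+x. \<integral>\<^sup>+y. f (x + s, y + t) \<partial>circle \<partial>circle)"
    by (subst fib[OF m1]) simp
  also have "\<dots> = (\<integral>\<^sup>+x. \<integral>\<^sup>+y. f (x + s, y) \<partial>circle \<partial>circle)"
    by (intro nn_integral_cong nn_integral_circle_shift[of "\<lambda>y. f (_, y)"]) (auto simp: per)
  also have "\<dots> = (\<integral>\<^sup>+x. \<integral>\<^sup>+y. f (x, y) \<partial>circle \<partial>circle)"
  proof (rule nn_integral_circle_shift[of "\<lambda>x. \<integral>\<^sup>+y. f (x, y) \<partial>circle"])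
    show "(\<lambda>x. \<integral>\<^sup>+ y. f (x, y) \<partial>circle) \<in> borel_measurable borel"
      by (rule circle.borel_measurable_nn_integral) measurable
  qed (simp add: per)
  finally show ?thesis by (simp add: fib[OF f])
qed

text \<open>An averaging argument replaces any decomposition of the integer matrix. The matrix is
  invertible over the reals, so every translation of the image point by \<open>w\<close> comes from
  a translation of the source and leaves the integral \<open>?I\<close> unchanged. Averaging over
  \<open>w\<close> and exchanging the integrals gives the integral of \<open>f\<close>. The
  determinant may be any nonzero integer, so maps that are not injective, such as t -> l t in one
  coordinate, are covered.\<close>

lemma nn_integral_torus_affine:
  fixes f :: "real \<times> real \<Rightarrow> ennreal" and a b c d :: int
  assumes f: "f \<in> borel_measurable borel"
    and per: "\<And>x y. f (x + 1, y) = f (x, y)" "\<And>x y. f (x, y + 1) = f (x, y)"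
    and det: "a * d - b * c \<noteq> 0"
  shows "(\<integral>\<^sup>+z. f (of_int a * fst z + of_int b * snd z + s, of_int c * fst z + of_int d * snd z + t) \<partial>torus)
     = (\<integral>\<^sup>+z. f z \<partial>torus)" (is "?I = _")
proof -
  have [measurable]: "f \<in> borel_measurable (borel \<Otimes>\<^sub>M borel)"
    using f by (simp add: borel_prod)
  define g where "g = (\<lambda>z::real\<times>real. f (of_int a * fst z + of_int b * snd z + s, of_int c * fst z + of_int d * snd z + t))"
  have g: "g \<in> borel_measurable borel"
    unfolding borel_prod[symmetric] g_def by measurable
  have per1: "f (x + of_int n, y) = f (x, y)" for x y n
    by (rule periodic_int[of "\<lambda>x. f (x, y)"]) (rule per)
  have per2: "f (x, y + of_int n) = f (x, y)" for x y n
    by (rule periodic_int[of "\<lambda>y. f (x, y)"]) (rule per)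
  have gper: "g (x + 1, y) = g (x, y)" "g (x, y + 1) = g (x, y)" for x y
    using per1[of "of_int a * x + of_int b * y + s" a] per1[of "of_int a * x + of_int b * y + s" b]
       per2[of _ "of_int c * x + of_int d * y + t" c] per2[of _ "of_int c * x + of_int d * y + t" d]
    by (simp_all add: g_def algebra_simps)
  define D where "D = real_of_int (a * d - b * c)"
  have D: "D \<noteq> 0" using det by (simp add: D_def del: of_int_diff of_int_mult)
  have shift: "(\<integral>\<^sup>+z. f (of_int a * fst z + of_int b * snd z + s + fst w, of_int c * fst z + of_int d * snd z + t + snd w) \<partial>torus) = ?I" for w
  proof -
    \<comment> \<open>Cramer's rule: (u, v) is the preimage of \<open>w\<close> under the linear
      part.\<close>
    define u where "u = (of_int d * fst w - of_int b * snd w) / D"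
    define v where "v = (of_int a * snd w - of_int c * fst w) / D"
    have "of_int a * (of_int d * fst w - of_int b * snd w) + of_int b * (of_int a * snd w - of_int c * fst w) = D * fst w"
      by (simp add: D_def algebra_simps)
    then have 1: "of_int a * u + of_int b * v = fst w" 
      using D by (simp add: u_def v_def flip: add_divide_distrib)
    have "of_int c * (of_int d * fst w - of_int b * snd w) + of_int d * (of_int a * snd w - of_int c * fst w) = D * snd w"
      by (simp add: D_def algebra_simps)
    then have 2: "of_int c * u + of_int d * v = snd w" 
      using D by (simp add: u_def v_def flip: add_divide_distrib)
    have "g (fst z + u, snd z + v) = f (of_int a * fst z + of_int b * snd z + s + fst w, of_int c * fst z + of_int d * snd z + t + snd w)" for z
      unfolding g_def 1[symmetric] 2[symmetric] by (simp add: algebra_simps)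
    then show ?thesis
      using nn_integral_torus_shift[OF g gper, of u v] by (simp add: g_def)
  qed
  have [measurable]: "f \<in> borel_measurable (torus)"
    using f by (rule measurable_circle2)
  have "?I = (\<integral>\<^sup>+w. ?I \<partial>torus)"
    using circle2.P.emeasure_space_1 by simp
  also have "\<dots> = (\<integral>\<^sup>+w. \<integral>\<^sup>+z. f (of_int a * fst z + of_int b * snd z + s + fst w, of_int c * fst z + of_int d * snd z + t + snd w) \<partial>torus \<partial>torus)"
    by (simp add: shift)
  also have "\<dots> = (\<integral>\<^sup>+z. \<integral>\<^sup>+w. f (of_int a * fst z + of_int b * snd z + s + fst w, of_int c * fst z + of_int d * snd z + t + snd w) \<partial>torus \<partial>torus)"
  proof (rule pair_sigma_finite.Fubini')
    show "pair_sigma_finite torus torus" by unfold_locales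
  qed measurable
  also have "\<dots> = (\<integral>\<^sup>+z. \<integral>\<^sup>+w. f w \<partial>torus \<partial>torus)"
  proof -
    have "(\<integral>\<^sup>+w. f (p + fst w, q + snd w) \<partial>torus) = (\<integral>\<^sup>+w. f w \<partial>torus)" for p q
      using nn_integral_torus_shift[OF f per, of p q] by (simp add: add.commute)
    then show ?thesis by simp
  qed
  also have "\<dots> = (\<integral>\<^sup>+w. f w \<partial>torus)"
    using circle2.P.emeasure_space_1 by simp
  finally show ?thesis .
qed

lemma integral_torus_affine:
  fixes f :: "real \<times> real \<Rightarrow> 'a :: {banach, second_countable_topology}" and a b c d :: int
  assumes f: "f \<in> borel_measurable borel"
    and per: "\<And>x y. f (x + 1, y) = f (x, y)" "\<And>x y. f (x, y + 1) = f (x, y)"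
    and det: "a * d - b * c \<noteq> 0"
  shows "(\<integral>z. f (of_int a * fst z + of_int b * snd z + s, of_int c * fst z + of_int d * snd z + t) \<partial>torus)
     = (\<integral>z. f z \<partial>torus)"
proof -
  \<comment> \<open>Reduced modulo 1, the affine map sends the fundamental domain to itself. The
    preceding identity, applied to indicators, shows that it preserves the measure, which carries
    the statement over to Bochner integrals.\<close>
  define T where "T = (\<lambda>z. (frac (of_int a * fst z + of_int b * snd z + s), frac (of_int c * fst z + of_int d * snd z + t)))"
  have [measurable]: "frac \<in> measurable borel circle"
  proof -
    have "frac \<in> borel_measurable (borel :: real measure)"
      using borel_measurable_diff[OF measurable_ident_sets[OF refl] borel_measurable_real_floor]
      by (simp add: frac_def[abs_def])
    then show ?thesis
      unfolding circle_def by (intro measurable_restrict_space2) (auto simp: frac_lt_1)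
  qed
  have T[measurable]: "T \<in> measurable torus torus"
    unfolding T_def by measurable
  have "distr torus torus T = torus"
  proof (rule measure_eqI)
    fix A assume "A \<in> sets (distr torus torus T)"
    then have A[measurable]: "A \<in> sets torus" by simp
    define g :: "real \<times> real \<Rightarrow> ennreal" where "g = (\<lambda>z. indicator A (frac (fst z), frac (snd z)))"
    have g: "g \<in> borel_measurable borel"
      unfolding borel_prod[symmetric] g_def by measurable
    have fr: "frac (x + 1) = frac x" for x :: real
      by (simp add: frac_def)
    have "emeasure (distr torus torus T) A = (\<integral>\<^sup>+z. indicator A (T z) \<partial>torus)"
      using nn_integral_distr[OF T, of "indicator A"] by (simp add: nn_integral_indicator)
    also have "\<dots> = (\<integral>\<^sup>+z. g (of_int a * fst z + of_int b * snd z + s, of_int c * fst z + of_int d * snd z + t) \<partial>torus)"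
      by (simp add: g_def T_def)
    also have "\<dots> = (\<integral>\<^sup>+z. g z \<partial>torus)"
      by (rule nn_integral_torus_affine[OF g _ _ det]) (simp_all add: g_def fr)
    also have "\<dots> = (\<integral>\<^sup>+z. indicator A z \<partial>torus)"
      by (intro nn_integral_cong) (auto simp: g_def space_pair_measure frac_eq)
    finally show "emeasure (distr torus torus T) A = emeasure torus A" by simp
  qed simp
  then have "(\<integral>z. f z \<partial>torus) = (\<integral>z. f z \<partial>distr torus torus T)" by simp
  also have "\<dots> = (\<integral>z. f (T z) \<partial>torus)"
    by (rule integral_distr) (auto intro: measurable_circle2 f)
  also have "(\<lambda>z. f (T z)) = (\<lambda>z. f (of_int a * fst z + of_int b * snd z + s, of_int c * fst z + of_int d * snd z + t))"
  proof
    show "f (T z) = f (of_int a * fst z + of_int b * snd z + s, of_int c * fst z + of_int d * snd z + t)" for z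
      unfolding T_def
      using per periodic_frac[of "\<lambda>x. f (x, y)" for y] periodic_frac[of "\<lambda>y. f (x, y)" for x] by metis
  qed
  finally show ?thesis by simp
qed

text \<open>The planar statement for the matrix diag(a, 1), applied to a function of the first
  coordinate alone.\<close>

lemma integral_circle_affine:
  fixes f :: "real \<Rightarrow> 'a :: {banach, second_countable_topology}" and a :: int
  assumes f: "f \<in> borel_measurable borel" and per: "\<And>x. f (x + 1) = f x" and a: "a \<noteq> 0"
  shows "(\<integral>x. f (of_int a * x + s) \<partial>circle) = (\<integral>x. f x \<partial>circle)"
proof -
  have [measurable]: "f \<in> borel_measurable (borel)" "f \<in> borel_measurable circle" using f by (auto intro: measurable_circle)
  have marg: "(\<integral>z. h (fst z) \<partial>torus) = (\<integral>x. h x \<partial>circle)" if "h \<in> borel_measurable circle" for h :: "real \<Rightarrow> 'a"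
    using integral_distr[of fst torus circle h] that circle.distr_pair_fst[of circle]
      circle.emeasure_space_1 by simp
  have f2: "(\<lambda>z. f (fst z)) \<in> borel_measurable (borel :: (real \<times> real) measure)"
    unfolding borel_prod[symmetric] by measurable
  have m: "(\<lambda>x. f (of_int a * x + s)) \<in> borel_measurable circle"
    by measurable
  show ?thesis
    using integral_torus_affine[OF f2, of a 1 0 0 s 0] marg[OF m] marg[of f] a by (simp add: per)
qed

text \<open>Integrating a test function over the independent uniform phase leaves a continuous
  function of the modulus, so weak convergence of the laws reduces to convergence of the moduli in
  measure.\<close>

definition rotation_average :: "(complex \<Rightarrow> real) \<Rightarrow> real \<Rightarrow> real" where
  "rotation_average F r = (\<integral>t. F (e2pi t * of_real r) \<partial>circle)"

text \<open>\<open>nu M\<close> is the case f = \<open>Theta M\<close>.\<close>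

definition law :: "(real \<times> real \<Rightarrow> complex) \<Rightarrow> complex measure" where
  "law f = distr (circle \<Otimes>\<^sub>M torus) borel (\<lambda>(t, \<xi>). e2pi t * of_real (cmod (f \<xi>)))"

context
  fixes F :: "complex \<Rightarrow> real"
  assumes contF: "continuous_on UNIV F" and boundF: "bounded (range F)"
begin

lemma bound_witness: obtains B where "\<And>z. \<bar>F z\<bar> \<le> B"
  using boundF by (auto simp: bounded_iff)

lemma measurable_F [measurable]: "F \<in> borel_measurable borel"
  by (intro borel_measurable_continuous_onI contF)

lemma integral_law:
  assumes [measurable]: "f \<in> borel_measurable borel"
  shows "(\<integral>z. F z \<partial>law f) = (\<integral>\<xi>. rotation_average F (cmod (f \<xi>)) \<partial>torus)"
proof -
  obtain B where B: "\<And>z. \<bar>F z\<bar> \<le> B" by (rule bound_witness) auto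
  have f[measurable]: "f \<in> borel_measurable torus" by (intro measurable_circle2 assms)
  have m: "(\<lambda>(t, \<xi>). F (e2pi t * of_real (cmod (f \<xi>)))) \<in> borel_measurable (circle \<Otimes>\<^sub>M torus)"
    by measurable
  have "(\<integral>z. F z \<partial>law f) = (\<integral>(t,\<xi>). F (e2pi t * of_real (cmod (f \<xi>))) \<partial>(circle \<Otimes>\<^sub>M torus))"
    unfolding law_def by (subst integral_distr) (auto simp: case_prod_beta')
  also have "\<dots> = (\<integral>\<xi>. \<integral>t. F (e2pi t * of_real (cmod (f \<xi>))) \<partial>circle \<partial>torus)"
    by (rule circle3.integral_snd[symmetric], rule circle3.P.integrable_const_bound[where B = B])
       (use B m in auto)
  finally show ?thesis by (simp add: rotation_average_def)
qed

lemma continuous_rotation_average: "continuous_on UNIV (rotation_average F)"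
proof -
  obtain B where B: "\<And>z. \<bar>F z\<bar> \<le> B" by (rule bound_witness) auto
  have "(\<lambda>i. rotation_average F (x i)) \<longlonglongrightarrow> rotation_average F a" if x: "x \<longlonglongrightarrow> a" for x a
    unfolding rotation_average_def
  proof (rule integral_dominated_convergence[where w = "\<lambda>_. B"])
    have "(\<lambda>i. e2pi t * of_real (x i)) \<longlonglongrightarrow> e2pi t * of_real a" for t
      by (intro tendsto_intros x)
    then have "(\<lambda>i. F (e2pi t * of_real (x i))) \<longlonglongrightarrow> F (e2pi t * of_real a)" for t
      by (rule continuous_on_tendsto_compose[OF contF]) auto
    then show "AE t in circle. (\<lambda>i. F (e2pi t * of_real (x i))) \<longlonglongrightarrow> F (e2pi t * of_real a)"
      by auto
  qed (use B in auto)
  then show ?thesis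
    by (auto simp: continuous_on_sequentially o_def)
qed

lemma rotation_average_bounded: obtains B where "\<And>r. \<bar>rotation_average F r\<bar> \<le> B"
proof -
  obtain B where B: "\<And>z. \<bar>F z\<bar> \<le> B" by (rule bound_witness) auto
  have "\<bar>rotation_average F r\<bar> \<le> B" for r
  proof -
    have "\<bar>rotation_average F r\<bar> \<le> (\<integral>t. \<bar>F (e2pi t * of_real r)\<bar> \<partial>circle)"
      unfolding rotation_average_def by (rule integral_abs_bound)
    also have "\<dots> \<le> (\<integral>t. B \<partial>circle)"
      by (intro integral_mono circle.integrable_const_bound[where B = B]) (auto simp: B intro: order_trans[OF abs_ge_zero B])
    finally show ?thesis using circle.prob_space by simp
  qed
  then show ?thesis by (rule that)
qed

lemma measurable_rotation_average [measurable]: "rotation_average F \<in> borel_measurable borel"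
  by (intro borel_measurable_continuous_onI continuous_rotation_average)

text \<open>With z = e(\<theta>) |z| the phase becomes l t + \<theta>, an affine self-map of the
  circle that preserves its measure because l \<noteq> 0.\<close>

lemma rotation_average_rotate:
  assumes l: "l \<noteq> 0"
  shows "(\<integral>t. F (e2pi (of_int l * t) * z) \<partial>circle) = rotation_average F (cmod z)"
proof -
  obtain \<theta> where z: "z = e2pi \<theta> * of_real (cmod z)"
  proof -
    have "z = e2pi (Arg z / (2 * pi)) * of_real (cmod z)"
      using rcis_cmod_Arg[of z] by (simp add: e2pi_cis rcis_def mult.commute)
    then show ?thesis by (rule that)
  qed
  have "e2pi (of_int l * t) * z = e2pi (of_int l * t + \<theta>) * of_real (cmod z)" for t
    by (subst z) (simp add: e2pi_add)
  then have "(\<integral>t. F (e2pi (of_int l * t) * z) \<partial>circle) = (\<integral>t. F (e2pi (of_int l * t + \<theta>) * of_real (cmod z)) \<partial>circle)"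
    by simp
  also have "\<dots> = rotation_average F (cmod z)"
    unfolding rotation_average_def
    by (rule integral_circle_affine[where f = "\<lambda>t. F (e2pi t * of_real (cmod z))"])
       (use l e2pi_int[of 1] in \<open>auto simp: e2pi_add\<close>)
  finally show ?thesis .
qed

end

section \<open>Zak transforms and weak convergence\<close>

lemma cmod_square_add3: "(cmod (a + b + c))\<^sup>2 \<le> 3 * (cmod a)\<^sup>2 + 3 * (cmod b)\<^sup>2 + 3 * (cmod c)\<^sup>2"
proof -
  have "cmod (a + b + c) \<le> cmod a + cmod b + cmod c"
    by (meson norm_triangle_ineq norm_triangle_mono order_refl order_trans add_right_mono)
  then have "(cmod (a + b + c))\<^sup>2 \<le> (cmod a + cmod b + cmod c)\<^sup>2"
    by (intro power_mono) auto
  also have "\<dots> \<le> 3 * (cmod a)\<^sup>2 + 3 * (cmod b)\<^sup>2 + 3 * (cmod c)\<^sup>2"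
    using sum_squares_ge_zero[of "cmod a - cmod b" "cmod b - cmod c"] zero_le_power2[of "cmod a - cmod c"]
    by (simp add: power2_eq_square algebra_simps)
  finally show ?thesis .
qed

lemma integrable_circle_e2pi [simp]: "integrable circle (\<lambda>x. e2pi (a * x))"
  by (rule circle.integrable_const_bound[where B = 1]) (auto intro!: measurable_circle)

lemma integral_circle_e2pi: "(\<integral>x. e2pi (of_int n * x) \<partial>circle) = (if n = 0 then 1 else 0)"
proof (cases "n = 0")
  case True
  then show ?thesis using circle.prob_space by simp
next
  case False
  \<comment> \<open>Half a period of the character: translating by \<open>s\<close> changes its
    sign, so the integral equals its own negative.\<close>
  define s where "s = 1 / (2 * real_of_int n)"
  have "(\<integral>x. e2pi (of_int n * x) \<partial>circle) = (\<integral>x. e2pi (of_int n * (of_int 1 * x + s)) \<partial>circle)"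
    by (rule integral_circle_affine[symmetric]) (auto simp: distrib_left e2pi_add)
  also have "\<dots> = (\<integral>x. e2pi (of_int n * s) * e2pi (of_int n * x) \<partial>circle)"
    by (simp add: distrib_left e2pi_add mult.commute)
  also have "e2pi (of_int n * s) = -1"
    using False by (simp add: s_def e2pi_cis)
  finally show ?thesis using False by simp
qed

lemma fourier_coefficient_sum:
  assumes "finite A" 
  shows "(\<integral>x. (\<Sum>n\<in>A. c n * e2pi (of_int n * x)) * e2pi (- (of_int m * x)) \<partial>circle) = (if m \<in> A then c m else 0)"
proof -
  have "(\<integral>x. (\<Sum>n\<in>A. c n * e2pi (of_int n * x)) * e2pi (- (of_int m * x)) \<partial>circle) =
     (\<integral>x. (\<Sum>n\<in>A. c n * e2pi (of_int (n - m) * x)) \<partial>circle)"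
    by (simp add: sum_distrib_right mult.assoc left_diff_distrib flip: e2pi_add)
  also have "\<dots> = (\<Sum>n\<in>A. c n * (\<integral>x. e2pi (of_int (n - m) * x) \<partial>circle))"
    by (subst Bochner_Integration.integral_sum) (auto simp del: of_int_diff)
  also have "\<dots> = (\<Sum>n\<in>A. if n = m then c n else 0)"
    unfolding integral_circle_e2pi by (intro sum.cong) auto
  finally show ?thesis using assms by simp
qed

lemma parseval_sum:
  assumes "finite A"
  shows "(\<integral>\<^sup>+x. ennreal ((cmod (\<Sum>n\<in>A. c n * e2pi (of_int n * x)))\<^sup>2) \<partial>circle) = ennreal (\<Sum>n\<in>A. (cmod (c n))\<^sup>2)"
proof -
  let ?S = "\<lambda>x. \<Sum>n\<in>A. c n * e2pi (of_int n * x)"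
  have bd: "cmod (?S x) \<le> (\<Sum>n\<in>A. cmod (c n))" for x
    by (rule order_trans[OF norm_sum]) (simp add: norm_mult)
  have int: "integrable circle (\<lambda>x. (cmod (?S x))\<^sup>2)"
    by (rule circle.integrable_const_bound[where B = "(\<Sum>n\<in>A. cmod (c n))\<^sup>2"])
       (auto intro!: measurable_circle power_mono bd)
  have "complex_of_real (\<integral>x. (cmod (?S x))\<^sup>2 \<partial>circle) = (\<integral>x. complex_of_real ((cmod (?S x))\<^sup>2) \<partial>circle)"
    by (rule integral_complex_of_real[symmetric])
  also have "\<dots> = (\<integral>x. (\<Sum>m\<in>A. cnj (c m) * (?S x * e2pi (- (of_int m * x)))) \<partial>circle)"
    unfolding complex_norm_square by (intro Bochner_Integration.integral_cong) (auto simp: sum_distrib_left e2pi_minus mult_ac)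
  also have "\<dots> = (\<Sum>m\<in>A. cnj (c m) * (\<integral>x. ?S x * e2pi (- (of_int m * x)) \<partial>circle))"
  proof (subst Bochner_Integration.integral_sum)
    fix m
    have "integrable circle (\<lambda>x. ?S x * e2pi (- (of_int m * x)))"
      by (rule circle.integrable_const_bound[where B = "(\<Sum>n\<in>A. cmod (c n))"])
       (auto intro!: measurable_circle bd simp: norm_mult)
    then show "integrable circle (\<lambda>x. cnj (c m) * (?S x * e2pi (- (of_int m * x))))" by simp
  qed simp
  also have "\<dots> = (\<Sum>m\<in>A. cnj (c m) * c m)"
    unfolding fourier_coefficient_sum[OF assms] by simp
  also have "\<dots> = complex_of_real (\<Sum>n\<in>A. (cmod (c n))\<^sup>2)"
    by (simp add: complex_norm_square mult.commute del: of_real_power)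
  finally have "(\<integral>x. (cmod (?S x))\<^sup>2 \<partial>circle) = (\<Sum>n\<in>A. (cmod (c n))\<^sup>2)"
    using of_real_eq_iff by blast
  then show ?thesis
    using nn_integral_eq_integral[OF int] by simp
qed

text \<open>The Zak transform of \<open>K\<close>, up to convention: on the fibre over y the numbers
  K(n - y) are the Fourier coefficients in x. Convergence is unconditional in mean square, as in
  \<open>is_theta\<close>, so \<open>f\<close> is determined only up to null sets.\<close>

definition zak :: "(real \<Rightarrow> complex) \<Rightarrow> (real \<times> real \<Rightarrow> complex) \<Rightarrow> bool" where
  "zak K f \<longleftrightarrow> f \<in> borel_measurable borel \<and> (AE y in lborel.
    ((\<lambda>A. \<integral>\<^sup>+x. ennreal ((cmod (f (x, y) - (\<Sum>n\<in>A. K (of_int n - y) * e2pi (of_int n * x))))\<^sup>2) \<partial>circle)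
       \<longlongrightarrow> 0) (finite_subsets_at_top UNIV))"

lemma zak_zero: "zak (\<lambda>_. 0) (\<lambda>_. 0)"
  by (simp add: zak_def)

lemma measurable_section:
  assumes "f \<in> borel_measurable (borel :: (real \<times> real) measure)"
  shows "(\<lambda>x. f (x, y)) \<in> borel_measurable borel"
proof -
  have "f \<in> borel_measurable (borel \<Otimes>\<^sub>M borel)" using assms by (simp add: borel_prod)
  then show ?thesis by measurable
qed

text \<open>Both functions are compared with their partial sums over the same finite set
  \<open>A\<close>. Parseval controls the difference of the partial sums, and the two outer errors
  vanish along \<open>finite_subsets_at_top\<close>. The factor 3 is that of
  \<open>cmod_square_add3\<close>. The bound \<open>s\<close> is quantified inside the almost
  everywhere statement, so it may be chosen separately for each y.\<close>

lemma zak_distance: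
  assumes f: "zak K f" and f': "zak K' f'"
  shows "AE y in lborel. \<forall>s. (\<forall>A. finite A \<longrightarrow> (\<Sum>n\<in>A. (cmod (K (of_int n - y) - K' (of_int n - y)))\<^sup>2) \<le> s) \<longrightarrow>
     (\<integral>\<^sup>+x. ennreal ((cmod (f (x, y) - f' (x, y)))\<^sup>2) \<partial>circle) \<le> ennreal (3 * s)"
proof -
  have meas: "f \<in> borel_measurable borel" "f' \<in> borel_measurable borel"
    using f f' by (auto simp: zak_def)
  have 1: "AE y in lborel. ((\<lambda>A. \<integral>\<^sup>+x. ennreal ((cmod (f (x, y) - (\<Sum>n\<in>A. K (of_int n - y) * e2pi (of_int n * x))))\<^sup>2) \<partial>circle)
       \<longlongrightarrow> 0) (finite_subsets_at_top UNIV)" using f by (simp add: zak_def)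
  have 2: "AE y in lborel. ((\<lambda>A. \<integral>\<^sup>+x. ennreal ((cmod (f' (x, y) - (\<Sum>n\<in>A. K' (of_int n - y) * e2pi (of_int n * x))))\<^sup>2) \<partial>circle)
       \<longlongrightarrow> 0) (finite_subsets_at_top UNIV)" using f' by (simp add: zak_def)
  from 1 2 show ?thesis
  proof eventually_elim
    case (elim y)
    show ?case
    proof (intro allI impI)
      fix s assume s: "\<forall>A. finite A \<longrightarrow> (\<Sum>n\<in>A. (cmod (K (of_int n - y) - K' (of_int n - y)))\<^sup>2) \<le> s"
      let ?S = "\<lambda>A x. \<Sum>n\<in>A. K (of_int n - y) * e2pi (of_int n * x)"
      let ?S' = "\<lambda>A x. \<Sum>n\<in>A. K' (of_int n - y) * e2pi (of_int n * x)"
      let ?a = "\<lambda>A. \<integral>\<^sup>+x. ennreal ((cmod (f (x, y) - ?S A x))\<^sup>2) \<partial>circle"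
      let ?b = "\<lambda>A. \<integral>\<^sup>+x. ennreal ((cmod (f' (x, y) - ?S' A x))\<^sup>2) \<partial>circle"
      have [measurable]: "(\<lambda>x. f (x, y)) \<in> borel_measurable circle" "(\<lambda>x. f' (x, y)) \<in> borel_measurable circle"
        by (intro measurable_circle measurable_section meas)+
      have le: "(\<integral>\<^sup>+x. ennreal ((cmod (f (x, y) - f' (x, y)))\<^sup>2) \<partial>circle) \<le> 3 * ?a A + 3 * ennreal s + 3 * ?b A"
        if A: "finite A" for A
      proof -
        have "ennreal ((cmod (f (x, y) - f' (x, y)))\<^sup>2) \<le> 
            3 * ennreal ((cmod (f (x, y) - ?S A x))\<^sup>2) + 3 * ennreal ((cmod (?S A x - ?S' A x))\<^sup>2)
             + 3 * ennreal ((cmod (f' (x, y) - ?S' A x))\<^sup>2)" for x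
        proof -
          have "(cmod (f (x, y) - f' (x, y)))\<^sup>2 \<le> 3 * (cmod (f (x, y) - ?S A x))\<^sup>2 + 3 * (cmod (?S A x - ?S' A x))\<^sup>2
             + 3 * (cmod (f' (x, y) - ?S' A x))\<^sup>2"
            using cmod_square_add3[of "f (x, y) - ?S A x" "?S A x - ?S' A x" "?S' A x - f' (x, y)"]
            by (simp add: norm_minus_commute[of "f' (x, y)"])
          then show ?thesis
            by (subst (asm) ennreal_le_iff[symmetric]) (auto simp: ennreal_mult ennreal_plus simp del: ennreal_power)
        qed
        then have "(\<integral>\<^sup>+x. ennreal ((cmod (f (x, y) - f' (x, y)))\<^sup>2) \<partial>circle) \<le>
          (\<integral>\<^sup>+x. 3 * ennreal ((cmod (f (x, y) - ?S A x))\<^sup>2) + 3 * ennreal ((cmod (?S A x - ?S' A x))\<^sup>2)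
             + 3 * ennreal ((cmod (f' (x, y) - ?S' A x))\<^sup>2) \<partial>circle)"
          by (intro nn_integral_mono)
        also have "\<dots> = 3 * ?a A + 3 * (\<integral>\<^sup>+x. ennreal ((cmod (?S A x - ?S' A x))\<^sup>2) \<partial>circle) + 3 * ?b A"
          by (simp add: nn_integral_add nn_integral_cmult)
        also have "(\<integral>\<^sup>+x. ennreal ((cmod (?S A x - ?S' A x))\<^sup>2) \<partial>circle) = 
           ennreal (\<Sum>n\<in>A. (cmod (K (of_int n - y) - K' (of_int n - y)))\<^sup>2)"
          using parseval_sum[OF A, of "\<lambda>n. K (of_int n - y) - K' (of_int n - y)"]
          by (simp add: left_diff_distrib sum_subtractf)
        also have "\<dots> \<le> ennreal s" using s A by (intro ennreal_leI) auto
        finally show ?thesis by (simp add: add_left_mono add_right_mono mult_left_mono)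
      qed
      have s0: "s \<ge> 0" using s[rule_format, of "{}"] by simp
      have "((\<lambda>A. 3 * ?a A + 3 * ennreal s + 3 * ?b A) \<longlongrightarrow> 3 * 0 + 3 * ennreal s + 3 * 0) (finite_subsets_at_top UNIV)"
        by (intro tendsto_add tendsto_const tendsto_mult_ennreal elim) auto
      then have "(\<integral>\<^sup>+x. ennreal ((cmod (f (x, y) - f' (x, y)))\<^sup>2) \<partial>circle) \<le> 3 * 0 + 3 * ennreal s + 3 * 0"
        by (rule tendsto_lowerbound) (auto intro!: eventually_finite_subsets_at_top_weakI le)
      then show "(\<integral>\<^sup>+x. ennreal ((cmod (f (x, y) - f' (x, y)))\<^sup>2) \<partial>circle) \<le> ennreal (3 * s)"
        using s0 by (simp add: ennreal_mult)
    qed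
  qed
qed

section \<open>From square bounds on fibres to weak convergence of laws\<close>

text \<open>The truncated square is integrable whatever the tails of \<open>X j\<close>, and its
  mean tends to 0 exactly when \<open>X j\<close> tends to \<open>Y\<close> in measure. A
  subsequence violating the conclusion would have a further subsequence converging almost
  everywhere, which dominated convergence excludes.\<close>

lemma integral_tendsto_of_convergence_in_measure:
  fixes X :: "nat \<Rightarrow> 'a \<Rightarrow> complex" and J :: "real \<Rightarrow> real"
  assumes M: "prob_space M" and X[measurable]: "\<And>j. X j \<in> borel_measurable M" and Y[measurable]: "Y \<in> borel_measurable M"
    and lim: "(\<lambda>j. \<integral>\<xi>. min 1 ((cmod (X j \<xi> - Y \<xi>))\<^sup>2) \<partial>M) \<longlonglongrightarrow> 0"
    and J: "continuous_on UNIV J" "\<And>r. \<bar>J r\<bar> \<le> B"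
  shows "(\<lambda>j. \<integral>\<xi>. J (cmod (X j \<xi>)) \<partial>M) \<longlonglongrightarrow> (\<integral>\<xi>. J (cmod (Y \<xi>)) \<partial>M)"
proof (rule ccontr)
  interpret prob_space M by fact
  have [measurable]: "J \<in> borel_measurable borel"
    by (intro borel_measurable_continuous_onI J)
  let ?a = "\<lambda>j. \<integral>\<xi>. J (cmod (X j \<xi>)) \<partial>M" and ?L = "\<integral>\<xi>. J (cmod (Y \<xi>)) \<partial>M"
  assume "\<not> ?a \<longlonglongrightarrow> ?L"
  then obtain \<epsilon> where \<epsilon>: "\<epsilon> > 0" "\<And>N. \<exists>n\<ge>N. dist (?a n) ?L \<ge> \<epsilon>"
    unfolding lim_sequentially by (metis not_le)
  then have "infinite {n. dist (?a n) ?L \<ge> \<epsilon>}"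
    by (simp add: infinite_nat_iff_unbounded_le)
  then obtain r :: "nat \<Rightarrow> nat" where r: "strict_mono r" "\<And>n. r n \<in> {n. dist (?a n) ?L \<ge> \<epsilon>}"
    using infinite_enumerate by blast
  have "\<exists>s. strict_mono s \<and> (AE \<xi> in M. (\<lambda>n. min 1 ((cmod (X (r (s n)) \<xi> - Y \<xi>))\<^sup>2)) \<longlonglongrightarrow> 0)"
  proof (rule tendsto_L1_AE_subseq[of M "\<lambda>n \<xi>. min 1 ((cmod (X (r n) \<xi> - Y \<xi>))\<^sup>2)"])
    show "integrable M (\<lambda>\<xi>. min 1 ((cmod (X (r n) \<xi> - Y \<xi>))\<^sup>2))" for n
      by (rule integrable_const_bound[where B = 1]) auto
    show "(\<lambda>n. \<integral>\<xi>. norm (min 1 ((cmod (X (r n) \<xi> - Y \<xi>))\<^sup>2)) \<partial>M) \<longlonglongrightarrow> 0"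
      using LIMSEQ_subseq_LIMSEQ[OF lim r(1)] by (simp add: o_def)
  qed
  then obtain s where s: "strict_mono s" "AE \<xi> in M. (\<lambda>n. min 1 ((cmod (X (r (s n)) \<xi> - Y \<xi>))\<^sup>2)) \<longlonglongrightarrow> 0"
    by blast
  have "(\<lambda>n. ?a (r (s n))) \<longlonglongrightarrow> ?L"
  proof (rule integral_dominated_convergence[where w = "\<lambda>_. B"])
    show "AE \<xi> in M. (\<lambda>n. J (cmod (X (r (s n)) \<xi>))) \<longlonglongrightarrow> J (cmod (Y \<xi>))"
      using s(2)
    proof eventually_elim
      case (elim \<xi>)
      have "\<forall>\<^sub>F n in sequentially. min 1 ((cmod (X (r (s n)) \<xi> - Y \<xi>))\<^sup>2) < 1"
        using order_tendstoD(2)[OF elim, of 1] by simp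
      then have "(\<lambda>n. (cmod (X (r (s n)) \<xi> - Y \<xi>))\<^sup>2) \<longlonglongrightarrow> 0"
        by (intro Lim_transform_eventually[OF elim]) (auto elim!: eventually_mono)
      then have "(\<lambda>n. sqrt ((cmod (X (r (s n)) \<xi> - Y \<xi>))\<^sup>2)) \<longlonglongrightarrow> sqrt 0"
        by (rule tendsto_real_sqrt)
      then have "(\<lambda>n. X (r (s n)) \<xi> - Y \<xi>) \<longlonglongrightarrow> 0"
        by (simp add: tendsto_norm_zero_iff)
      then have "(\<lambda>n. X (r (s n)) \<xi>) \<longlonglongrightarrow> Y \<xi>"
        by (simp add: LIM_zero_iff)
      then have "(\<lambda>n. cmod (X (r (s n)) \<xi>)) \<longlonglongrightarrow> cmod (Y \<xi>)" by (rule tendsto_norm)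
      then show ?case by (rule continuous_on_tendsto_compose[OF J(1)]) auto
    qed
  qed (use J in auto)
  then have "\<forall>\<^sub>F n in sequentially. dist (?a (r (s n))) ?L < \<epsilon>"
    using \<epsilon>(1) by (simp add: tendsto_iff)
  then show False
    using r(2) by (auto simp: eventually_sequentially not_less[symmetric])
qed

text \<open>The bounds \<open>s\<close> may depend on y without any uniformity: the truncation at 1
  supplies the dominating function for the integration over y.\<close>

lemma law_convergence:
  fixes f :: "nat \<Rightarrow> real \<times> real \<Rightarrow> complex"
  assumes f: "\<And>j. zak (K j) (f j)" and f0: "zak K0 f0"
    and lim: "AE y in lborel. \<exists>s. (\<forall>\<^sub>F j in sequentially. \<forall>A. finite A \<longrightarrow> (\<Sum>n\<in>A. (cmod (K j (of_int n - y) - K0 (of_int n - y)))\<^sup>2) \<le> s j)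
       \<and> s \<longlonglongrightarrow> 0"
  shows "weak_conv_complex (\<lambda>j. law (f j)) (law f0)"
  unfolding weak_conv_complex_def
proof safe
  fix F :: "complex \<Rightarrow> real"
  assume F: "continuous_on UNIV F" "bounded (range F)"
  have mb: "f j \<in> borel_measurable borel" "f0 \<in> borel_measurable borel" for j
    using f f0 by (auto simp: zak_def)
  then have [measurable]: "f j \<in> borel_measurable torus" "f0 \<in> borel_measurable torus" for j
    by (auto intro: measurable_circle2)
  obtain B where B: "\<And>r. \<bar>rotation_average F r\<bar> \<le> B" using rotation_average_bounded[OF F] by auto
  let ?u = "\<lambda>j \<xi>. min 1 ((cmod (f j \<xi> - f0 \<xi>))\<^sup>2)"
  have "(\<lambda>j. \<integral>\<^sup>+\<xi>. ennreal (?u j \<xi>) \<partial>torus) \<longlonglongrightarrow> 0"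
  proof -
    have eq: "(\<integral>\<^sup>+\<xi>. ennreal (?u j \<xi>) \<partial>torus) = (\<integral>\<^sup>+y. \<integral>\<^sup>+x. ennreal (?u j (x, y)) \<partial>circle \<partial>circle)" for j
      by (rule circle2.nn_integral_snd[symmetric, of "\<lambda>\<xi>. ennreal (?u j \<xi>)", unfolded split_def]) measurable
    have "(\<lambda>j. \<integral>\<^sup>+y. \<integral>\<^sup>+x. ennreal (?u j (x, y)) \<partial>circle \<partial>circle) \<longlonglongrightarrow> (\<integral>\<^sup>+y. 0 \<partial>circle)"
    proof (rule nn_integral_dominated_convergence[where w = "\<lambda>_. 1"])
      have "AE y in lborel. (\<lambda>j. \<integral>\<^sup>+x. ennreal (?u j (x, y)) \<partial>circle) \<longlonglongrightarrow> 0"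
      proof -
        have "AE y in lborel. \<forall>j. \<forall>s. (\<forall>A. finite A \<longrightarrow> (\<Sum>n\<in>A. (cmod (K j (of_int n - y) - K0 (of_int n - y)))\<^sup>2) \<le> s) \<longrightarrow>
            (\<integral>\<^sup>+x. ennreal ((cmod (f j (x, y) - f0 (x, y)))\<^sup>2) \<partial>circle) \<le> ennreal (3 * s)"
          by (subst AE_all_countable) (intro allI zak_distance f f0)
        with lim show ?thesis
        proof eventually_elim
          case (elim y)
          note bound = elim(2)
          from elim(1) obtain s where s: "\<forall>\<^sub>F j in sequentially. \<forall>A. finite A \<longrightarrow> (\<Sum>n\<in>A. (cmod (K j (of_int n - y) - K0 (of_int n - y)))\<^sup>2) \<le> s j" "s \<longlonglongrightarrow> 0"
            by blast
          have "\<forall>\<^sub>F j in sequentially. (\<integral>\<^sup>+x. ennreal (?u j (x, y)) \<partial>circle) \<le> ennreal (3 * s j)"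
            using s(1)
          proof eventually_elim
            case (elim j)
            have "(\<integral>\<^sup>+x. ennreal (?u j (x, y)) \<partial>circle) \<le> (\<integral>\<^sup>+x. ennreal ((cmod (f j (x, y) - f0 (x, y)))\<^sup>2) \<partial>circle)"
              by (intro nn_integral_mono ennreal_leI) simp
            also have "\<dots> \<le> ennreal (3 * s j)" using bound elim by blast
            finally show ?case .
          qed
          moreover have "(\<lambda>j. ennreal (3 * s j)) \<longlonglongrightarrow> 0"
            using tendsto_ennrealI[OF tendsto_mult_left[OF s(2), of 3]] by simp
          ultimately show ?case
            by (rule tendsto_sandwich[OF always_eventually[OF allI[OF zero_le]] _ tendsto_const])
        qed
      qed
      then show "AE y in circle. (\<lambda>j. \<integral>\<^sup>+x. ennreal (?u j (x, y)) \<partial>circle) \<longlonglongrightarrow> 0"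
        by (rule AE_circle)
      show "AE y in circle. (\<integral>\<^sup>+x. ennreal (?u j (x, y)) \<partial>circle) \<le> 1" for j
      proof (intro AE_I2)
        fix y
        have "(\<integral>\<^sup>+x. ennreal (?u j (x, y)) \<partial>circle) \<le> (\<integral>\<^sup>+x. 1 \<partial>circle)"
          by (intro nn_integral_mono) (simp flip: ennreal_1 add: ennreal_leI del: ennreal_1)
        then show "(\<integral>\<^sup>+x. ennreal (?u j (x, y)) \<partial>circle) \<le> 1"
          using circle.emeasure_space_1 by simp
      qed
    qed (use circle.emeasure_space_1 in auto)
    then show ?thesis by (simp add: eq)
  qed
  moreover have "(\<integral>\<^sup>+\<xi>. ennreal (?u j \<xi>) \<partial>torus) = ennreal (\<integral>\<xi>. ?u j \<xi> \<partial>torus)" for j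
    by (intro nn_integral_eq_integral circle2.P.integrable_const_bound[where B = 1]) auto
  ultimately have "(\<lambda>j. ennreal (\<integral>\<xi>. ?u j \<xi> \<partial>torus)) \<longlonglongrightarrow> ennreal 0" by simp
  then have "(\<lambda>j. \<integral>\<xi>. ?u j \<xi> \<partial>torus) \<longlonglongrightarrow> 0"
    by (rule tendsto_ennrealD) (auto intro!: always_eventually integral_nonneg_AE)
  then have "(\<lambda>j. \<integral>\<xi>. rotation_average F (cmod (f j \<xi>)) \<partial>torus) \<longlonglongrightarrow> (\<integral>\<xi>. rotation_average F (cmod (f0 \<xi>)) \<partial>torus)"
    by (intro integral_tendsto_of_convergence_in_measure[where B = B])
       (auto intro: circle2.P.prob_space_axioms continuous_rotation_average[OF F] B)
  then show "(\<lambda>j. \<integral>z. F z \<partial>law (f j)) \<longlonglongrightarrow> (\<integral>z. F z \<partial>law f0)"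
    by (simp add: integral_law[OF F mb(1)] integral_law[OF F mb(2)])
qed

lemma summable_on_inverse_square_int: "(\<lambda>n::int. 1 / (1 + \<bar>real_of_int n\<bar>)\<^sup>2) summable_on UNIV"
proof -
  have "summable (\<lambda>n. inverse (real n ^ 2))"
    by (rule inverse_power_summable) simp
  from summable_Suc_iff[THEN iffD2, OF this] have "summable (\<lambda>n. 1 / (1 + real n)\<^sup>2)"
    by (simp add: inverse_eq_divide add.commute)
  then have nat: "(\<lambda>n. 1 / (1 + real n)\<^sup>2) summable_on UNIV"
    by (intro norm_summable_imp_summable_on) simp
  have 1: "(\<lambda>n::int. 1 / (1 + \<bar>real_of_int n\<bar>)\<^sup>2) summable_on range int"
    using nat by (subst summable_on_reindex) (auto simp: o_def)
  have "(\<lambda>n. 1 / (2 + real n)\<^sup>2) summable_on UNIV"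
    by (rule summable_on_comparison_test[OF nat]) (auto intro!: divide_left_mono power_mono mult_pos_pos)
  then have 2: "(\<lambda>n::int. 1 / (1 + \<bar>real_of_int n\<bar>)\<^sup>2) summable_on range (\<lambda>n. - 1 - int n)"
    by (subst summable_on_reindex) (auto simp: o_def inj_on_def)
  have "range int \<union> range (\<lambda>n. - 1 - int n) = UNIV"
  proof -
    have "x \<in> range int \<or> x \<in> range (\<lambda>n. - 1 - int n)" for x
    proof (cases "x \<ge> 0")
      case True
      then show ?thesis by (metis nat_0_le rangeI)
    next
      case False
      then have "x = - 1 - int (nat (- x - 1))" by simp
      then show ?thesis by blast
    qed
    then show ?thesis by blast
  qed
  moreover have "range int \<inter> range (\<lambda>n. - 1 - int n) = {}" by auto
  ultimately show ?thesis
    using summable_on_Un_disjoint[OF 1 2] by simp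
qed

lemma integrable_inverse_square_int: "integrable (count_space UNIV) (\<lambda>n::int. D / (1 + \<bar>real_of_int n\<bar>)\<^sup>2)"
proof -
  have "(\<lambda>n::int. norm (1 / (1 + \<bar>real_of_int n\<bar>)\<^sup>2)) summable_on UNIV"
    using summable_on_inverse_square_int by simp
  then have "integrable (count_space UNIV) (\<lambda>n::int. 1 / (1 + \<bar>real_of_int n\<bar>)\<^sup>2)"
    unfolding abs_summable_equivalent abs_summable_on_def .
  note int = this
  have "integrable (count_space UNIV) (\<lambda>n::int. D * (1 / (1 + \<bar>real_of_int n\<bar>)\<^sup>2))"
    by (rule integrable_mult_right) (rule int)
  then show ?thesis by simp
qed

text \<open>The centre of decay is moved from y to 0 at the price of a factor 1 + |y|, by 1 + |n|
  \<le> (1 + |n - y|) (1 + |y|). After squaring, the bound is summable over n.\<close>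

lemma decay_shift:
  assumes "cmod z \<le> C / (1 + \<bar>of_int n - y\<bar>)" "C \<ge> 0"
  shows "(cmod z)\<^sup>2 \<le> (C * (1 + \<bar>y\<bar>))\<^sup>2 / (1 + \<bar>real_of_int n\<bar>)\<^sup>2"
proof -
  have prod_expand: "(1 + a) * (1 + b) = 1 + (a + b) + a * b" for a b :: real
    by (simp add: algebra_simps)
  have "0 \<le> \<bar>of_int n - y\<bar> * \<bar>y\<bar>" by (intro mult_nonneg_nonneg) auto
  then have "1 + \<bar>real_of_int n\<bar> \<le> (1 + \<bar>of_int n - y\<bar>) * (1 + \<bar>y\<bar>)"
    using abs_triangle_ineq[of "of_int n - y" y] unfolding prod_expand by linarith
  then have "C / (1 + \<bar>of_int n - y\<bar>) \<le> C * (1 + \<bar>y\<bar>) / (1 + \<bar>real_of_int n\<bar>)"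
  proof -
    have "C / p \<le> C * b / q" if "p > 0" "q > 0" "q \<le> p * b" for p q b :: real
      using mult_left_mono[OF that(3) assms(2)] that by (simp add: field_simps)
    from this[OF _ _ \<open>1 + \<bar>real_of_int n\<bar> \<le> _\<close>] show ?thesis by simp
  qed
  then have "cmod z \<le> C * (1 + \<bar>y\<bar>) / (1 + \<bar>real_of_int n\<bar>)"
    using assms(1) by linarith
  then show ?thesis
    by (metis power_divide power_mono norm_ge_zero)
qed

text \<open>Dominated convergence for series, as an integral over \<open>count_space\<close>. Decay
  of order 1/|n - y| gives a summable majorant only because the coefficients enter squared. The
  witness for \<open>s\<close> is the full sum of squares.\<close>

lemma tannery_zak:
  fixes K :: "nat \<Rightarrow> real \<Rightarrow> complex"
  assumes bd: "\<And>j n. cmod (K j (of_int n - y) - K0 (of_int n - y)) \<le> C / (1 + \<bar>of_int n - y\<bar>)"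
    and lim: "\<And>n. (\<lambda>j. K j (of_int n - y)) \<longlonglongrightarrow> K0 (of_int n - y)"
  shows "\<exists>s. (\<forall>\<^sub>F j in sequentially. \<forall>A. finite A \<longrightarrow> (\<Sum>n\<in>A. (cmod (K j (of_int n - y) - K0 (of_int n - y)))\<^sup>2) \<le> s j) \<and> s \<longlonglongrightarrow> (0::real)"
proof -
  let ?a = "\<lambda>j n::int. (cmod (K j (of_int n - y) - K0 (of_int n - y)))\<^sup>2"
  have C: "C \<ge> 0"
  proof -
    have "0 \<le> C / (1 + \<bar>of_int 0 - y\<bar>)" using order_trans[OF norm_ge_zero bd[of 0 0]] .
    then show ?thesis by (smt (verit) zero_le_divide_iff)
  qed
  let ?b = "\<lambda>n::int. (C * (1 + \<bar>y\<bar>))\<^sup>2 / (1 + \<bar>real_of_int n\<bar>)\<^sup>2"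
  have ab: "?a j n \<le> ?b n" for j n
    by (rule decay_shift[OF bd C])
  have int: "integrable (count_space UNIV) ?b" by (rule integrable_inverse_square_int)
  have inta: "integrable (count_space UNIV) (?a j)" for j
    by (rule Bochner_Integration.integrable_bound[OF int]) (use ab in auto)
  have "(\<lambda>j. \<integral>n. ?a j n \<partial>count_space UNIV) \<longlonglongrightarrow> (\<integral>n. 0 \<partial>count_space (UNIV :: int set))"
  proof (rule integral_dominated_convergence[OF _ _ int])
    have "(\<lambda>j. ?a j n) \<longlonglongrightarrow> 0" for n
      using tendsto_power[OF tendsto_norm[OF tendsto_diff[OF lim tendsto_const]], of n "K0 (of_int n - y)" 2] by simp
    then show "AE n in count_space UNIV. (\<lambda>j. ?a j n) \<longlonglongrightarrow> 0" by simp
  qed (use ab in auto)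
  moreover have "(\<Sum>n\<in>A. ?a j n) \<le> (\<integral>n. ?a j n \<partial>count_space UNIV)" if "finite A" for j A
  proof -
    have fin: "finite {n. indicator A n * ?a j n \<noteq> 0}"
      using that by (rule rev_finite_subset) (auto simp: indicator_def)
    have "(\<Sum>n\<in>A. ?a j n) = (\<integral>n. indicator A n * ?a j n \<partial>count_space UNIV)"
      using fin that by (subst lebesgue_integral_count_space_finite_support) (auto intro!: sum.mono_neutral_cong_right)
    also have "\<dots> \<le> (\<integral>n. ?a j n \<partial>count_space UNIV)"
      by (intro integral_mono inta Bochner_Integration.integrable_bound[OF inta[of j]]) (auto simp: indicator_def)
    finally show ?thesis .
  qed
  ultimately show ?thesis
    by (intro exI[of _ "\<lambda>j. \<integral>n. ?a j n \<partial>count_space UNIV"]) auto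
qed

text \<open>Along powers of 4 the \<open>L\<^sup>2\<close> norms of the increments decay geometrically, so these partial sums converge
  almost everywhere and the limit is jointly measurable.\<close>

definition partial_block :: "nat \<Rightarrow> int set" where
  "partial_block k = {- (4 ^ k)..4 ^ k}"

text \<open>One version fixed everywhere: where the partial sums diverge, \<open>lim\<close> returns
  some value, yet the function is jointly measurable, exactly 1-periodic in x, and pointwise equal
  to the finite sum when only finitely many coefficients are nonzero.\<close>

definition zak_sum :: "(real \<Rightarrow> complex) \<Rightarrow> real \<times> real \<Rightarrow> complex" where
  "zak_sum K = (\<lambda>(x, y). lim (\<lambda>k. \<Sum>n\<in>partial_block k. K (of_int n - y) * e2pi (of_int n * x)))"

lemma finite_partial_block [simp]: "finite (partial_block k)"
  by (simp add: partial_block_def)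

lemma eventually_subset_partial_block:
  assumes "finite A"
  shows "\<forall>\<^sub>F k in sequentially. A \<subseteq> partial_block k"
proof -
  have "\<forall>\<^sub>F k in sequentially. n \<in> partial_block k" for n
  proof -
    have "n \<in> partial_block k" if "k \<ge> nat \<bar>n\<bar>" for k
    proof -
      have "\<bar>n\<bar> \<le> int k" using that by simp
      also have "k < 4 ^ k"
        by (rule less_le_trans[OF less_exp]) (simp add: power_mono)
      then have "int k < int (4 ^ k)" by (simp only: of_nat_less_iff)
      then have "int k < 4 ^ k" by simp
      finally show ?thesis by (auto simp: partial_block_def abs_le_iff)
    qed
    then show ?thesis unfolding eventually_sequentially by blast
  qed
  with assms show ?thesis
    by (simp add: subset_iff eventually_ball_finite Ball_def[symmetric])
qed

lemma zak_sum_finite: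
  assumes "finite A" "\<And>n. n \<notin> A \<Longrightarrow> K (of_int n - y) = 0"
  shows "zak_sum K (x, y) = (\<Sum>n\<in>A. K (of_int n - y) * e2pi (of_int n * x))"
proof -
  have "\<forall>\<^sub>F k in sequentially. (\<Sum>n\<in>partial_block k. K (of_int n - y) * e2pi (of_int n * x)) = 
      (\<Sum>n\<in>A. K (of_int n - y) * e2pi (of_int n * x))"
    using eventually_subset_partial_block[OF assms(1)]
    by eventually_elim (intro sum.mono_neutral_right, auto simp: assms)
  then have "(\<lambda>k. \<Sum>n\<in>partial_block k. K (of_int n - y) * e2pi (of_int n * x)) \<longlonglongrightarrow> 
      (\<Sum>n\<in>A. K (of_int n - y) * e2pi (of_int n * x))"
    by (rule tendsto_eventually)
  then show ?thesis unfolding zak_sum_def by (simp add: limI)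
qed

lemma zak_sum_periodic: "zak_sum K (x + 1, y) = zak_sum K (x, y)"
  by (simp add: zak_sum_def distrib_left e2pi_add)

lemma measurable_zak_sum:
  assumes [measurable]: "K \<in> borel_measurable borel"
  shows "zak_sum K \<in> borel_measurable borel"
  unfolding zak_sum_def borel_prod[symmetric] by measurable

text \<open>The integrals of the increments along the blocks are summable, so the block sums
  converge almost everywhere. Fatou's lemma then bounds the distance from any finite partial sum by
  the tail of the sum of squares.\<close>

lemma zak_sum_limit:
  assumes K[measurable]: "K \<in> borel_measurable borel" and bd: "\<And>w. cmod (K w) \<le> C / (1 + \<bar>w\<bar>)"
  shows "((\<lambda>A. \<integral>\<^sup>+x. ennreal ((cmod (zak_sum K (x, y) - (\<Sum>n\<in>A. K (of_int n - y) * e2pi (of_int n * x))))\<^sup>2) \<partial>circle)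
       \<longlongrightarrow> 0) (finite_subsets_at_top UNIV)"
proof -
  define D where "D = (C * (1 + \<bar>y\<bar>))\<^sup>2"
  have C: "C \<ge> 0" using order_trans[OF norm_ge_zero bd[of 0]] by simp
  define a where "a = (\<lambda>n::int. (cmod (K (of_int n - y)))\<^sup>2)"
  have aD: "a n \<le> D / (1 + \<bar>real_of_int n\<bar>)\<^sup>2" for n
    unfolding a_def D_def by (rule decay_shift[OF bd C])
  have a0: "a n \<ge> 0" for n by (simp add: a_def)
  have D0: "D \<ge> 0" by (simp add: D_def)
  have "(\<lambda>n::int. D * (1 / (1 + \<bar>real_of_int n\<bar>)\<^sup>2)) summable_on UNIV"
    by (intro summable_on_cmult_right summable_on_inverse_square_int)
  then have "a summable_on UNIV"
    by (rule summable_on_comparison_test) (use aD a0 in auto)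
  then have suma: "(sum a \<longlongrightarrow> infsum a UNIV) (finite_subsets_at_top UNIV)"
    using has_sum_infsum unfolding has_sum_def by blast
  have sum_le: "sum a A \<le> infsum a UNIV" if "finite A" for A
    using \<open>a summable_on UNIV\<close> that by (intro finite_sum_le_infsum) (auto simp: a0)
  define S where "S = (\<lambda>A x. \<Sum>n\<in>A. K (of_int n - y) * e2pi (of_int n * x))"
  have [measurable]: "S A \<in> borel_measurable circle" for A
    unfolding S_def by (rule measurable_circle) measurable
  have [measurable]: "(\<lambda>x. zak_sum K (x, y)) \<in> borel_measurable circle"
    by (intro measurable_circle measurable_section measurable_zak_sum K)
  have parseval: "(\<integral>\<^sup>+x. ennreal ((cmod (S A x))\<^sup>2) \<partial>circle) = ennreal (sum a A)" if "finite A" for A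
    unfolding S_def a_def using parseval_sum[OF that] by simp
  have Sdiff: "S B x - S A x = S (B - A) x" if "A \<subseteq> B" "finite B" for A B x
    using sum_diff[OF that(2,1), of "\<lambda>n. K (of_int n - y) * e2pi (of_int n * x)"] by (simp add: S_def)
  let ?P = "\<lambda>k. S (partial_block k)"
  have mono: "partial_block k \<subseteq> partial_block (Suc k)" for k
    by (auto simp: partial_block_def intro: order_trans[of _ "4^k"] order_trans[of "- (4 * 4^k)" "- (4 ^ k)"])
  have conv: "AE x in circle. (\<lambda>k. ?P k x) \<longlonglongrightarrow> zak_sum K (x, y)"
  proof -
    have step: "(\<integral>\<^sup>+x. ennreal (cmod (?P (Suc k) x - ?P k x)) \<partial>circle) \<le> ennreal ((1/2) ^ k * (1 + 9 * D))" for k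
    proof -
      \<comment> \<open>Young's inequality with weight 2^-k: the block energy is of order 4^-k, so
        both terms are of order 2^-k after integration and can be summed over k.\<close>
      have "cmod z \<le> (1/2) ^ k + 2 ^ k * (cmod z)\<^sup>2" for z
      proof (cases "cmod z \<le> (1/2) ^ k")
        case True
        then show ?thesis by (simp add: add_increasing2)
      next
        case False
        then have "1 \<le> 2 ^ k * cmod z"
          by (simp add: power_divide field_simps)
        then have "cmod z * 1 \<le> cmod z * (2 ^ k * cmod z)" by (intro mult_left_mono) auto
        then show ?thesis by (simp add: power2_eq_square mult_ac add_increasing)
      qed
      then have "(\<integral>\<^sup>+x. ennreal (cmod (?P (Suc k) x - ?P k x)) \<partial>circle) \<le> 
          (\<integral>\<^sup>+x. ennreal ((1/2) ^ k) + ennreal (2 ^ k) * ennreal ((cmod (?P (Suc k) x - ?P k x))\<^sup>2) \<partial>circle)"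
        by (intro nn_integral_mono) (simp flip: ennreal_plus ennreal_mult' add: ennreal_leI del: ennreal_power)
      also have "\<dots> = ennreal ((1/2) ^ k) + ennreal (2 ^ k) * (\<integral>\<^sup>+x. ennreal ((cmod (?P (Suc k) x - ?P k x))\<^sup>2) \<partial>circle)"
        using circle.emeasure_space_1 by (subst nn_integral_add) (auto simp: nn_integral_cmult)
      also have "(\<integral>\<^sup>+x. ennreal ((cmod (?P (Suc k) x - ?P k x))\<^sup>2) \<partial>circle) = ennreal (sum a (partial_block (Suc k) - partial_block k))"
        by (subst Sdiff) (auto simp: mono parseval)
      \<comment> \<open>About 8 * 4^k terms, each at most D / 16^k since |n| exceeds 4^k outside the
        smaller block.\<close>
      also have "sum a (partial_block (Suc k) - partial_block k) \<le> of_nat (card (partial_block (Suc k))) * (D / (4 ^ k)\<^sup>2)"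
      proof -
        have "a n \<le> D / (4 ^ k)\<^sup>2" if "n \<in> partial_block (Suc k) - partial_block k" for n
        proof -
          have "4 ^ k < \<bar>n\<bar>" using that by (auto simp: partial_block_def)
          then have "real_of_int (4 ^ k) < real_of_int \<bar>n\<bar>" by (simp only: of_int_less_iff)
          then have "4 ^ k \<le> 1 + \<bar>real_of_int n\<bar>" by simp
          then have "D / (1 + \<bar>real_of_int n\<bar>)\<^sup>2 \<le> D / (4 ^ k)\<^sup>2"
            by (intro divide_left_mono power_mono D0) auto
          with aD[of n] show ?thesis by linarith
        qed
        then have "sum a (partial_block (Suc k) - partial_block k) \<le> of_nat (card (partial_block (Suc k) - partial_block k)) * (D / (4 ^ k)\<^sup>2)"
          by (rule sum_bounded_above)
        also have "\<dots> \<le> of_nat (card (partial_block (Suc k))) * (D / (4 ^ k)\<^sup>2)"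
          by (intro mult_right_mono) (auto intro!: card_mono simp: D0)
        finally show ?thesis .
      qed
      also have "real (card (partial_block (Suc k))) = 8 * 4 ^ k + 1"
        by (simp add: partial_block_def)
      also have "(8 * 4 ^ k + 1) * (D / (4 ^ k)\<^sup>2) \<le> 9 * 4 ^ k * (D / (4 ^ k)\<^sup>2)"
        by (intro mult_right_mono) (auto simp: D0)
      also have "\<dots> = 9 * D / 4 ^ k"
        by (simp add: power2_eq_square)
      finally have "(\<integral>\<^sup>+x. ennreal (cmod (?P (Suc k) x - ?P k x)) \<partial>circle) \<le> ennreal ((1/2) ^ k) + ennreal (2 ^ k) * ennreal (9 * D / 4 ^ k)"
        by (simp add: add_left_mono mult_left_mono ennreal_leI)
      also have "\<dots> = ennreal ((1/2) ^ k + 2 ^ k * (9 * D / 4 ^ k))"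
        using D0 by (simp flip: ennreal_mult ennreal_plus)
      also have "(2::real) ^ k * (9 * D / 4 ^ k) = (1/2) ^ k * (9 * D)"
      proof -
        have "(4::real) ^ k = 2 ^ k * 2 ^ k" by (simp flip: power_mult_distrib)
        then show ?thesis by (simp add: power_divide)
      qed
      finally show ?thesis by (simp add: distrib_left)
    qed
    have "(\<integral>\<^sup>+x. (\<Sum>k. ennreal (cmod (?P (Suc k) x - ?P k x))) \<partial>circle) = (\<Sum>k. \<integral>\<^sup>+x. ennreal (cmod (?P (Suc k) x - ?P k x)) \<partial>circle)"
      by (rule nn_integral_suminf) measurable
    also have "\<dots> \<le> (\<Sum>k. ennreal ((1/2) ^ k * (1 + 9 * D)))"
      by (intro suminf_le step) auto
    also have "\<dots> = ennreal (\<Sum>k. (1/2) ^ k * (1 + 9 * D))"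
      using D0 by (intro suminf_ennreal2 summable_mult2 summable_geometric) auto
    also have "\<dots> < \<infinity>" by simp
    finally have "AE x in circle. (\<Sum>k. ennreal (cmod (?P (Suc k) x - ?P k x))) \<noteq> \<infinity>"
      by (intro nn_integral_PInf_AE borel_measurable_suminf_order) auto
    then show ?thesis
    proof eventually_elim
      case (elim x)
      then have "summable (\<lambda>k. cmod (?P (Suc k) x - ?P k x))"
        by (intro summable_suminf_not_top) auto
      then have "summable (\<lambda>k. ?P (Suc k) x - ?P k x)" by (rule summable_norm_cancel)
      then have "convergent (\<lambda>m. \<Sum>k<m. ?P (Suc k) x - ?P k x)" by (simp add: summable_iff_convergent)
      then have "convergent (\<lambda>m. ?P m x - ?P 0 x)" by (simp add: sum_lessThan_telescope[of "\<lambda>m. ?P m x"])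
      then have "convergent (\<lambda>m. ?P m x)" by (simp add: convergent_diff_const_right_iff)
      then show ?case by (simp add: zak_sum_def S_def convergent_LIMSEQ_iff)
    qed
  qed
  have bound: "(\<integral>\<^sup>+x. ennreal ((cmod (zak_sum K (x, y) - S A x))\<^sup>2) \<partial>circle) \<le> ennreal (infsum a UNIV - sum a A)" if A: "finite A" for A
  proof -
    have "(\<integral>\<^sup>+x. ennreal ((cmod (zak_sum K (x, y) - S A x))\<^sup>2) \<partial>circle) = 
       (\<integral>\<^sup>+x. liminf (\<lambda>k. ennreal ((cmod (?P k x - S A x))\<^sup>2)) \<partial>circle)"
    proof (intro nn_integral_cong_AE)
      show "AE x in circle. ennreal ((cmod (zak_sum K (x, y) - S A x))\<^sup>2) = liminf (\<lambda>k. ennreal ((cmod (?P k x - S A x))\<^sup>2))"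
        using conv
      proof eventually_elim
        case (elim x)
        then have "(\<lambda>k. ennreal ((cmod (?P k x - S A x))\<^sup>2)) \<longlonglongrightarrow> ennreal ((cmod (zak_sum K (x, y) - S A x))\<^sup>2)"
          by (intro tendsto_intros)
        then show ?case by (intro lim_imp_Liminf[symmetric]) auto
      qed
    qed
    \<comment> \<open>Fatou's lemma. The integrals on the right are finite Parseval sums over the
      block minus \<open>A\<close>, once the block contains \<open>A\<close>.\<close>
    also have "\<dots> \<le> liminf (\<lambda>k. \<integral>\<^sup>+x. ennreal ((cmod (?P k x - S A x))\<^sup>2) \<partial>circle)"
      by (rule nn_integral_liminf) measurable
    also have "\<dots> \<le> ennreal (infsum a UNIV - sum a A)"
    proof (rule Liminf_le)
      show "\<forall>\<^sub>F k in sequentially. (\<integral>\<^sup>+x. ennreal ((cmod (?P k x - S A x))\<^sup>2) \<partial>circle) \<le> ennreal (infsum a UNIV - sum a A)"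
        using eventually_subset_partial_block[OF A]
      proof eventually_elim
        case (elim k)
        have "(\<integral>\<^sup>+x. ennreal ((cmod (?P k x - S A x))\<^sup>2) \<partial>circle) = ennreal (sum a (partial_block k - A))"
          using elim by (simp add: Sdiff parseval)
        also have "sum a (partial_block k - A) = sum a (partial_block k) - sum a A"
          using elim by (simp add: sum_diff)
        finally show ?case using sum_le[of "partial_block k"] by (simp add: ennreal_leI)
      qed
    qed simp
    finally show ?thesis .
  qed
  have "((\<lambda>A. ennreal (infsum a UNIV - sum a A)) \<longlongrightarrow> ennreal (infsum a UNIV - infsum a UNIV)) (finite_subsets_at_top UNIV)"
    by (intro tendsto_ennrealI tendsto_diff tendsto_const suma)
  then have lm: "((\<lambda>A. ennreal (infsum a UNIV - sum a A)) \<longlongrightarrow> 0) (finite_subsets_at_top UNIV)" by simp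
  have ev: "\<forall>\<^sub>F A in finite_subsets_at_top UNIV. (\<integral>\<^sup>+x. ennreal ((cmod (zak_sum K (x, y) - S A x))\<^sup>2) \<partial>circle) \<le> ennreal (infsum a UNIV - sum a A)"
    by (intro eventually_finite_subsets_at_top_weakI bound)
  have "((\<lambda>A. \<integral>\<^sup>+x. ennreal ((cmod (zak_sum K (x, y) - S A x))\<^sup>2) \<partial>circle) \<longlongrightarrow> 0) (finite_subsets_at_top UNIV)"
    by (rule tendsto_sandwich[OF _ ev tendsto_const lm]) simp
  then show ?thesis by (simp add: S_def)
qed

lemma zak_zak_sum:
  assumes "K \<in> borel_measurable borel" "\<And>w. cmod (K w) \<le> C / (1 + \<bar>w\<bar>)"
  shows "zak K (zak_sum K)"
  unfolding zak_def using assms by (intro conjI measurable_zak_sum AE_I2 zak_sum_limit)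

text \<open>The distance estimate with s = 0: the two functions agree for almost every x on almost
  every fibre, hence almost everywhere on the torus.\<close>

lemma law_cong_zak:
  assumes "zak K f" "zak K g"
  shows "law f = law g"
proof -
  have [measurable]: "f \<in> borel_measurable torus" "g \<in> borel_measurable torus"
    and fg: "f \<in> borel_measurable borel" "g \<in> borel_measurable borel"
    using assms by (auto simp: zak_def intro: measurable_circle2)
  have "AE y in circle. AE x in circle. f (x, y) = g (x, y)"
    using AE_circle[OF zak_distance[OF assms]]
  proof eventually_elim
    case (elim y)
    have [measurable]: "(\<lambda>x. f (x, y)) \<in> borel_measurable circle" "(\<lambda>x. g (x, y)) \<in> borel_measurable circle"
      by (intro measurable_circle measurable_section fg)+
    from elim[rule_format, of 0] have "(\<integral>\<^sup>+x. ennreal ((cmod (f (x, y) - g (x, y)))\<^sup>2) \<partial>circle) = 0"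
      by simp
    then show ?case by (subst (asm) nn_integral_0_iff_AE) auto
  qed
  moreover have P: "{\<xi> \<in> space torus. f (fst \<xi>, snd \<xi>) = g (fst \<xi>, snd \<xi>)} \<in> sets torus" by measurable
  ultimately have "AE \<xi> in torus. f \<xi> = g \<xi>"
    using circle2.AE_commute[OF P] circle2.AE_pair_iff[OF P] by simp
  moreover have Q: "{z \<in> space (circle \<Otimes>\<^sub>M torus). f (snd z) = g (snd z)} \<in> sets (circle \<Otimes>\<^sub>M torus)" by measurable
  ultimately have "AE z in circle \<Otimes>\<^sub>M torus. f (snd z) = g (snd z)"
    by (intro circle3.AE_pair_measure[OF Q]) simp
  then show ?thesis
    unfolding law_def by (intro distr_cong_AE) (auto simp: case_prod_beta')
qed

section \<open>The kernel of the theta function\<close>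

lemma mat2_nth [simp]:
  "mat2 a b c d $ 1 $ 1 = a" "mat2 a b c d $ 1 $ 2 = b" "mat2 a b c d $ 2 $ 1 = c" "mat2 a b c d $ 2 $ 2 = d"
  by (simp_all add: mat2_def)

lemma mat2_eta: "mat2 (M $ 1 $ 1) (M $ 1 $ 2) (M $ 2 $ 1) (M $ 2 $ 2) = M"
  by (simp add: vec_eq_iff forall_2)

lemma mat2_eq_iff: "mat2 a b c d = mat2 a' b' c' d' \<longleftrightarrow> a = a' \<and> b = b' \<and> c = c' \<and> d = d'"
  by (auto simp: vec_eq_iff forall_2)

lemma det_mat2 [simp]: "det (mat2 a b c d) = a * d - b * c"
  by (simp add: det_2)

lemma mat2_mult: "mat2 a b c d ** mat2 a' b' c' d' =
    mat2 (a * a' + b * c') (a * b' + b * d') (c * a' + d * c') (c * b' + d * d')"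
  by (simp add: vec_eq_iff forall_2 matrix_matrix_mult_def sum_2)

lemma iwasawa_eq:
  assumes "v > 0"
  shows "iwasawa u v \<phi> = mat2 (sqrt v * cos \<phi> + u * sin \<phi> / sqrt v) (u * cos \<phi> / sqrt v - sqrt v * sin \<phi>)
     (sin \<phi> / sqrt v) (cos \<phi> / sqrt v)"
  using assms by (simp add: iwasawa_def mat2_mult mat2_eq_iff powr_half_sqrt powr_minus_divide)

text \<open>The lower row of the matrix is (sin \<phi>, cos \<phi>) / sqrt v, which determines v and
  \<phi>; then u is the real part of the image of i under the Moebius action. Uniqueness is proved
  as well because the coordinates are a definite description.\<close>

lemma iwasawa_coords_SL2R:
  assumes det: "a * d - b * c = (1::real)"
  obtains u v \<phi> where "iwasawa_coords (mat2 a b c d) = (u, v, \<phi>)" "v > 0" "0 \<le> \<phi>" "\<phi> < 2 * pi"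
    "a = sqrt v * cos \<phi> + u * sin \<phi> / sqrt v" "b = u * cos \<phi> / sqrt v - sqrt v * sin \<phi>"
    "sin \<phi> = c * sqrt v" "cos \<phi> = d * sqrt v"
proof -
  have pos: "c\<^sup>2 + d\<^sup>2 > 0"
    using det by (metis diff_zero mult_zero_right sum_power2_gt_zero_iff zero_neq_one)
  define v where "v = 1 / (c\<^sup>2 + d\<^sup>2)"
  have v: "v > 0" unfolding v_def using pos by (rule divide_pos_pos[OF zero_less_one])
  have sv: "sqrt v > 0" "sqrt v * sqrt v = v" using v by simp_all
  have "(d * sqrt v)\<^sup>2 + (c * sqrt v)\<^sup>2 = (c\<^sup>2 + d\<^sup>2) * v"
    using v by (simp add: power_mult_distrib algebra_simps)
  also have "\<dots> = 1"
  proof -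
    have "c\<^sup>2 + d\<^sup>2 \<noteq> 0" using pos by linarith
    then show ?thesis unfolding v_def divide_inverse mult_1_left by (rule right_inverse)
  qed
  finally obtain \<phi> where \<phi>: "0 \<le> \<phi>" "\<phi> < 2 * pi" "d * sqrt v = cos \<phi>" "c * sqrt v = sin \<phi>"
    using sincos_total_2pi by blast
  define u where "u = (a * c + b * d) * v"
  have vd: "v * (c * c + d * d) = 1"
  proof -
    have "c * c + d * d \<noteq> 0" using pos unfolding power2_eq_square by linarith
    then show ?thesis unfolding v_def power2_eq_square divide_inverse mult_1_left by (rule left_inverse)
  qed
  have a: "a = sqrt v * cos \<phi> + u * sin \<phi> / sqrt v"
  proof -
    have "sqrt v * cos \<phi> + u * sin \<phi> / sqrt v = v * d + u * c"
      unfolding \<phi>(3,4)[symmetric] using sv by (simp add: field_simps)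
    also have "v * d + u * c = v * (d + (a * c + b * d) * c)" by (simp add: u_def algebra_simps)
    also have "d + (a * c + b * d) * c = d * (a * d - b * c) + (a * c + b * d) * c" by (simp add: det)
    also have "\<dots> = a * (c * c + d * d)" by (simp add: algebra_simps)
    finally show ?thesis using vd by (simp add: mult.left_commute)
  qed
  have b: "b = u * cos \<phi> / sqrt v - sqrt v * sin \<phi>"
  proof -
    have "u * cos \<phi> / sqrt v - sqrt v * sin \<phi> = u * d - v * c"
      unfolding \<phi>(3,4)[symmetric] using sv by (simp add: field_simps)
    also have "\<dots> = v * ((a * c + b * d) * d - c)" by (simp add: u_def algebra_simps)
    also have "(a * c + b * d) * d - c = (a * c + b * d) * d - c * (a * d - b * c)" by (simp add: det)
    also have "\<dots> = b * (c * c + d * d)" by (simp add: algebra_simps)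
    finally show ?thesis using vd by (simp add: mult.left_commute)
  qed
  have "iwasawa_coords (mat2 a b c d) = (u, v, \<phi>)"
    unfolding iwasawa_coords_def
  proof (rule the_equality)
    show "case (u, v, \<phi>) of (u, v, \<phi>) \<Rightarrow> v > 0 \<and> 0 \<le> \<phi> \<and> \<phi> < 2 * pi \<and> mat2 a b c d = iwasawa u v \<phi>"
    proof (simp add: v \<phi>(1,2) iwasawa_eq mat2_eq_iff, intro conjI a b)
      show "c = sin \<phi> / sqrt v" "d = cos \<phi> / sqrt v"
        unfolding \<phi>(3,4)[symmetric] using sv by simp_all
    qed
  next
    fix z assume "case z of (u, v, \<phi>) \<Rightarrow> v > 0 \<and> 0 \<le> \<phi> \<and> \<phi> < 2 * pi \<and> mat2 a b c d = iwasawa u v \<phi>"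
    then obtain u' v' \<phi>' where z: "z = (u', v', \<phi>')" "v' > 0" "0 \<le> \<phi>'" "\<phi>' < 2 * pi" "mat2 a b c d = iwasawa u' v' \<phi>'"
      by (cases z) auto
    have sv': "sqrt v' > 0" "sqrt v' * sqrt v' = v'" using z by simp_all
    from z(5) have e: "a = sqrt v' * cos \<phi>' + u' * sin \<phi>' / sqrt v'" "b = u' * cos \<phi>' / sqrt v' - sqrt v' * sin \<phi>'"
      "c = sin \<phi>' / sqrt v'" "d = cos \<phi>' / sqrt v'"
      by (simp_all add: iwasawa_eq[OF z(2)] mat2_eq_iff)
    have "c\<^sup>2 + d\<^sup>2 = ((sin \<phi>')\<^sup>2 + (cos \<phi>')\<^sup>2) / v'"
      using z(2) by (simp add: e(3,4) power_divide flip: add_divide_distrib)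
    then have v': "v' = v" by (simp add: v_def)
    have "sin \<phi>' = sin \<phi>" "cos \<phi>' = cos \<phi>"
      using \<phi>(3,4) sv' e(3,4) by (simp_all add: v')
    then obtain n :: int where n: "\<phi>' = \<phi> + 2 * pi * of_int n" using sin_cos_eq_iff by blast
    have "\<bar>2 * pi * of_int n\<bar> < 2 * pi * 1" using n z(3,4) \<phi>(1,2) by linarith
    then have "\<bar>real_of_int n\<bar> < 1" by (simp add: abs_mult)
    then have "n = 0" by linarith
    then have \<phi>': "\<phi>' = \<phi>" using n by simp
    have "u' = u"
    proof -
      have *: "(a * c + b * d) * v = (a * sin \<phi> + b * cos \<phi>) * sqrt v"
        unfolding \<phi>(3,4)[symmetric] using sv by (simp add: algebra_simps)
      have "(a * sin \<phi> + b * cos \<phi>) * sqrt v = u' * ((sin \<phi>)\<^sup>2 + (cos \<phi>)\<^sup>2)"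
      proof -
        have "((q * C + u' * S / q) * S + (u' * C / q - q * S) * C) * q = u' * (S\<^sup>2 + C\<^sup>2)" if "q > 0" for q S C
          using that by (simp add: field_simps power2_eq_square)
        from this[OF sv(1)] show ?thesis unfolding e(1,2) v' \<phi>' .
      qed
      then show ?thesis by (simp add: u_def *)
    qed
    then show "z = (u, v, \<phi>)" by (simp add: z v' \<phi>')
  qed
  then show ?thesis by (rule that) (use v \<phi> a b in auto)
qed

text \<open>The Schroedinger--Weil transform of \<open>\<chi>\<close>, as an integral kernel depending on the matrix entries only.\<close>

definition weil_kernel :: "real \<Rightarrow> real \<Rightarrow> real \<Rightarrow> real \<Rightarrow> real \<Rightarrow> complex" where
  "weil_kernel a b c d w =
     (if c = 0 then of_real (sqrt \<bar>a\<bar>) * e2pi (a * b * w\<^sup>2 / 2) * of_real (chi (a * w))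
      else of_real (1 / sqrt \<bar>c\<bar>) * (\<integral>s. e2pi (((a * w\<^sup>2 + d * s\<^sup>2) / 2 - w * s) / c) * of_real (chi s) \<partial>lborel))"

text \<open>The Iwasawa coordinates recombine: v^(1/4) |sin \<phi>|^(-1/2) is |c|^(-1/2), the
  dilation by sqrt v expresses the phase of \<open>chi_rot\<close> through c, d and v, and the
  horizontal phase u w^2 / 2 completes a = v d + u c. When c = 0 only \<phi> = 0 and \<phi> = pi
  occur, with a = sqrt v and a = - sqrt v.\<close>

lemma theta_term_eq:
  assumes det: "a * d - b * c = (1::real)"
  shows "theta_term (mat2 a b c d) n (x, y) = weil_kernel a b c d (of_int n - y) * e2pi (of_int n * x)"
proof -
  obtain u v \<phi> where coords: "iwasawa_coords (mat2 a b c d) = (u, v, \<phi>)" and v: "v > 0" and \<phi>: "0 \<le> \<phi>" "\<phi> < 2 * pi"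
    and ab: "a = sqrt v * cos \<phi> + u * sin \<phi> / sqrt v" "b = u * cos \<phi> / sqrt v - sqrt v * sin \<phi>"
    and sc: "sin \<phi> = c * sqrt v" "cos \<phi> = d * sqrt v"
    by (rule iwasawa_coords_SL2R[OF det])
  define w where "w = of_int n - y"
  have sv: "sqrt v > 0" "sqrt v * sqrt v = v" using v by simp_all
  have v4: "v powr (1/4) = sqrt (sqrt v)"
    using v by (simp add: powr_powr flip: powr_half_sqrt)
  have main: "of_real (sqrt (sqrt v)) * chi_rot \<phi> (w * sqrt v) * e2pi (w\<^sup>2 / 2 * u) = weil_kernel a b c d w"
  proof (cases "c = 0")
    case True
    then have s0: "sin \<phi> = 0" using sc by simp
    then obtain i :: int where i: "\<phi> = of_int i * pi" using sin_zero_iff_int2 by auto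
    have "of_int i * pi < 2 * pi" "0 \<le> of_int i * pi" using \<phi> i by simp_all
    then have "real_of_int i < 2" "0 \<le> real_of_int i" using pi_gt_zero by (auto simp: zero_le_mult_iff)
    then have "i = 0 \<or> i = 1" by linarith
    then show ?thesis
    proof
      assume "i = 0"
      then have "\<phi> = 0" using i by simp
      then have "chi_rot \<phi> (w * sqrt v) = of_real (chi (w * sqrt v))"
        by (auto simp: chi_rot_def intro: exI[of _ "0::int"])
      moreover have "a = sqrt v" "b = u / sqrt v" using ab \<open>\<phi> = 0\<close> by simp_all
      ultimately show ?thesis using True sv by (simp add:  weil_kernel_def mult_ac)
    next
      assume "i = 1"
      then have pi: "\<phi> = pi" using i by simp
      have "\<not> (\<exists>j::int. pi = 2 * pi * of_int j)"
      proof
        assume "\<exists>j::int. pi = 2 * pi * of_int j"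
        then obtain j :: int where "pi * 1 = pi * (2 * of_int j)" by (auto simp: mult_ac)
        then have "1 = 2 * real_of_int j" by (simp del: mult_1_right)
        then have "1 = 2 * j" by linarith
        then show False by presburger
      qed
      then have "chi_rot \<phi> (w * sqrt v) = of_real (chi (- (w * sqrt v)))"
        unfolding pi chi_rot_def by (auto intro: exI[of _ "0::int"])
      moreover have "a = - sqrt v" "b = - u / sqrt v" using ab pi by simp_all
      ultimately show ?thesis using True sv by (simp add:  weil_kernel_def mult_ac)
    qed
  next
    case False
    then have s0: "sin \<phi> \<noteq> 0" using sc sv by simp
    have "\<not> (\<exists>j::int. \<phi> = 2 * pi * of_int j)" "\<not> (\<exists>j::int. \<phi> = pi + 2 * pi * of_int j)"
      using s0 by (auto simp: sin_add)
    then have "chi_rot \<phi> (w * sqrt v) = of_real (\<bar>sin \<phi>\<bar> powr (-1/2)) *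
        (\<integral>w'. e2pi ((((w * sqrt v)\<^sup>2 + w'\<^sup>2) / 2 * cos \<phi> - (w * sqrt v) * w') / sin \<phi>) * of_real (chi w') \<partial>lborel)"
      by (simp add: chi_rot_def)
    moreover have "\<bar>sin \<phi>\<bar> powr (-1/2) = 1 / (sqrt \<bar>c\<bar> * sqrt (sqrt v))"
    proof -
      have "x powr (-1/2) = 1 / sqrt x" if "x \<ge> 0" for x :: real
        using powr_minus_divide[of x "1/2"] powr_half_sqrt[OF that] by simp
      then show ?thesis using sv by (simp add: sc abs_mult real_sqrt_mult)
    qed
    moreover have "e2pi ((((w * sqrt v)\<^sup>2 + s\<^sup>2) / 2 * cos \<phi> - (w * sqrt v) * s) / sin \<phi>) * of_real (chi s) * e2pi (w\<^sup>2 / 2 * u)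
        = e2pi (((a * w\<^sup>2 + d * s\<^sup>2) / 2 - w * s) / c) * of_real (chi s)" for s
    proof -
      have a: "a = v * d + u * c" using ab(1) sc sv by (simp add: field_simps)
      have "(((w * sqrt v)\<^sup>2 + s\<^sup>2) / 2 * cos \<phi> - (w * sqrt v) * s) / sin \<phi> = ((v * w\<^sup>2 + s\<^sup>2) / 2 * d - w * s) / c"
      proof -
        have "((w * sqrt v)\<^sup>2 + s\<^sup>2) / 2 * cos \<phi> - (w * sqrt v) * s = (((v * w\<^sup>2 + s\<^sup>2) / 2 * d - w * s)) * sqrt v"
          using v by (simp add: sc power_mult_distrib algebra_simps)
        then show ?thesis using sv by (simp add: sc)
      qed
      also have "\<dots> + w\<^sup>2 / 2 * u = ((a * w\<^sup>2 + d * s\<^sup>2) / 2 - w * s) / c"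
        using False by (simp add: a field_simps)
      finally have eq: "(((w * sqrt v)\<^sup>2 + s\<^sup>2) / 2 * cos \<phi> - (w * sqrt v) * s) / sin \<phi> + w\<^sup>2 / 2 * u
         = ((a * w\<^sup>2 + d * s\<^sup>2) / 2 - w * s) / c" .
      have "e2pi p * of_real (chi s) * e2pi q = e2pi (p + q) * of_real (chi s)" for p q
        by (simp add: e2pi_add)
      then show ?thesis by (simp only: eq)
    qed
    then have "(\<integral>s. e2pi ((((w * sqrt v)\<^sup>2 + s\<^sup>2) / 2 * cos \<phi> - (w * sqrt v) * s) / sin \<phi>) * of_real (chi s) \<partial>lborel) * e2pi (w\<^sup>2 / 2 * u)
      = (\<integral>s. e2pi (((a * w\<^sup>2 + d * s\<^sup>2) / 2 - w * s) / c) * of_real (chi s) \<partial>lborel)"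
      by (subst integral_mult_left_zero[symmetric]) (simp only:)
    ultimately show ?thesis
      using False sv by (simp add:  weil_kernel_def)
  qed
  show ?thesis
    unfolding theta_term_def coords using v
    by (simp add: main[symmetric] w_def[symmetric] v4 powr_half_sqrt e2pi_add)
qed

section \<open>Bounds for the kernel, uniform in the matrix entries\<close>

lemma chi_measurable [measurable]: "chi \<in> borel_measurable borel"
  unfolding chi_def by measurable

lemma measurable_kernel [measurable]: "weil_kernel a b c d \<in> borel_measurable borel"
  unfolding  weil_kernel_def by (cases "c = 0") (simp_all, measurable)

lemma integrable_chi: "integrable lborel chi"
  unfolding chi_def by simp

lemma integral_chi: "(\<integral>s. chi s \<partial>lborel) = 1"
  unfolding chi_def by simp

lemma norm_kernel_le:
  assumes "c \<noteq> 0"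
  shows "cmod (weil_kernel a b c d w) \<le> 1 / sqrt \<bar>c\<bar>"
proof -
  let ?I = "\<integral>s. e2pi (((a * w\<^sup>2 + d * s\<^sup>2) / 2 - w * s) / c) * of_real (chi s) \<partial>lborel"
  have "cmod ?I \<le> (\<integral>s. cmod (e2pi (((a * w\<^sup>2 + d * s\<^sup>2) / 2 - w * s) / c) * of_real (chi s)) \<partial>lborel)"
    by (rule integral_norm_bound)
  also have "\<dots> = (\<integral>s. chi s \<partial>lborel)"
    by (intro Bochner_Integration.integral_cong) (auto simp: norm_mult chi_def)
  finally have "cmod ?I \<le> 1" by (simp add: integral_chi)
  then have "1 / sqrt \<bar>c\<bar> * cmod ?I \<le> 1 / sqrt \<bar>c\<bar> * 1" by (intro mult_left_mono) auto
  then show ?thesis using assms by (simp add:  weil_kernel_def norm_mult norm_divide)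
qed

text \<open>Integration by parts against the reciprocal of the phase derivative
  \<open>\<alpha> * s + \<beta>\<close>. The two boundary terms and the remaining integral are each
  at most 1 / (2 pi m), the last one because the second derivative \<alpha> of the phase is at most
  m in absolute value; and 3 / (2 pi) < 1.\<close>

lemma first_derivative_test:
  assumes m: "m > 0" and \<theta>: "\<And>s. 0 \<le> s \<Longrightarrow> s \<le> 1 \<Longrightarrow> m \<le> \<bar>\<alpha> * s + \<beta>\<bar>" and \<alpha>: "\<bar>\<alpha>\<bar> \<le> m"
  shows "cmod (\<integral>s. e2pi (\<alpha> * s\<^sup>2 / 2 + \<beta> * s) * of_real (chi s) \<partial>lborel) \<le> 1 / m"
proof -
  define E where "E = (\<lambda>s. e2pi (\<alpha> * s\<^sup>2 / 2 + \<beta> * s))"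
  define k :: complex where "k = 2 * of_real pi * \<i>"
  have k: "k \<noteq> 0" "cmod k = 2 * pi" by (simp_all add: k_def norm_mult)
  define g where "g = (\<lambda>s. complex_of_real (1 / (\<alpha> * s + \<beta>)))"
  have nz: "\<alpha> * s + \<beta> \<noteq> 0" if "0 \<le> s" "s \<le> 1" for s
    using \<theta>[OF that] m by auto
  have gn: "cmod (g s) \<le> 1 / m" if "0 \<le> s" "s \<le> 1" for s
    using \<theta>[OF that] m by (simp add: g_def norm_divide divide_simps flip: of_real_mult of_real_add)
  have dE: "(E has_vector_derivative k * of_real (\<alpha> * s + \<beta>) * E s) (at s within A)" for s A
    unfolding E_def k_def by (rule has_vector_derivative_e2pi) (auto intro!: derivative_eq_intros)
  have dg: "(g has_vector_derivative of_real (- \<alpha> / (\<alpha> * s + \<beta>)\<^sup>2)) (at s within {0..1})" if "s \<in> {0..1}" for s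
  proof -
    have "((\<lambda>s. 1 / (\<alpha> * s + \<beta>)) has_real_derivative - \<alpha> / (\<alpha> * s + \<beta>)\<^sup>2) (at s within {0..1})"
      using nz[of s] that by (auto intro!: derivative_eq_intros simp: power2_eq_square)
    then show ?thesis
      unfolding g_def by (rule has_vector_derivative_of_real)
  qed
  \<comment> \<open>Up to the factor 1 / k, the error term of the integration by parts: the
    derivative of E g / k is E - r / k.\<close>
  define r where "r = (\<lambda>s. E s * (of_real \<alpha> * (g s)\<^sup>2))"
  have FTC: "has_bochner_integral lborel (\<lambda>s. indicator {0..1} s *\<^sub>R (E s - r s / k)) (E 1 * g 1 / k - E 0 * g 0 / k)"
  proof (rule has_bochner_integral_FTC_Icc)
    fix s :: real assume s: "0 \<le> s" "s \<le> 1"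
    have gs: "g s * of_real (\<alpha> * s + \<beta>) = 1" 
      using nz[OF s] by (simp add: g_def del: of_real_add of_real_mult flip: of_real_mult)
    have gs2: "of_real (- \<alpha> / (\<alpha> * s + \<beta>)\<^sup>2) = - (of_real \<alpha> * (g s)\<^sup>2)"
      by (simp add: g_def power_divide)
    have "((\<lambda>s. E s * g s / k) has_vector_derivative 
        (E s * of_real (- \<alpha> / (\<alpha> * s + \<beta>)\<^sup>2) + (k * of_real (\<alpha> * s + \<beta>) * E s) * g s) / k) (at s within {0..1})"
      using s by (intro has_vector_derivative_divide has_vector_derivative_mult dE dg) auto
    moreover have "(E s * of_real (- \<alpha> / (\<alpha> * s + \<beta>)\<^sup>2) + (k * of_real (\<alpha> * s + \<beta>) * E s) * g s) / k = E s - r s / k"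
    proof -
      have "(k * of_real (\<alpha> * s + \<beta>) * E s) * g s = k * E s * (g s * of_real (\<alpha> * s + \<beta>))" by (simp only: mult_ac)
      then show ?thesis unfolding gs gs2 r_def using k by (simp add: field_simps)
    qed
    ultimately show "((\<lambda>s. E s * g s / k) has_vector_derivative E s - r s / k) (at s within {0..1})"
      by simp
  next
    have "continuous_on {0..1} g"
      unfolding g_def using nz by (intro continuous_intros) auto
    then show "continuous_on {0..1} (\<lambda>s. E s - r s / k)"
      unfolding E_def r_def using k by (intro continuous_intros) auto
  qed simp
  have bE: "has_bochner_integral lborel (\<lambda>s. indicator {0..1} s *\<^sub>R E s) (\<integral>s. indicator {0..1} s *\<^sub>R E s \<partial>lborel)"
    unfolding E_def
    by (intro has_bochner_integral_integrable borel_integrable_atLeastAtMost' continuous_intros)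
       (auto intro!: borel_integrable_compact continuous_intros)
  have "has_bochner_integral lborel (\<lambda>s. indicator {0..1} s *\<^sub>R (r s / k)) ((\<integral>s. indicator {0..1} s *\<^sub>R E s \<partial>lborel) - (E 1 * g 1 / k - E 0 * g 0 / k))"
    using has_bochner_integral_diff[OF bE FTC] by (simp add: scaleR_diff_right)
  then have rI: "integrable lborel (\<lambda>s. indicator {0..1} s *\<^sub>R (r s / k))" 
    "(\<integral>s. indicator {0..1} s *\<^sub>R (r s / k) \<partial>lborel) = (\<integral>s. indicator {0..1} s *\<^sub>R E s \<partial>lborel) - (E 1 * g 1 / k - E 0 * g 0 / k)"
    by (auto simp: has_bochner_integral_iff)
  have "cmod (\<integral>s. indicator {0..1} s *\<^sub>R (r s / k) \<partial>lborel) \<le> (\<integral>s. cmod (indicator {0..1} s *\<^sub>R (r s / k)) \<partial>lborel)"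
    by (rule integral_norm_bound)
  also have "\<dots> \<le> (\<integral>s. indicator {0..1::real} s *\<^sub>R (1 / (2 * pi * m)) \<partial>lborel)"
  proof (intro integral_mono integrable_norm rI)
    fix s :: real
    show "cmod (indicator {0..1} s *\<^sub>R (r s / k)) \<le> indicator {0..1} s *\<^sub>R (1 / (2 * pi * m))"
    proof (cases "s \<in> {0..1}")
      case True
      have "cmod (r s) \<le> m * (1 / m)\<^sup>2"
        unfolding r_def using gn[of s] True \<alpha> m
        by (auto simp: norm_mult norm_power E_def intro!: mult_mono power_mono)
      also have "\<dots> = 1 / m" using m by (simp add: power2_eq_square)
      finally have "cmod (r s) / (2 * pi) \<le> 1 / m / (2 * pi)" by (intro divide_right_mono) auto
      then show ?thesis using True by (simp add: norm_divide k mult_ac)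
    qed simp
  qed auto
  also have "\<dots> = 1 / (2 * pi * m)" by simp
  finally have 1: "cmod (\<integral>s. indicator {0..1} s *\<^sub>R (r s / k) \<partial>lborel) \<le> 1 / (2 * pi * m)" .
  have 2: "cmod (E s * g s / k) \<le> 1 / (2 * pi * m)" if "0 \<le> s" "s \<le> 1" for s
  proof -
    have "cmod (E s * g s / k) = cmod (g s) / (2 * pi)" by (simp add: norm_mult norm_divide k E_def)
    also have "\<dots> \<le> 1 / m / (2 * pi)" by (intro divide_right_mono gn that) auto
    finally show ?thesis by (simp add: mult_ac)
  qed
  have "(\<integral>s. e2pi (\<alpha> * s\<^sup>2 / 2 + \<beta> * s) * of_real (chi s) \<partial>lborel) = (\<integral>s. indicator {0..1} s *\<^sub>R E s \<partial>lborel)"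
  proof (rule integral_cong_AE)
    \<comment> \<open>\<open>chi\<close> and the indicator of [0, 1] differ only at the point
      0.\<close>
    show "AE s in lborel. e2pi (\<alpha> * s\<^sup>2 / 2 + \<beta> * s) * of_real (chi s) = indicator {0..1} s *\<^sub>R E s"
      using AE_lborel_singleton[of "0::real"]
      by eventually_elim (auto simp: E_def chi_def indicator_def)
  qed (auto simp: E_def)
  also have "\<dots> = (\<integral>s. indicator {0..1} s *\<^sub>R (r s / k) \<partial>lborel) + E 1 * g 1 / k - E 0 * g 0 / k"
    using rI(2) by simp
  also have "cmod \<dots> \<le> cmod (\<integral>s. indicator {0..1} s *\<^sub>R (r s / k) \<partial>lborel) + cmod (E 1 * g 1 / k) + cmod (E 0 * g 0 / k)"
    by (meson norm_triangle_ineq norm_triangle_ineq4 order_trans add_right_mono)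
  also have "\<dots> \<le> 1 / (2 * pi * m) + 1 / (2 * pi * m) + 1 / (2 * pi * m)"
    by (intro add_mono 1 2) auto
  also have "\<dots> = 3 / (2 * pi) / m" by simp
  also have "\<dots> \<le> 1 / m"
    using m pi_gt3 by (intro divide_right_mono) (auto simp: divide_simps)
  finally show ?thesis .
qed

text \<open>The phase in s has derivative (d s - w) / c, and for |w| \<ge> 2 |d| this stays at least
  |w| / (2 |c|) in absolute value on [0, 1]. The numerator sqrt |c| that survives is what makes the
  laws collapse in the cusp.\<close>

lemma norm_kernel_decay:
  assumes c: "c \<noteq> 0" and w: "w \<noteq> 0" "2 * \<bar>d\<bar> \<le> \<bar>w\<bar>"
  shows "cmod (weil_kernel a b c d w) \<le> 2 * sqrt \<bar>c\<bar> / \<bar>w\<bar>"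
proof -
  let ?I = "\<integral>s. e2pi (((a * w\<^sup>2 + d * s\<^sup>2) / 2 - w * s) / c) * of_real (chi s) \<partial>lborel"
  have I: "?I = (\<integral>s. e2pi (a * w\<^sup>2 / 2 / c) * (e2pi (d / c * s\<^sup>2 / 2 + (- w / c) * s) * of_real (chi s)) \<partial>lborel)"
  proof (intro Bochner_Integration.integral_cong refl)
    fix s
    have "((a * w\<^sup>2 + d * s\<^sup>2) / 2 - w * s) / c = a * w\<^sup>2 / 2 / c + (d / c * s\<^sup>2 / 2 + (- w / c) * s)"
      using c by (simp add: field_simps)
    then show "e2pi (((a * w\<^sup>2 + d * s\<^sup>2) / 2 - w * s) / c) * of_real (chi s) =
        e2pi (a * w\<^sup>2 / 2 / c) * (e2pi (d / c * s\<^sup>2 / 2 + (- w / c) * s) * of_real (chi s))"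
      by (simp only: e2pi_add mult.assoc)
  qed
  have "cmod ?I = cmod (\<integral>s. e2pi (d / c * s\<^sup>2 / 2 + (- w / c) * s) * of_real (chi s) \<partial>lborel)"
    unfolding I by (subst integral_mult_right_zero) (simp only: norm_mult norm_e2pi mult_1_left)
  also have "\<dots> \<le> 1 / (\<bar>w\<bar> / (2 * \<bar>c\<bar>))"
  proof (rule first_derivative_test)
    fix s :: real assume s: "0 \<le> s" "s \<le> 1"
    have "\<bar>d * s\<bar> \<le> \<bar>d\<bar> * 1" unfolding abs_mult using s by (intro mult_left_mono) auto
    then have "\<bar>w\<bar> / 2 \<le> \<bar>d * s - w\<bar>" using w by linarith
    then have "\<bar>w\<bar> / 2 / \<bar>c\<bar> \<le> \<bar>d * s - w\<bar> / \<bar>c\<bar>" by (intro divide_right_mono) auto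
    also have "\<dots> = \<bar>d / c * s + - w / c\<bar>" by (simp add: diff_divide_distrib flip: abs_divide)
    finally show "\<bar>w\<bar> / (2 * \<bar>c\<bar>) \<le> \<bar>d / c * s + - w / c\<bar>" by simp
  next
    have "\<bar>d\<bar> / \<bar>c\<bar> \<le> \<bar>w\<bar> / 2 / \<bar>c\<bar>" using w by (intro divide_right_mono) auto
    then show "\<bar>d / c\<bar> \<le> \<bar>w\<bar> / (2 * \<bar>c\<bar>)" by simp
  qed (use c w in simp)
  also have "\<dots> = 2 * \<bar>c\<bar> / \<bar>w\<bar>" by simp
  finally have "1 / sqrt \<bar>c\<bar> * cmod ?I \<le> 1 / sqrt \<bar>c\<bar> * (2 * \<bar>c\<bar> / \<bar>w\<bar>)" by (intro mult_left_mono) auto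
  also have "\<dots> = 2 * (\<bar>c\<bar> / sqrt \<bar>c\<bar>) / \<bar>w\<bar>" by simp
  also have "\<bar>c\<bar> / sqrt \<bar>c\<bar> = sqrt \<bar>c\<bar>" by (rule real_div_sqrt) simp
  finally show ?thesis using c by (simp add:  weil_kernel_def norm_mult norm_divide)
qed

text \<open>A stationary point can occur only for bounded w, where the trivial bound is used; beyond
  1 + 2 d1 the decay estimate applies. For c \<noteq> 0 the upper row enters through a unimodular
  factor alone, so the constant depends only on the range of c and d.\<close>

lemma norm_kernel_uniform:
  assumes "0 < c0" "c0 \<le> \<bar>c\<bar>" "\<bar>c\<bar> \<le> c1" "\<bar>d\<bar> \<le> d1"
  shows "cmod (weil_kernel a b c d w) \<le> (4 * sqrt c1 + (2 + 2 * d1) / sqrt c0) / (1 + \<bar>w\<bar>)"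
proof -
  have d1: "d1 \<ge> 0" and c1: "c1 \<ge> 0" using assms by linarith+
  show ?thesis
  proof (cases "\<bar>w\<bar> \<ge> 1 + 2 * d1")
    case True
    then have "cmod (weil_kernel a b c d w) \<le> 2 * sqrt \<bar>c\<bar> / \<bar>w\<bar>"
      using assms d1 by (intro norm_kernel_decay) auto
    also have "\<dots> \<le> 2 * sqrt c1 / \<bar>w\<bar>" using assms by (intro divide_right_mono mult_left_mono) auto
    also have "\<dots> \<le> 4 * sqrt c1 / (1 + \<bar>w\<bar>)"
    proof -
      have "2 * sqrt c1 * (1 + \<bar>w\<bar>) \<le> 2 * sqrt c1 * (2 * \<bar>w\<bar>)"
        using True d1 c1 by (intro mult_left_mono) auto
      then show ?thesis using True d1 by (simp add: field_simps)
    qed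
    also have "\<dots> \<le> (4 * sqrt c1 + (2 + 2 * d1) / sqrt c0) / (1 + \<bar>w\<bar>)"
      using assms d1 by (intro divide_right_mono) auto
    finally show ?thesis .
  next
    case False
    have "cmod (weil_kernel a b c d w) \<le> 1 / sqrt \<bar>c\<bar>" using assms by (intro norm_kernel_le) auto
    also have "\<dots> \<le> 1 / sqrt c0" using assms by (intro divide_left_mono) auto
    also have "\<dots> = (1 + \<bar>w\<bar>) / sqrt c0 / (1 + \<bar>w\<bar>)" by simp
    also have "\<dots> \<le> (2 + 2 * d1) / sqrt c0 / (1 + \<bar>w\<bar>)"
      using False assms by (intro divide_right_mono) auto
    also have "\<dots> \<le> (4 * sqrt c1 + (2 + 2 * d1) / sqrt c0) / (1 + \<bar>w\<bar>)"
      using c1 by (intro divide_right_mono) auto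
    finally show ?thesis .
  qed
qed

lemma kernel_decay:
  assumes det: "a * d - b * c = 1"
  obtains C where "\<And>w. cmod (weil_kernel a b c d w) \<le> C / (1 + \<bar>w\<bar>)"
proof (cases "c = 0")
  case True
  then have a: "a \<noteq> 0" using det by auto
  have "cmod (weil_kernel a b c d w) \<le> (sqrt \<bar>a\<bar> * (1 + 1 / \<bar>a\<bar>)) / (1 + \<bar>w\<bar>)" for w
  proof (cases "0 < a * w \<and> a * w \<le> 1")
    case True
    then have "\<bar>a\<bar> * \<bar>w\<bar> \<le> 1" by (simp flip: abs_mult)
    then have "\<bar>w\<bar> \<le> 1 / \<bar>a\<bar>" using a by (simp add: field_simps)
    then have "sqrt \<bar>a\<bar> * (1 + \<bar>w\<bar>) \<le> sqrt \<bar>a\<bar> * (1 + 1 / \<bar>a\<bar>)" by (intro mult_left_mono) auto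
    then have "sqrt \<bar>a\<bar> \<le> (sqrt \<bar>a\<bar> * (1 + 1 / \<bar>a\<bar>)) / (1 + \<bar>w\<bar>)"
      by (simp add: pos_le_divide_eq)
    then show ?thesis using \<open>c = 0\<close> True by (simp add:  weil_kernel_def norm_mult chi_def)
  next
    case False
    then show ?thesis using \<open>c = 0\<close> a by (auto simp:  weil_kernel_def chi_def indicator_def)
  qed
  then show ?thesis by (rule that)
next
  case False
  then show ?thesis
    using norm_kernel_uniform[of "\<bar>c\<bar>" c "\<bar>c\<bar>" d "\<bar>d\<bar>"] by (intro that) auto
qed

section \<open>Laws attached to matrices and their limits\<close>

definition kernel_law :: "real \<Rightarrow> real \<Rightarrow> real \<Rightarrow> real \<Rightarrow> complex measure" where
  "kernel_law a b c d = law (zak_sum (weil_kernel a b c d))"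

lemma zak_kernel: "a * d - b * c = 1 \<Longrightarrow> zak (weil_kernel a b c d) (zak_sum (weil_kernel a b c d))"
  by (metis kernel_decay measurable_kernel zak_zak_sum)

text \<open>\<open>Theta\<close> is chosen by \<open>SOME\<close>; \<open>zak_sum\<close> shows that
  a choice exists, and \<open>law_cong_zak\<close> that the law does not depend on it.\<close>

lemma nu_eq_kernel_law:
  assumes det: "a * d - b * c = 1"
  shows "nu (mat2 a b c d) = kernel_law a b c d"
proof -
  have iff: "is_theta (mat2 a b c d) f \<longleftrightarrow> zak (weil_kernel a b c d) f \<and> (\<forall>x y. f (x + 1, y) = f (x, y))" for f
    unfolding is_theta_def zak_def theta_term_eq[OF det] by blast
  have "is_theta (mat2 a b c d) (zak_sum (weil_kernel a b c d))"
    unfolding iff using zak_kernel[OF det] zak_sum_periodic by blast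
  then have "is_theta (mat2 a b c d) (Theta (mat2 a b c d))"
    unfolding Theta_def by (rule someI[of "is_theta (mat2 a b c d)"])
  then have "law (Theta (mat2 a b c d)) = law (zak_sum (weil_kernel a b c d))"
    unfolding iff by (intro law_cong_zak[OF _ zak_kernel[OF det]]) auto
  then show ?thesis by (simp add: kernel_law_def law_def nu_def)
qed

lemma kernel_law_in_limit_family:
  assumes det: "a * d - b * c = 1"
  shows "kernel_law a b c d \<in> limit_family"
proof -
  let ?M = "mat2 a b c d" and ?r = "{(M, M'). M \<in> SL2R \<and> M' \<in> SL2R \<and> (\<exists>A\<in>SL2Z. M' = A ** M)}"
  have M: "?M \<in> SL2R" using det by (simp add: SL2R_def)
  have "(?M, ?M) \<in> ?r"
  proof -
    have "mat 1 $ i $ j \<in> (\<int> :: real set)" for i j :: 2 by (simp add: mat_def)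
    then have "mat 1 \<in> SL2Z" by (simp add: SL2Z_def)
    moreover have "?M = mat 1 ** ?M" by simp
    ultimately show ?thesis using M by blast
  qed
  then have "?M \<in> ?r `` {?M}" by blast
  moreover have "?r `` {?M} \<in> modular_quotient"
    unfolding modular_quotient_def using M by (rule quotientI)
  ultimately show ?thesis
    unfolding limit_family_def nu_eq_kernel_law[OF det, symmetric] by blast
qed

lemma limit_family_cases:
  assumes "\<nu> \<in> limit_family"
  obtains "\<nu> = return borel 0" | a b c d where "a * d - b * c = 1" "\<nu> = kernel_law a b c d"
proof -
  consider "\<nu> = return borel 0" | M C where "\<nu> = nu M" "C \<in> modular_quotient" "M \<in> C"
    using assms by (auto simp: limit_family_def)
  then show ?thesis
  proof cases
    case 2
    then have "M \<in> SL2R" by (auto simp: modular_quotient_def quotient_def)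
    then have det: "M $ 1 $ 1 * M $ 2 $ 2 - M $ 1 $ 2 * M $ 2 $ 1 = 1"
      by (simp add: SL2R_def det_2)
    then show ?thesis
      using that(2)[OF det] nu_eq_kernel_law[OF det] 2 by (simp add: mat2_eta)
  qed (use that in blast)
qed

lemma law_zero: "law (\<lambda>_. 0) = return borel 0"
  unfolding law_def by (simp add: case_prod_beta' circle3.P.prob_space_axioms prob_space.distr_const)

text \<open>Dominated convergence with majorant \<open>chi\<close> gives convergence of the kernels
  at each point, and the uniform decay estimate supplies the majorant for Tannery's theorem. As c0
  \<noteq> 0, the determinant fixes b, which is why limits of a, c and d suffice.\<close>

lemma kernel_law_continuous:
  fixes a b c d :: "nat \<Rightarrow> real"
  assumes det: "\<And>j. a j * d j - b j * c j = 1" and det0: "a0 * d0 - b0 * c0 = 1" and c0: "c0 \<noteq> 0"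
    and lim: "a \<longlonglongrightarrow> a0" "c \<longlonglongrightarrow> c0" "d \<longlonglongrightarrow> d0"
  shows "weak_conv_complex (\<lambda>j. kernel_law (a j) (b j) (c j) (d j)) (kernel_law a0 b0 c0 d0)"
proof -
  have "(\<lambda>j. \<bar>c j\<bar>) \<longlonglongrightarrow> \<bar>c0\<bar>" "(\<lambda>j. \<bar>d j\<bar>) \<longlonglongrightarrow> \<bar>d0\<bar>" by (intro tendsto_intros lim)+
  note lim' = this
  have "\<forall>\<^sub>F j in sequentially. \<bar>c j\<bar> > \<bar>c0\<bar> / 2" "\<forall>\<^sub>F j in sequentially. \<bar>c j\<bar> < \<bar>c0\<bar> + 1"
     "\<forall>\<^sub>F j in sequentially. \<bar>d j\<bar> < \<bar>d0\<bar> + 1"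
    by (rule order_tendstoD[OF lim'(1)] order_tendstoD[OF lim'(2)], use c0 in simp)+
  then have "\<forall>\<^sub>F j in sequentially. \<bar>c j\<bar> > \<bar>c0\<bar> / 2 \<and> \<bar>c j\<bar> < \<bar>c0\<bar> + 1 \<and> \<bar>d j\<bar> < \<bar>d0\<bar> + 1"
    by eventually_elim auto
  then obtain m where m: "\<And>j. j \<ge> m \<Longrightarrow> \<bar>c j\<bar> > \<bar>c0\<bar> / 2 \<and> \<bar>c j\<bar> < \<bar>c0\<bar> + 1 \<and> \<bar>d j\<bar> < \<bar>d0\<bar> + 1"
    unfolding eventually_sequentially by blast
  \<comment> \<open>The decay constant for |c0| / 2 < |c| < |c0| + 1 and |d| < |d0| + 1, a region
    that contains (c0, d0) as well.\<close>
  define C where "C = 4 * sqrt (\<bar>c0\<bar> + 1) + (2 + 2 * (\<bar>d0\<bar> + 1)) / sqrt (\<bar>c0\<bar> / 2)"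
  have cm: "c (j + m) \<noteq> 0" for j using m[of "j + m"] by auto
  have bd: "cmod (weil_kernel (a (j + m)) (b (j + m)) (c (j + m)) (d (j + m)) w) \<le> C / (1 + \<bar>w\<bar>)" for j w
    unfolding C_def using m[of "j + m"] c0 by (intro norm_kernel_uniform) auto
  have bd0: "cmod (weil_kernel a0 b0 c0 d0 w) \<le> C / (1 + \<bar>w\<bar>)" for w
    unfolding C_def using c0 by (intro norm_kernel_uniform) auto
  have lm: "(\<lambda>j. a (j + m)) \<longlonglongrightarrow> a0" "(\<lambda>j. c (j + m)) \<longlonglongrightarrow> c0" "(\<lambda>j. d (j + m)) \<longlonglongrightarrow> d0"
    using lim by (auto intro: LIMSEQ_ignore_initial_segment)
  have conv: "(\<lambda>j. weil_kernel (a (j + m)) (b (j + m)) (c (j + m)) (d (j + m)) w) \<longlonglongrightarrow> weil_kernel a0 b0 c0 d0 w" for w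
  proof -
    have "(\<lambda>j. \<integral>s. e2pi (((a (j + m) * w\<^sup>2 + d (j + m) * s\<^sup>2) / 2 - w * s) / c (j + m)) * of_real (chi s) \<partial>lborel)
       \<longlonglongrightarrow> (\<integral>s. e2pi (((a0 * w\<^sup>2 + d0 * s\<^sup>2) / 2 - w * s) / c0) * of_real (chi s) \<partial>lborel)"
      by (rule integral_dominated_convergence[where w = chi])
         (auto intro!: tendsto_intros lm simp: c0 norm_mult integrable_chi chi_def)
    then have "(\<lambda>j. of_real (1 / sqrt \<bar>c (j + m)\<bar>) * (\<integral>s. e2pi (((a (j + m) * w\<^sup>2 + d (j + m) * s\<^sup>2) / 2 - w * s) / c (j + m)) * of_real (chi s) \<partial>lborel))
       \<longlonglongrightarrow> of_real (1 / sqrt \<bar>c0\<bar>) * (\<integral>s. e2pi (((a0 * w\<^sup>2 + d0 * s\<^sup>2) / 2 - w * s) / c0) * of_real (chi s) \<partial>lborel)"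
      by (intro tendsto_intros lm) (use c0 in auto)
    then show ?thesis using c0 cm by (simp add:  weil_kernel_def)
  qed
  have "weak_conv_complex (\<lambda>j. kernel_law (a (j + m)) (b (j + m)) (c (j + m)) (d (j + m))) (kernel_law a0 b0 c0 d0)"
    unfolding kernel_law_def
  proof (rule law_convergence[OF zak_kernel[OF det] zak_kernel[OF det0]], intro AE_I2 tannery_zak conv)
    fix y :: real and j n
    show "cmod (weil_kernel (a (j + m)) (b (j + m)) (c (j + m)) (d (j + m)) (of_int n - y) - weil_kernel a0 b0 c0 d0 (of_int n - y)) \<le> (C + C) / (1 + \<bar>of_int n - y\<bar>)"
      unfolding add_divide_distrib by (rule order_trans[OF norm_triangle_ineq4 add_mono[OF bd bd0]])
  qed
  then show ?thesis
    unfolding weak_conv_complex_def by (blast intro: LIMSEQ_offset)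
qed

text \<open>For y not an integer the points n - y keep a distance \<delta> > 0 from 0. Once 2 |d| <
  \<delta>, the decay estimate holds at all of them, with a factor sqrt |c| that tends to 0. The
  upper row may diverge meanwhile.\<close>

lemma kernel_law_cusp:
  fixes a b c d :: "nat \<Rightarrow> real"
  assumes det: "\<And>j. a j * d j - b j * c j = 1" and c: "\<And>j. c j \<noteq> 0"
    and lim: "c \<longlonglongrightarrow> 0" "d \<longlonglongrightarrow> 0"
  shows "weak_conv_complex (\<lambda>j. kernel_law (a j) (b j) (c j) (d j)) (return borel 0)"
  unfolding kernel_law_def law_zero[symmetric]
proof (rule law_convergence[OF zak_kernel[OF det] zak_zero])
  have "AE y in lborel. y \<notin> (\<int> :: real set)"
    using countable_imp_null_set_lborel[OF countable_int] by (rule AE_not_in)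
  then show "AE y in lborel. \<exists>s. (\<forall>\<^sub>F j in sequentially. \<forall>A. finite A \<longrightarrow> (\<Sum>n\<in>A. (cmod (weil_kernel (a j) (b j) (c j) (d j) (of_int n - y) - 0))\<^sup>2) \<le> s j) \<and> s \<longlonglongrightarrow> 0"
  proof eventually_elim
    case (elim y)
    define \<delta> where "\<delta> = min (frac y) (1 - frac y)"
    have \<delta>: "\<delta> > 0" using elim by (auto simp: \<delta>_def frac_lt_1 frac_gt_0_iff)
    have dist: "\<delta> \<le> \<bar>of_int n - y\<bar>" for n
    proof (cases "n \<le> \<lfloor>y\<rfloor>")
      case True
      then have "of_int n \<le> real_of_int \<lfloor>y\<rfloor>" by simp
      then show ?thesis unfolding \<delta>_def frac_def by linarith
    next
      case False
      then have "\<lfloor>y\<rfloor> + 1 \<le> n" by simp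
      then have "real_of_int \<lfloor>y\<rfloor> + 1 \<le> real_of_int n" by linarith
      then show ?thesis unfolding \<delta>_def frac_def by linarith
    qed
    define S where "S = infsum (\<lambda>n::int. 1 / (1 + \<bar>real_of_int n\<bar>)\<^sup>2) UNIV"
    \<comment> \<open>The factor 1 + 1 / \<delta> replaces 1 / |n - y| by 1 / (1 + |n - y|); the
      factor 1 + |y| recentres the decay at 0.\<close>
    define E where "E = (1 + 1 / \<delta>) * (1 + \<bar>y\<bar>)"
    define s where "s = (\<lambda>j. (2 * sqrt \<bar>c j\<bar> * E)\<^sup>2 * S)"
    have "(\<lambda>j. (2 * sqrt \<bar>c j\<bar> * E)\<^sup>2 * S) \<longlonglongrightarrow> (2 * sqrt \<bar>0\<bar> * E)\<^sup>2 * S"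
      by (intro tendsto_intros lim)
    then have "s \<longlonglongrightarrow> 0" by (simp add: s_def)
    moreover have "\<forall>\<^sub>F j in sequentially. \<bar>d j\<bar> < \<delta> / 2"
      using order_tendstoD(2)[OF tendsto_rabs[OF lim(2)], of "\<delta> / 2"] \<delta> by simp
    then have "\<forall>\<^sub>F j in sequentially. \<forall>A. finite A \<longrightarrow> (\<Sum>n\<in>A. (cmod (weil_kernel (a j) (b j) (c j) (d j) (of_int n - y) - 0))\<^sup>2) \<le> s j"
    proof eventually_elim
      case (elim j)
      have "(cmod (weil_kernel (a j) (b j) (c j) (d j) (of_int n - y)))\<^sup>2 \<le> (2 * sqrt \<bar>c j\<bar> * E)\<^sup>2 * (1 / (1 + \<bar>real_of_int n\<bar>)\<^sup>2)" for n
      proof -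
        let ?t = "\<bar>of_int n - y\<bar>"
        have t: "?t > 0" using dist[of n] \<delta> by linarith
        have "cmod (weil_kernel (a j) (b j) (c j) (d j) (of_int n - y)) \<le> 2 * sqrt \<bar>c j\<bar> / ?t"
          using elim dist[of n] \<delta> by (intro norm_kernel_decay c) auto
        also have "\<dots> \<le> 2 * sqrt \<bar>c j\<bar> * (1 + 1 / \<delta>) / (1 + ?t)"
        proof -
          have "1 \<le> ?t / \<delta>" using dist[of n] \<delta> by simp
          then have "1 + ?t \<le> (1 + 1 / \<delta>) * ?t" by (simp add: distrib_right)
          then have "2 * sqrt \<bar>c j\<bar> * (1 + ?t) \<le> 2 * sqrt \<bar>c j\<bar> * ((1 + 1 / \<delta>) * ?t)" by (intro mult_left_mono) auto
          then show ?thesis using t by (simp add: pos_divide_le_eq pos_le_divide_eq mult.assoc)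
        qed
        finally have "(cmod (weil_kernel (a j) (b j) (c j) (d j) (of_int n - y)))\<^sup>2 \<le> (2 * sqrt \<bar>c j\<bar> * (1 + 1 / \<delta>) * (1 + \<bar>y\<bar>))\<^sup>2 / (1 + \<bar>real_of_int n\<bar>)\<^sup>2"
          using \<delta> by (intro decay_shift) auto
        then show ?thesis by (simp add: E_def mult.assoc)
      qed
      note pointwise = this
      show ?case
      proof (intro allI impI)
        fix A :: "int set" assume A: "finite A"
        have "(\<Sum>n\<in>A. (cmod (weil_kernel (a j) (b j) (c j) (d j) (of_int n - y) - 0))\<^sup>2) \<le> 
           (\<Sum>n\<in>A. (2 * sqrt \<bar>c j\<bar> * E)\<^sup>2 * (1 / (1 + \<bar>real_of_int n\<bar>)\<^sup>2))"
          by (intro sum_mono) (use pointwise in simp)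
        also have "\<dots> = (2 * sqrt \<bar>c j\<bar> * E)\<^sup>2 * (\<Sum>n\<in>A. 1 / (1 + \<bar>real_of_int n\<bar>)\<^sup>2)"
          by (rule sum_distrib_left[symmetric])
        also have "\<dots> \<le> s j"
          unfolding s_def S_def
          by (intro mult_left_mono finite_sum_le_infsum summable_on_inverse_square_int A) auto
        finally show "(\<Sum>n\<in>A. (cmod (weil_kernel (a j) (b j) (c j) (d j) (of_int n - y) - 0))\<^sup>2) \<le> s j" .
      qed
    qed
    ultimately show ?case by blast
  qed
qed

section \<open>Fourier uniqueness\<close>

text \<open>The positive and the negative part of \<open>r\<close> are densities of finite measures
  that agree on all half lines, hence everywhere. So the two parts coincide almost everywhere, and
  they are never both nonzero.\<close>

lemma AE_zero_if_tail_integrals_zero: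
  fixes r :: "real \<Rightarrow> real"
  assumes r: "integrable lborel r" and zero: "\<And>a. (\<integral>t. r t * indicator {a<..} t \<partial>lborel) = 0"
  shows "AE t in lborel. r t = 0"
proof -
  have [measurable]: "r \<in> borel_measurable borel" using r by auto
  have int: "integrable lborel (\<lambda>t. max 0 (s * r t))" for s
    using r by (intro integrable_max) auto
  have inti: "integrable lborel (\<lambda>t. max 0 (s * r t) * indicator {a<..} t)" for s a
    by (rule Bochner_Integration.integrable_bound[OF int[of s]]) (auto simp: indicator_def)
  have em: "emeasure (density lborel (\<lambda>t. ennreal (max 0 (s * r t)))) {a<..} = ennreal (\<integral>t. max 0 (s * r t) * indicator {a<..} t \<partial>lborel)" for s a
  proof -
    have "emeasure (density lborel (\<lambda>t. ennreal (max 0 (s * r t)))) {a<..} = (\<integral>\<^sup>+t. ennreal (max 0 (s * r t)) * indicator {a<..} t \<partial>lborel)"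
      by (subst emeasure_density) auto
    also have "\<dots> = (\<integral>\<^sup>+t. ennreal (max 0 (s * r t) * indicator {a<..} t) \<partial>lborel)"
      by (intro nn_integral_cong) (auto simp: indicator_def)
    also have "\<dots> = ennreal (\<integral>t. max 0 (s * r t) * indicator {a<..} t \<partial>lborel)"
      by (rule nn_integral_eq_integral[OF inti]) auto
    finally show ?thesis .
  qed
  have "density lborel (\<lambda>t. ennreal (max 0 (1 * r t))) = density lborel (\<lambda>t. ennreal (max 0 (- 1 * r t)))"
  proof (rule measure_eqI_lessThan)
    fix a
    have "(\<integral>t. max 0 (1 * r t) * indicator {a<..} t \<partial>lborel) - (\<integral>t. max 0 (- 1 * r t) * indicator {a<..} t \<partial>lborel)
       = (\<integral>t. max 0 (1 * r t) * indicator {a<..} t - max 0 (- 1 * r t) * indicator {a<..} t \<partial>lborel)"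
      by (rule Bochner_Integration.integral_diff[symmetric, OF inti inti])
    also have "\<dots> = (\<integral>t. r t * indicator {a<..} t \<partial>lborel)"
      by (intro Bochner_Integration.integral_cong) (auto simp: indicator_def max_def)
    finally have "(\<integral>t. max 0 (1 * r t) * indicator {a<..} t \<partial>lborel) = (\<integral>t. max 0 (- 1 * r t) * indicator {a<..} t \<partial>lborel)"
      by (simp only: zero) 
    then show "emeasure (density lborel (\<lambda>t. ennreal (max 0 (1 * r t)))) {a<..} = emeasure (density lborel (\<lambda>t. ennreal (max 0 (- 1 * r t)))) {a<..}"
      by (simp only: em)
    show "emeasure (density lborel (\<lambda>t. ennreal (max 0 (1 * r t)))) {a<..} < \<infinity>"
      by (simp only: em) simp
  qed auto
  then have "AE t in lborel. ennreal (max 0 (1 * r t)) = ennreal (max 0 (- 1 * r t))"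
    by (subst (asm) sigma_finite_measure.density_unique_iff[OF sigma_finite_lborel]) auto
  then show ?thesis
    by eventually_elim (auto simp: max_def ennreal_eq_0_iff split: if_splits)
qed

lemma e2pi_eq_iff: "e2pi x = e2pi y \<longleftrightarrow> x - y \<in> \<int>"
proof
  assume "e2pi x = e2pi y"
  then obtain n :: int where n: "2 * of_real pi * \<i> * of_real x = 2 * of_real pi * \<i> * of_real y + (of_int (2 * n) * pi) * \<i>"
    unfolding e2pi_def exp_eq by blast
  then have "(2 * of_real pi * \<i>) * complex_of_real x = (2 * of_real pi * \<i>) * complex_of_real (y + of_int n)"
    by (simp add: algebra_simps)
  then have "complex_of_real x = complex_of_real (y + of_int n)"
    by (subst (asm) mult_left_cancel) auto
  then have "x = y + of_int n" using of_real_eq_iff by blast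
  then show "x - y \<in> \<int>" by simp
qed (rule e2pi_cong_Ints)

text \<open>Trigonometric polynomials. The inductive form, without an index set, makes closure under
  products a double induction.\<close>

inductive trig_poly :: "(real \<Rightarrow> complex) \<Rightarrow> bool" where
  trig_monomial: "trig_poly (\<lambda>x. c * e2pi (of_int n * x))"
| trig_add: "trig_poly f \<Longrightarrow> trig_poly g \<Longrightarrow> trig_poly (\<lambda>x. f x + g x)"

lemma trig_mult:
  assumes "trig_poly f" "trig_poly g"
  shows "trig_poly (\<lambda>x. f x * g x)"
  using assms
proof (induction rule: trig_poly.induct)
  case (trig_monomial c n)
  then show ?case
  proof (induction rule: trig_poly.induct)
    case (trig_monomial c' n')
    have "(\<lambda>x. c * e2pi (of_int n * x) * (c' * e2pi (of_int n' * x))) = (\<lambda>x. (c * c') * e2pi (of_int (n + n') * x))"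
      by (simp add: algebra_simps e2pi_add)
    then show ?case by (simp only: trig_poly.trig_monomial)
  next
    case (trig_add f g)
    then show ?case unfolding distrib_left by (intro trig_poly.trig_add)
  qed
next
  case (trig_add f f')
  then show ?case unfolding distrib_right by (intro trig_poly.trig_add)
qed

lemma trig_poly_real_polynomial:
  assumes "real_polynomial_function p"
  shows "trig_poly (\<lambda>x. complex_of_real (p (e2pi x)))"
  using assms
proof (induction rule: real_polynomial_function.induct)
  case (linear f)
  \<comment> \<open>A real linear functional of e(x) is a combination of its real and imaginary
    parts, hence of e(x) and e(-x).\<close>
  have "complex_of_real (f (e2pi x)) = (of_real (f 1) - \<i> * of_real (f \<i>)) / 2 * e2pi (of_int 1 * x)
      + (of_real (f 1) + \<i> * of_real (f \<i>)) / 2 * e2pi (of_int (-1) * x)" for x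
  proof -
    interpret f: bounded_linear f by fact
    let ?z = "e2pi x"
    have "?z = Re ?z *\<^sub>R 1 + Im ?z *\<^sub>R \<i>" by (simp add: complex_eq_iff)
    then have "f ?z = Re ?z * f 1 + Im ?z * f \<i>" by (metis f.add f.scaleR real_scaleR_def)
    then show ?thesis
      by (simp add: e2pi_minus complex_eq_iff field_simps)
  qed
  then show ?case by (simp only: trig_poly.intros)
next
  case (const c)
  show ?case using trig_monomial[of "of_real c" 0] by simp
qed (use trig_add trig_mult in auto)

text \<open>The class of test functions annihilated by \<open>D\<close> is enlarged in stages:
  trigonometric polynomials by hypothesis, continuous functions of e(x) by Stone-Weierstrass on the
  unit circle, and indicators of (a, 1) as bounded limits of continuous functions. All tail
  integrals of \<open>D\<close> then vanish.\<close>

lemma fourier_uniqueness: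
  fixes D :: "real \<Rightarrow> complex"
  assumes D: "integrable circle D" and zero: "\<And>n. (\<integral>x. D x * e2pi (- (of_int n * x)) \<partial>circle) = 0"
  shows "AE x in circle. D x = 0"
proof -
  have bd: "integrable circle (\<lambda>x. D x * g x)" if "g \<in> borel_measurable borel" "\<And>x. cmod (g x) \<le> B" for g B
  proof (rule Bochner_Integration.integrable_bound[OF integrable_mult_right[of B circle "\<lambda>x. cmod (D x)"]])
    show "(\<lambda>x. D x * g x) \<in> borel_measurable circle"
      using D that by (auto intro!: borel_measurable_times measurable_circle)
    show "AE x in circle. cmod (D x * g x) \<le> norm (B * cmod (D x))"
    proof (rule AE_I2)
      fix x
      have "cmod (D x * g x) = cmod (g x) * cmod (D x)" by (simp add: norm_mult)
      also have "\<dots> \<le> B * cmod (D x)" by (intro mult_right_mono that) simp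
      finally show "cmod (D x * g x) \<le> norm (B * cmod (D x))" by simp
    qed
  qed (use D in simp)
  have trig: "integrable circle (\<lambda>x. D x * f x) \<and> (\<integral>x. D x * f x \<partial>circle) = 0" if "trig_poly f" for f
    using that
  proof induction
    case (trig_monomial c n)
    have "integrable circle (\<lambda>x. D x * e2pi (of_int n * x))"
      by (rule bd[where B = 1]) auto
    moreover have "(\<integral>x. D x * e2pi (of_int n * x) \<partial>circle) = 0"
      using zero[of "- n"] by simp
    moreover have "(\<lambda>x. D x * (c * e2pi (of_int n * x))) = (\<lambda>x. c * (D x * e2pi (of_int n * x)))" by (simp add: mult_ac)
    ultimately show ?case by (simp only: integrable_mult_right integral_mult_right_zero mult_zero_right)
  next
    case (trig_add f g)
    then show ?case by (simp add: distrib_left)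
  qed
  have cont: "(\<integral>x. D x * of_real (\<phi> (e2pi x)) \<partial>circle) = 0" if \<phi>: "continuous_on UNIV \<phi>" for \<phi> :: "complex \<Rightarrow> real"
  proof -
    have "cmod (\<integral>x. D x * of_real (\<phi> (e2pi x)) \<partial>circle) \<le> \<epsilon> * (\<integral>x. cmod (D x) \<partial>circle)" if \<epsilon>: "\<epsilon> > 0" for \<epsilon>
    proof -
      obtain p where p: "real_polynomial_function p" "\<And>z. z \<in> sphere 0 1 \<Longrightarrow> \<bar>\<phi> z - p z\<bar> < \<epsilon>"
        using Stone_Weierstrass_real_polynomial_function[of "sphere (0::complex) 1" \<phi> \<epsilon>] \<epsilon> \<phi>
        by (auto intro: continuous_on_subset)
      have p': "\<bar>\<phi> (e2pi x) - p (e2pi x)\<bar> \<le> \<epsilon>" for x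
        using p(2)[of "e2pi x"] by simp
      have [measurable]: "p \<in> borel_measurable borel" "\<phi> \<in> borel_measurable borel"
        using continuous_real_polymonial_function[OF p(1)] \<phi>
        by (auto intro!: borel_measurable_continuous_onI simp: continuous_on_eq_continuous_within)
      have i1: "integrable circle (\<lambda>x. D x * (of_real (\<phi> (e2pi x)) - of_real (p (e2pi x))))"
        by (rule bd[where B = \<epsilon>]) (use p' in \<open>auto simp flip: of_real_diff\<close>)
      have tp: "integrable circle (\<lambda>x. D x * of_real (p (e2pi x)))" "(\<integral>x. D x * of_real (p (e2pi x)) \<partial>circle) = 0"
        using trig[OF trig_poly_real_polynomial[OF p(1)]] by auto
      have "(\<integral>x. D x * of_real (\<phi> (e2pi x)) \<partial>circle) = (\<integral>x. D x * (of_real (\<phi> (e2pi x)) - of_real (p (e2pi x))) + D x * of_real (p (e2pi x)) \<partial>circle)"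
        by (simp add: algebra_simps)
      also have "\<dots> = (\<integral>x. D x * (of_real (\<phi> (e2pi x)) - of_real (p (e2pi x))) \<partial>circle)"
        using i1 tp by (subst Bochner_Integration.integral_add) auto
      also have "cmod \<dots> \<le> (\<integral>x. cmod (D x * (of_real (\<phi> (e2pi x)) - of_real (p (e2pi x)))) \<partial>circle)"
        by (rule integral_norm_bound)
      also have "\<dots> \<le> (\<integral>x. \<epsilon> * cmod (D x) \<partial>circle)"
      proof (intro integral_mono integrable_norm i1 integrable_mult_right D)
        fix x
        show "cmod (D x * (of_real (\<phi> (e2pi x)) - of_real (p (e2pi x)))) \<le> \<epsilon> * cmod (D x)"
          using mult_right_mono[OF p'[of x], of "cmod (D x)"] by (simp add: norm_mult mult.commute flip: of_real_diff)
      qed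
      finally show ?thesis by simp
    qed
    note * = this
    have "cmod (\<integral>x. D x * of_real (\<phi> (e2pi x)) \<partial>circle) \<le> 0"
    proof (rule field_le_epsilon)
      fix e :: real assume e: "e > 0"
      let ?I = "\<integral>x. cmod (D x) \<partial>circle"
      have I: "?I \<ge> 0" by simp
      have "e / (1 + t) * t \<le> e" if "t \<ge> 0" for t
        using e that by (simp add: field_simps)
      note this[OF I]
      with * [of "e / (1 + ?I)"] e I show "cmod (\<integral>x. D x * of_real (\<phi> (e2pi x)) \<partial>circle) \<le> 0 + e"
        by (auto simp: add_pos_nonneg intro: order_trans)
    qed
    then show ?thesis by simp
  qed
  have tail: "(\<integral>x. D x * indicator {a<..} x \<partial>circle) = 0" if a: "0 \<le> a" "a < 1" for a
  proof -
    \<comment> \<open>The arc to be cut away is closed, so \<open>\<phi> j\<close> vanishes on it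
      and is eventually 1 at every point off it. For a < x < 1 the point e(x) lies off the arc, as x
      - s is strictly between 0 and 1 for s in [0, a].\<close>
    define C where "C = e2pi ` {0..a}"
    have C: "closed C" "C \<noteq> {}"
      unfolding C_def using a by (auto intro!: compact_imp_closed compact_continuous_image continuous_intros)
    define \<phi> where "\<phi> = (\<lambda>j::nat. \<lambda>z. min 1 (real j * infdist z C))"
    have "(\<lambda>j. \<integral>x. D x * of_real (\<phi> j (e2pi x)) \<partial>circle) \<longlonglongrightarrow> (\<integral>x. D x * indicator {a<..} x \<partial>circle)"
    proof (rule integral_dominated_convergence[where w = "\<lambda>x. cmod (D x)"])
      show "AE x in circle. (\<lambda>j. D x * of_real (\<phi> j (e2pi x))) \<longlonglongrightarrow> D x * indicator {a<..} x"
      proof (rule AE_I2)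
        fix x assume "x \<in> space circle"
        then have x: "0 \<le> x" "x < 1" by auto
        show "(\<lambda>j. D x * of_real (\<phi> j (e2pi x))) \<longlonglongrightarrow> D x * indicator {a<..} x"
        proof (cases "x \<le> a")
          case True
          then have "e2pi x \<in> C" using x by (auto simp: C_def)
          then show ?thesis using True by (simp add: \<phi>_def)
        next
          case False
          have "e2pi x \<notin> C"
          proof
            assume "e2pi x \<in> C"
            then obtain s where s: "0 \<le> s" "s \<le> a" "x - s \<in> \<int>" by (auto simp: C_def e2pi_eq_iff)
            then obtain i :: int where "x - s = of_int i" by (auto elim: Ints_cases)
            with s False x a have "0 < real_of_int i" "real_of_int i < 1" by linarith+
            then show False by simp
          qed
          then have pos: "infdist (e2pi x) C > 0"
            using in_closed_iff_infdist_zero[OF C] infdist_nonneg[of "e2pi x" C] by fastforce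
          obtain N :: nat where N: "real N * infdist (e2pi x) C > 1"
            using reals_Archimedean3[OF pos] by blast
          have "\<forall>\<^sub>F j in sequentially. \<phi> j (e2pi x) = 1"
            using eventually_ge_at_top[of N]
          proof eventually_elim
            case (elim j)
            then have "real N * infdist (e2pi x) C \<le> real j * infdist (e2pi x) C"
              using pos by (intro mult_right_mono) auto
            then show ?case using N by (simp add: \<phi>_def)
          qed
          then have "\<forall>\<^sub>F j in sequentially. D x * of_real (\<phi> j (e2pi x)) = D x * indicator {a<..} x"
            by eventually_elim (use False in auto)
          then show ?thesis by (rule tendsto_eventually)
        qed
      qed
      show "AE x in circle. norm (D x * of_real (\<phi> j (e2pi x))) \<le> cmod (D x)" for j
      proof (rule AE_I2)
        fix x
        have "0 \<le> \<phi> j (e2pi x)" "\<phi> j (e2pi x) \<le> 1" by (auto simp: \<phi>_def infdist_nonneg)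
        then have "cmod (D x) * \<bar>\<phi> j (e2pi x)\<bar> \<le> cmod (D x) * 1" by (intro mult_left_mono) auto
        then show "norm (D x * of_real (\<phi> j (e2pi x))) \<le> cmod (D x)" by (simp add: norm_mult)
      qed
      show "(\<lambda>x. D x * of_real (\<phi> j (e2pi x))) \<in> borel_measurable circle" for j
      proof -
        have "(\<lambda>x. complex_of_real (\<phi> j (e2pi x))) \<in> borel_measurable borel"
          unfolding \<phi>_def by (intro borel_measurable_continuous_onI continuous_intros)
        then show ?thesis using D by (auto intro!: borel_measurable_times measurable_circle)
      qed
      show "(\<lambda>x. D x * indicator {a<..} x) \<in> borel_measurable circle"
        using D by (auto intro!: borel_measurable_times measurable_circle)
    qed (use D in simp)
    moreover have "(\<integral>x. D x * of_real (\<phi> j (e2pi x)) \<partial>circle) = 0" for j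
      by (rule cont) (auto simp: \<phi>_def intro!: continuous_intros)
    ultimately show ?thesis by (simp add: LIMSEQ_const_iff)
  qed
  have tail': "(\<integral>x. D x * indicator {a<..} x \<partial>circle) = 0" for a
  proof -
    consider "a < 0" | "0 \<le> a" "a < 1" | "a \<ge> 1" by linarith
    then show ?thesis
    proof cases
      case 1
      have "(\<integral>x. D x * indicator {a<..} x \<partial>circle) = (\<integral>x. D x * e2pi (- (of_int 0 * x)) \<partial>circle)"
        using 1 by (intro Bochner_Integration.integral_cong) auto
      then show ?thesis by (simp only: zero)
    next
      case 3
      have "(\<integral>x. D x * indicator {a<..} x \<partial>circle) = (\<integral>x. 0 \<partial>circle)"
        using 3 by (intro Bochner_Integration.integral_cong) auto
      then show ?thesis by simp
    qed (rule tail)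
  qed
  have lb: "integrable lborel (\<lambda>x. indicator {0..<1} x *\<^sub>R D x)"
    using D unfolding circle_def by (subst (asm) integrable_restrict_space) (auto simp: set_integrable_def)
  have lz: "(\<integral>x. (indicator {0..<1} x *\<^sub>R D x) * indicator {a<..} x \<partial>lborel) = 0" for a
    using tail'[of a] unfolding integral_circle by simp
  have lbi: "integrable lborel (\<lambda>x. (indicator {0..<1} x *\<^sub>R D x) * indicator {a<..} x)" for a
  proof -
    have "(\<lambda>x. z x * indicator {a<..} x) = (\<lambda>x. indicator {a<..} x *\<^sub>R z x)" for z :: "real \<Rightarrow> complex"
      by (auto simp: indicator_def fun_eq_iff)
    then show ?thesis by (simp only:) (rule integrable_mult_indicator[OF _ lb], simp)
  qed
  have "AE x in lborel. Re (indicator {0..<1} x *\<^sub>R D x) = 0"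
  proof (rule AE_zero_if_tail_integrals_zero)
    show "integrable lborel (\<lambda>x. Re (indicator {0..<1} x *\<^sub>R D x))" using lb by (rule integrable_Re)
    show "(\<integral>x. Re (indicator {0..<1} x *\<^sub>R D x) * indicator {a<..} x \<partial>lborel) = 0" for a
    proof -
      have "(\<integral>x. Re (indicator {0..<1} x *\<^sub>R D x) * indicator {a<..} x \<partial>lborel) = (\<integral>x. Re ((indicator {0..<1} x *\<^sub>R D x) * indicator {a<..} x) \<partial>lborel)"
        by (intro Bochner_Integration.integral_cong) (auto simp: indicator_def)
      also have "\<dots> = Re (\<integral>x. (indicator {0..<1} x *\<^sub>R D x) * indicator {a<..} x \<partial>lborel)"
        by (rule integral_Re[OF lbi])
      finally show ?thesis by (simp only: lz zero_complex.sel)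
    qed
  qed
  moreover have "AE x in lborel. Im (indicator {0..<1} x *\<^sub>R D x) = 0"
  proof (rule AE_zero_if_tail_integrals_zero)
    show "integrable lborel (\<lambda>x. Im (indicator {0..<1} x *\<^sub>R D x))" using lb by (rule integrable_Im)
    show "(\<integral>x. Im (indicator {0..<1} x *\<^sub>R D x) * indicator {a<..} x \<partial>lborel) = 0" for a
    proof -
      have "(\<integral>x. Im (indicator {0..<1} x *\<^sub>R D x) * indicator {a<..} x \<partial>lborel) = (\<integral>x. Im ((indicator {0..<1} x *\<^sub>R D x) * indicator {a<..} x) \<partial>lborel)"
        by (intro Bochner_Integration.integral_cong) (auto simp: indicator_def)
      also have "\<dots> = Im (\<integral>x. (indicator {0..<1} x *\<^sub>R D x) * indicator {a<..} x \<partial>lborel)"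
        by (rule integral_Im[OF lbi])
      finally show ?thesis by (simp only: lz zero_complex.sel)
    qed
  qed
  ultimately have "AE x in lborel. x \<in> {0..<1} \<longrightarrow> D x = 0"
    by eventually_elim (auto simp: complex_eq_iff)
  then show ?thesis unfolding circle_def by (subst AE_restrict_space_iff) auto
qed

text \<open>A partial sum whose index set contains n has n-th coefficient exactly K(n - y), and
  convergence in mean square forces convergence of the coefficients.\<close>

lemma fourier_coefficient_zak_sum:
  assumes K: "K \<in> borel_measurable borel" and bd: "\<And>w. cmod (K w) \<le> C / (1 + \<bar>w\<bar>)"
  shows "integrable circle (\<lambda>x. zak_sum K (x, y))"
    and "(\<integral>x. zak_sum K (x, y) * e2pi (- (of_int n * x)) \<partial>circle) = K (of_int n - y)"
proof -
  let ?f = "\<lambda>x. zak_sum K (x, y)" and ?S = "\<lambda>A x. \<Sum>n\<in>A. K (of_int n - y) * e2pi (of_int n * x)"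
  have [measurable]: "?f \<in> borel_measurable circle"
    by (intro measurable_circle measurable_section measurable_zak_sum K)
  have [measurable]: "?S A \<in> borel_measurable circle" for A
    by (rule measurable_circle) measurable
  have intS: "integrable circle (?S A)" for A
    by auto
  have close: "integrable circle ?f \<and> cmod ((\<integral>x. ?f x * e2pi (- (of_int n * x)) \<partial>circle) - K (of_int n - y)) \<le> 2 * \<epsilon>" if \<epsilon>: "\<epsilon> > 0" for \<epsilon>
  proof -
    have "\<forall>\<^sub>F A in finite_subsets_at_top UNIV. (\<integral>\<^sup>+x. ennreal ((cmod (?f x - ?S A x))\<^sup>2) \<partial>circle) < ennreal (\<epsilon>\<^sup>2)"
      using order_tendstoD(2)[OF zak_sum_limit[OF K bd, of y], of "ennreal (\<epsilon>\<^sup>2)"] \<epsilon> by simp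
    then obtain A0 where "finite A0" and A0: "\<And>A. finite A \<Longrightarrow> A0 \<subseteq> A \<Longrightarrow> (\<integral>\<^sup>+x. ennreal ((cmod (?f x - ?S A x))\<^sup>2) \<partial>circle) < ennreal (\<epsilon>\<^sup>2)"
      unfolding eventually_finite_subsets_at_top by auto
    define A where "A = insert n A0"
    have A: "finite A" "n \<in> A" and small: "(\<integral>\<^sup>+x. ennreal ((cmod (?f x - ?S A x))\<^sup>2) \<partial>circle) < ennreal (\<epsilon>\<^sup>2)"
      using \<open>finite A0\<close> A0[of A] by (auto simp: A_def)
    \<comment> \<open>Young's inequality: on a probability space it passes from mean square error
      \<epsilon>^2 to mean error 2 \<epsilon>, and so also yields integrability of the
      limit.\<close>
    have le: "cmod z \<le> \<epsilon> + 1 / \<epsilon> * (cmod z)\<^sup>2" for z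
    proof (cases "cmod z \<le> \<epsilon>")
      case False
      then have "cmod z * \<epsilon> \<le> cmod z * cmod z" by (intro mult_left_mono) auto
      then have "cmod z \<le> 1 / \<epsilon> * (cmod z)\<^sup>2" using \<epsilon> by (simp add: field_simps power2_eq_square)
      then show ?thesis using \<epsilon> by simp
    qed (use \<epsilon> in \<open>simp add: add_increasing2\<close>)
    have nn: "(\<integral>\<^sup>+x. ennreal (cmod (?f x - ?S A x)) \<partial>circle) \<le> ennreal (2 * \<epsilon>)"
    proof -
      have "(\<integral>\<^sup>+x. ennreal (cmod (?f x - ?S A x)) \<partial>circle) \<le> (\<integral>\<^sup>+x. ennreal \<epsilon> + ennreal (1 / \<epsilon>) * ennreal ((cmod (?f x - ?S A x))\<^sup>2) \<partial>circle)"
        using le \<epsilon> by (intro nn_integral_mono) (simp flip: ennreal_plus ennreal_mult' add: ennreal_leI del: ennreal_power)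
      also have "\<dots> = ennreal \<epsilon> + ennreal (1 / \<epsilon>) * (\<integral>\<^sup>+x. ennreal ((cmod (?f x - ?S A x))\<^sup>2) \<partial>circle)"
        using circle.emeasure_space_1 by (subst nn_integral_add) (auto simp: nn_integral_cmult)
      also have "\<dots> \<le> ennreal \<epsilon> + ennreal (1 / \<epsilon>) * ennreal (\<epsilon>\<^sup>2)"
        using small by (intro add_left_mono mult_left_mono) auto
      also have "\<dots> = ennreal (2 * \<epsilon>)"
        using \<epsilon> by (simp flip: ennreal_mult ennreal_plus) (simp add: power2_eq_square)
      finally show ?thesis .
    qed
    have intd: "integrable circle (\<lambda>x. ?f x - ?S A x)"
      unfolding integrable_iff_bounded using nn by (auto simp: less_top[symmetric] top_unique)
    then have intf: "integrable circle ?f"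
      using Bochner_Integration.integrable_add[OF intd intS[of A]] by simp
    have m: "integrable circle (\<lambda>x. g x * e2pi (- (of_int n * x)))" if "integrable circle g" for g
      by (rule Bochner_Integration.integrable_bound[OF that]) (use that in \<open>auto simp: norm_mult intro!: borel_measurable_times measurable_circle\<close>)
    have "(\<integral>x. ?f x * e2pi (- (of_int n * x)) \<partial>circle) - K (of_int n - y) = 
        (\<integral>x. ?f x * e2pi (- (of_int n * x)) \<partial>circle) - (\<integral>x. ?S A x * e2pi (- (of_int n * x)) \<partial>circle)"
      using fourier_coefficient_sum[OF A(1), of "\<lambda>n. K (of_int n - y)" n] A(2) by simp
    also have "\<dots> = (\<integral>x. (?f x - ?S A x) * e2pi (- (of_int n * x)) \<partial>circle)"
      unfolding left_diff_distrib by (rule Bochner_Integration.integral_diff[symmetric, OF m[OF intf] m[OF intS]])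
    also have "cmod \<dots> \<le> (\<integral>x. cmod (?f x - ?S A x) \<partial>circle)"
      using integral_norm_bound[of circle "\<lambda>x. (?f x - ?S A x) * e2pi (- (of_int n * x))"] by (simp add: norm_mult)
    also have "\<dots> \<le> 2 * \<epsilon>"
      using nn nn_integral_eq_integral[OF integrable_norm[OF intd]] \<epsilon> by simp
    finally show ?thesis using intf by blast
  qed
  show "integrable circle ?f" using close[of 1] by simp
  have "cmod ((\<integral>x. ?f x * e2pi (- (of_int n * x)) \<partial>circle) - K (of_int n - y)) \<le> 0"
  proof (rule field_le_epsilon)
    fix e :: real assume "e > 0"
    then show "cmod ((\<integral>x. ?f x * e2pi (- (of_int n * x)) \<partial>circle) - K (of_int n - y)) \<le> 0 + e"
      using close[of "e / 2"] by simp
  qed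
  then show "(\<integral>x. ?f x * e2pi (- (of_int n * x)) \<partial>circle) = K (of_int n - y)" by simp
qed

section \<open>Invariance under the modular group\<close>

lemma int_periodic_mult:
  fixes C :: "int \<Rightarrow> 'a"
  assumes "\<And>m. C (m + k) = C m"
  shows "C (m + k * q) = C m"
proof -
  have nat: "C (m + k * int j) = C m" for m j
  proof (induction j)
    case (Suc j)
    have "C (m + k * int (Suc j)) = C ((m + k * int j) + k)" by (simp add: algebra_simps)
    with Suc assms show ?case by simp
  qed simp
  show ?thesis
  proof (cases "q \<ge> 0")
    case True
    with nat[of m "nat q"] show ?thesis by simp
  next
    case False
    with nat[of "m + k * q" "nat (- q)"] show ?thesis by simp
  qed
qed

lemma sum_residues_shift:
  fixes C :: "int \<Rightarrow> 'a :: comm_monoid_add"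
  assumes k: "k > 0" and per: "\<And>m. C (m + k) = C m"
  shows "(\<Sum>r\<in>{0..<k}. C (r + t)) = (\<Sum>r\<in>{0..<k}. C r)"
proof -
  have md: "C (m mod k) = C m" for m
    using int_periodic_mult[of C k "m mod k" "m div k", OF per] by (simp add: add.commute)
  show ?thesis
    by (rule sum.reindex_bij_witness[of _ "\<lambda>r. (r - t) mod k" "\<lambda>r. (r + t) mod k"])
       (use k in \<open>auto simp: md mod_simps\<close>)
qed

text \<open>The unit intervals [q, q + 1) tile the line, and those with |q| \<le> Q already contain
  the support.\<close>

lemma sum_integral_circle_unfold:
  fixes W :: "real \<Rightarrow> complex"
  assumes W: "integrable lborel W" and supp: "\<And>x. \<bar>x\<bar> > of_int Q \<Longrightarrow> W x = 0"
  shows "(\<Sum>q\<in>{- Q..Q}. \<integral>x. W (of_int q + x) \<partial>circle) = (\<integral>x. W x \<partial>lborel)"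
proof -
  have "(\<integral>x. W (of_int q + x) \<partial>circle) = (\<integral>x. indicator {of_int q..<of_int q + 1} x *\<^sub>R W x \<partial>lborel)" for q :: int
  proof -
    have "(\<integral>x. indicator {of_int q..<of_int q + 1} x *\<^sub>R W x \<partial>lborel) = 
       (\<integral>x. indicator {of_int q..<of_int q + 1} (of_int q + 1 * x) *\<^sub>R W (of_int q + 1 * x) \<partial>lborel)"
      by (subst lborel_integral_real_affine[of 1 _ "of_int q"]) simp_all
    also have "\<dots> = (\<integral>x. W (of_int q + x) \<partial>circle)"
      unfolding integral_circle by (intro Bochner_Integration.integral_cong) (auto simp: indicator_def)
    finally show ?thesis by simp
  qed
  then have "(\<Sum>q\<in>{- Q..Q}. \<integral>x. W (of_int q + x) \<partial>circle) = (\<Sum>q\<in>{- Q..Q}. \<integral>x. indicator {of_int q..<of_int q + 1} x *\<^sub>R W x \<partial>lborel)"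
    by simp
  also have "\<dots> = (\<integral>x. (\<Sum>q\<in>{- Q..Q}. indicator {of_int q..<of_int q + 1} x *\<^sub>R W x) \<partial>lborel)"
    by (rule Bochner_Integration.integral_sum[symmetric]) (intro integrable_mult_indicator W, simp)
  also have "\<dots> = (\<integral>x. W x \<partial>lborel)"
  proof (intro Bochner_Integration.integral_cong refl)
    fix x :: real
    have ind: "indicator {of_int q..<of_int q + 1} x = (if q = \<lfloor>x\<rfloor> then 1 else 0 :: real)" for q :: int
      by (auto simp: indicator_def floor_eq_iff) linarith+
    have "(\<Sum>q\<in>{- Q..Q}. indicator {of_int q..<of_int q + 1} x *\<^sub>R W x) = (\<Sum>q\<in>{- Q..Q}. if q = \<lfloor>x\<rfloor> then W x else 0)"
      unfolding ind by (intro sum.cong) auto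
    also have "\<dots> = (if \<lfloor>x\<rfloor> \<in> {- Q..Q} then W x else 0)" by simp
    also have "\<dots> = W x"
    proof (cases "\<lfloor>x\<rfloor> \<in> {- Q..Q}")
      case False
      then have "\<bar>x\<bar> > of_int Q" by (auto simp: not_le floor_less_iff less_floor_iff abs_less_iff)
      then show ?thesis using supp by simp
    qed simp
    finally show "(\<Sum>q\<in>{- Q..Q}. indicator {of_int q..<of_int q + 1} x *\<^sub>R W x) = W x" .
  qed
  finally show ?thesis .
qed

text \<open>With m = c q + r, the sum over q glues the circle integrals of V(c (q + x) + r -
  \<theta>) into an integral over the line, whose value after substitution does not depend on r. The
  arithmetic factor then comes out as its sum over one period. The condition on Q leaves room for
  the shift by r - \<theta>.\<close>

lemma unfold_circle_sum:
  fixes V :: "real \<Rightarrow> complex" and c :: int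
  assumes V: "integrable lborel V" and supp: "\<And>s. \<bar>s\<bar> > L \<Longrightarrow> V s = 0" and L: "L \<ge> 0"
    and c: "c \<noteq> 0" and per: "\<And>m. C (m + c) = C m" and Q: "of_int Q \<ge> L + \<bar>of_int c\<bar> + \<bar>\<theta>\<bar>"
  shows "(\<Sum>q\<in>{- Q..Q}. \<Sum>r\<in>{0..<\<bar>c\<bar>}. C (c * q + r) * (\<integral>x. V (of_int (c * q + r) + of_int c * x - \<theta>) \<partial>circle))
    = (\<Sum>r\<in>{0..<\<bar>c\<bar>}. C r) * (of_real (1 / \<bar>of_int c\<bar>) * (\<integral>s. V s \<partial>lborel))"
proof -
  have Cr: "C (c * q + r) = C r" for q r
    using int_periodic_mult[of C c r q, OF per] by (simp add: add.commute)
  have main: "(\<Sum>q\<in>{- Q..Q}. \<integral>x. V (of_int (c * q + r) + of_int c * x - \<theta>) \<partial>circle) = of_real (1 / \<bar>of_int c\<bar>) * (\<integral>s. V s \<partial>lborel)"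
    if r: "r \<in> {0..<\<bar>c\<bar>}" for r
  proof -
    let ?W = "\<lambda>x. V ((of_int r - \<theta>) + of_int c * x)"
    have "(\<Sum>q\<in>{- Q..Q}. \<integral>x. ?W (of_int q + x) \<partial>circle) = (\<integral>x. ?W x \<partial>lborel)"
    proof (rule sum_integral_circle_unfold)
      show "integrable lborel ?W" using c by (intro lborel_integrable_real_affine V) simp
      fix x :: real assume x: "\<bar>x\<bar> > of_int Q"
      have "1 \<le> \<bar>c\<bar>" using c by linarith
      then have "1 \<le> \<bar>real_of_int c\<bar>" by linarith
      then have "1 * \<bar>x\<bar> \<le> \<bar>real_of_int c\<bar> * \<bar>x\<bar>" by (intro mult_right_mono) auto
      then have "\<bar>of_int c * x\<bar> > L + \<bar>of_int c\<bar> + \<bar>\<theta>\<bar>" using x Q by (simp add: abs_mult)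
      moreover have "\<bar>real_of_int r\<bar> \<le> \<bar>of_int c\<bar>" using r by auto
      ultimately have "\<bar>(of_int r - \<theta>) + of_int c * x\<bar> > L" by linarith
      then show "?W x = 0" by (rule supp)
    qed
    moreover have "(\<integral>s. V s \<partial>lborel) = \<bar>of_int c\<bar> *\<^sub>R (\<integral>x. ?W x \<partial>lborel)"
      using c by (intro lborel_integral_real_affine) simp
    moreover have "V (of_int (c * q + r) + of_int c * x - \<theta>) = ?W (of_int q + x)" for q x
      by (simp add: algebra_simps)
    ultimately show ?thesis using c by (simp add: scaleR_conv_of_real)
  qed
  have "(\<Sum>q\<in>{- Q..Q}. \<Sum>r\<in>{0..<\<bar>c\<bar>}. C (c * q + r) * (\<integral>x. V (of_int (c * q + r) + of_int c * x - \<theta>) \<partial>circle))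
    = (\<Sum>r\<in>{0..<\<bar>c\<bar>}. C r * (\<Sum>q\<in>{- Q..Q}. \<integral>x. V (of_int (c * q + r) + of_int c * x - \<theta>) \<partial>circle))"
    unfolding Cr by (subst sum.swap) (simp add: sum_distrib_left)
  also have "\<dots> = (\<Sum>r\<in>{0..<\<bar>c\<bar>}. C r * (of_real (1 / \<bar>of_int c\<bar>) * (\<integral>s. V s \<partial>lborel)))"
    by (intro sum.cong refl) (simp only: main)
  finally show ?thesis by (simp only: sum_distrib_right)
qed

text \<open>A window of integers adapted to the modulus c: it consists of full residue systems, so a
  sum over it becomes a double sum over a rectangle. Remainders range below |c| because c may be
  negative.\<close>

definition residue_block :: "int \<Rightarrow> int \<Rightarrow> int set" where
  "residue_block c Q = (\<lambda>(q, r). c * q + r) ` ({- Q..Q} \<times> {0..<\<bar>c\<bar>})"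

lemma sum_residue_block:
  assumes "c \<noteq> 0"
  shows "sum f (residue_block c Q) = (\<Sum>q\<in>{- Q..Q}. \<Sum>r\<in>{0..<\<bar>c\<bar>}. f (c * q + r))"
proof -
  have "inj_on (\<lambda>(q, r). c * q + r) ({- Q..Q} \<times> {0..<\<bar>c\<bar>})"
  proof (rule inj_onI, clarify)
    fix q r q' r' assume r: "r \<in> {0..<\<bar>c\<bar>}" "r' \<in> {0..<\<bar>c\<bar>}" and e: "c * q + r = c * q' + r'"
    have "r - r' = c * (q' - q)" using e by (simp add: algebra_simps)
    then have "c dvd r - r'" by simp
    moreover have "\<bar>r - r'\<bar> < \<bar>c\<bar>" using r by auto
    ultimately have "r = r'" using dvd_imp_le_int[of "r - r'" c] by force
    with e assms show "q = q' \<and> r = r'" by simp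
  qed
  then show ?thesis
    unfolding residue_block_def by (subst sum.reindex) (auto simp: sum.cartesian_product case_prod_beta')
qed

text \<open>Floor division by |c| \<ge> 1 does not increase the absolute value, and
  \<open>sgn c\<close> transfers the quotient to the modulus c.\<close>

lemma in_residue_block:
  assumes c: "c \<noteq> 0" and m: "\<bar>m\<bar> \<le> Q"
  shows "m \<in> residue_block c Q"
proof -
  define k where "k = \<bar>c\<bar>"
  have k: "k \<ge> 1" using c by (simp add: k_def)
  have r: "0 \<le> m mod k" "m mod k < k" using k by auto
  have e: "m = k * (m div k) + m mod k" by simp
  have "\<bar>m div k\<bar> \<le> \<bar>m\<bar>"
  proof (cases "m \<ge> 0")
    case True
    then have "0 \<le> m div k" using k by (simp add: pos_imp_zdiv_nonneg_iff)
    moreover from this have "1 * (m div k) \<le> k * (m div k)" using k by (intro mult_right_mono)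
    ultimately show ?thesis using e r by linarith
  next
    case False
    have "m div k \<ge> m"
    proof (rule ccontr)
      assume "\<not> m div k \<ge> m"
      then have "k * (m div k) \<le> k * (m - 1)" using k by (intro mult_left_mono) auto
      moreover have "k * m \<le> 1 * m" using k False by (intro mult_right_mono_neg) auto
      ultimately show False using e r by (simp add: algebra_simps)
    qed
    moreover have "m div k \<le> 0" using False k by (simp add: div_nonpos_pos_le0)
    ultimately show ?thesis by linarith
  qed
  then have q: "\<bar>sgn c * (m div k)\<bar> \<le> Q" using m by (simp add: abs_mult abs_sgn_eq c)
  have "c * (sgn c * (m div k)) + m mod k = m"
    using e by (simp add: k_def abs_sgn mult.assoc)
  then have "m = (\<lambda>(q, r). c * q + r) (sgn c * (m div k), m mod k)" by simp
  moreover have "(sgn c * (m div k), m mod k) \<in> {- Q..Q} \<times> {0..<\<bar>c\<bar>}"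
    using q r by (auto simp: k_def abs_le_iff)
  ultimately show ?thesis unfolding residue_block_def by blast
qed

lemma finite_residue_block: "finite (residue_block c Q)"
  by (simp add: residue_block_def)

definition gauss_phase :: "int \<Rightarrow> int \<Rightarrow> int \<Rightarrow> complex" where
  "gauss_phase c d m = e2pi (- (of_int d * of_int m * (of_int m - of_int c)) / (2 * of_int c))"

text \<open>Using \<open>m (m - c)\<close> instead of \<open>m\<^sup>2\<close> makes the quadratic phase \<open>c\<close>-periodic whatever the parity of \<open>c d\<close>.\<close>

lemma gauss_phase_periodic:
  assumes "c \<noteq> 0"
  shows "gauss_phase c d (m + c) = gauss_phase c d m"
  unfolding gauss_phase_def
proof (rule e2pi_cong_Ints)
  have "- (of_int d * of_int (m + c) * (of_int (m + c) - of_int c)) / (2 * of_int c) -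
     - (of_int d * of_int m * (of_int m - of_int c)) / (2 * of_int c) = - real_of_int (d * m)"
    using assms by (simp add: field_simps)
  then show "- (of_int d * of_int (m + c) * (of_int (m + c) - of_int c)) / (2 * of_int c) -
     - (of_int d * of_int m * (of_int m - of_int c)) / (2 * of_int c) \<in> (\<int> :: real set)" by simp
qed

text \<open>The square of the modulus is a double sum, and after the shift t -> t + r the quadratic
  phases combine into one that is linear in r. The sum over r vanishes unless c divides d t, which
  by coprimality leaves only t = 0, with weight |c|.\<close>

lemma norm_gauss_sum:
  assumes c: "c \<noteq> 0" and cop: "coprime c d"
  shows "cmod (\<Sum>r\<in>{0..<\<bar>c\<bar>}. gauss_phase c d r) = sqrt \<bar>of_int c\<bar>"
proof -
  let ?k = "\<bar>c\<bar>" and ?g = "gauss_phase c d"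
  have k: "?k > 0" using c by simp
  have perk: "?g (m + ?k) = ?g m" for m
    using gauss_phase_periodic[OF c, of d m] gauss_phase_periodic[OF c, of d "m - c"] by (cases "c > 0") auto
  \<comment> \<open>The character in r left over from the quotient of the phases at r + t and at r,
    once the phase at t is split off.\<close>
  define \<zeta> where "\<zeta> = (\<lambda>t r. e2pi (- (of_int d * of_int t * of_int r) / of_int c))"
  have prod: "?g (r + t) * cnj (?g r) = ?g t * \<zeta> t r" for r t
  proof -
    have "- (of_int d * of_int (r + t) * (of_int (r + t) - of_int c)) / (2 * of_int c) -
       - (of_int d * of_int r * (of_int r - of_int c)) / (2 * of_int c) =
       - (of_int d * of_int t * (of_int t - of_int c)) / (2 * of_int c) + - (of_int d * of_int t * of_int r) / real_of_int c"
      using c by (simp add: field_simps)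
    then show ?thesis
      unfolding gauss_phase_def \<zeta>_def by (metis e2pi_add e2pi_minus diff_conv_add_uminus)
  qed
  have geom: "(\<Sum>r\<in>{0..<?k}. \<zeta> t r) = (if t = 0 then of_int ?k else 0)" if t: "t \<in> {0..<?k}" for t
  proof (cases "t = 0")
    case True
    then show ?thesis using k by (simp add: \<zeta>_def)
  next
    case False
    \<comment> \<open>Multiplication by \<zeta>(t, 1) shifts the summation index, so a nonzero sum
      would force \<zeta>(t, 1) = 1.\<close>
    have step: "\<zeta> t (r + 1) = \<zeta> t 1 * \<zeta> t r" for r
    proof -
      have "- (of_int d * of_int t * of_int (r + 1)) / of_int c = 
          - (of_int d * of_int t * of_int 1) / of_int c + - (of_int d * of_int t * of_int r) / real_of_int c"
        using c by (simp add: field_simps)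
      then show ?thesis unfolding \<zeta>_def by (simp only: e2pi_add)
    qed
    have "\<zeta> t (r + c) = \<zeta> t r" for r
      unfolding \<zeta>_def
    proof (rule e2pi_cong_Ints)
      have "- (of_int d * of_int t * of_int (r + c)) / of_int c - - (of_int d * of_int t * of_int r) / of_int c = - real_of_int (d * t)"
        using c by (simp add: field_simps)
      then show "- (of_int d * of_int t * of_int (r + c)) / of_int c - - (of_int d * of_int t * of_int r) / of_int c \<in> (\<int> :: real set)" by simp
    qed
    note \<zeta>per = this
    have "\<zeta> t (r + ?k) = \<zeta> t r" for r
      using \<zeta>per[of r] \<zeta>per[of "r - c"] by (cases "c > 0") auto
    then have "(\<Sum>r\<in>{0..<?k}. \<zeta> t (r + 1)) = (\<Sum>r\<in>{0..<?k}. \<zeta> t r)"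
      by (intro sum_residues_shift k)
    then have "\<zeta> t 1 * (\<Sum>r\<in>{0..<?k}. \<zeta> t r) = (\<Sum>r\<in>{0..<?k}. \<zeta> t r)"
      by (simp add: step sum_distrib_left)
    moreover have "\<zeta> t 1 \<noteq> 1"
    proof
      assume "\<zeta> t 1 = 1"
      then have "e2pi (- (of_int d * of_int t) / of_int c) = e2pi 0" by (simp add: \<zeta>_def)
      then have "- (of_int d * of_int t) / real_of_int c \<in> \<int>" by (simp only: e2pi_eq_iff diff_zero)
      then obtain i where "- (of_int d * of_int t) / real_of_int c = of_int i" by (rule Ints_cases)
      then have "real_of_int (- (d * t)) = real_of_int (i * c)" using c by (simp add: field_simps)
      then have "- (d * t) = i * c" by (simp only: of_int_eq_iff)
      then have "c dvd d * t" by (metis dvd_minus_iff dvd_triv_right)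
      then have "c dvd t" using cop by (simp add: coprime_dvd_mult_right_iff)
      then show False using dvd_imp_le_int[OF False, of c] t by auto
    qed
    ultimately show ?thesis using False by (auto simp: mult_right_cancel)
  qed
  have "complex_of_real ((cmod (\<Sum>r\<in>{0..<?k}. ?g r))\<^sup>2) = (\<Sum>r\<in>{0..<?k}. ?g r) * cnj (\<Sum>r\<in>{0..<?k}. ?g r)"
    by (rule complex_norm_square)
  also have "\<dots> = (\<Sum>r\<in>{0..<?k}. (\<Sum>t\<in>{0..<?k}. ?g t) * cnj (?g r))"
    by (simp add: sum_distrib_left)
  also have "\<dots> = (\<Sum>r\<in>{0..<?k}. (\<Sum>t\<in>{0..<?k}. ?g (t + r)) * cnj (?g r))"
    by (simp only: sum_residues_shift[of ?k ?g, OF k perk])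
  also have "\<dots> = (\<Sum>r\<in>{0..<?k}. \<Sum>t\<in>{0..<?k}. ?g t * \<zeta> t r)"
    by (simp add: sum_distrib_right add.commute[of _ "_ :: int"] prod)
  also have "\<dots> = (\<Sum>t\<in>{0..<?k}. ?g t * (\<Sum>r\<in>{0..<?k}. \<zeta> t r))"
    by (subst sum.swap) (simp add: sum_distrib_left)
  also have "\<dots> = (\<Sum>t\<in>{0..<?k}. if t = 0 then ?g t * of_int ?k else 0)"
    by (intro sum.cong refl) (simp add: geom)
  also have "\<dots> = of_int ?k" using k by (simp add: gauss_phase_def)
  finally have "complex_of_real ((cmod (\<Sum>r\<in>{0..<?k}. ?g r))\<^sup>2) = complex_of_real \<bar>of_int c\<bar>" by (simp flip: of_int_abs)
  then have "(cmod (\<Sum>r\<in>{0..<?k}. ?g r))\<^sup>2 = \<bar>of_int c\<bar>" using of_real_eq_iff by blast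
  then show ?thesis by (metis norm_ge_zero real_sqrt_unique)
qed

section \<open>The action of integral matrices on Zak transforms\<close>

text \<open>Compact support of \<open>h\<close> makes every lattice sum of \<open>h\<close> finite,
  so these sums may be exchanged with integrals. The transform \<open>K\<close> need not have
  compact support and is accessible through the Fourier coefficients of its Zak transform.\<close>

locale weil_transform =
  fixes h :: "real \<Rightarrow> complex" and L :: real and a b c d :: int
  assumes h: "integrable lborel h" and supp: "\<And>s. \<bar>s\<bar> > L \<Longrightarrow> h s = 0" and L: "L \<ge> 0"
    and det: "a * d - b * c = 1" and c: "c \<noteq> 0"
begin

definition K :: "real \<Rightarrow> complex" where
  "K w = of_real (1 / sqrt \<bar>of_int c\<bar>) * (\<integral>s. e2pi (((of_int a * w\<^sup>2 + of_int d * s\<^sup>2) / 2 - w * s) / of_int c) * h s \<partial>lborel)"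

text \<open>The transform of \<open>h\<close> under an integral matrix has the Zak transform \<open>F\<close>, up to a constant phase and
  a translation in \<open>x\<close>: the quadratic phase makes \<open>F\<close> 1-periodic in \<open>x\<close>.\<close>

definition F :: "real \<times> real \<Rightarrow> complex" where
  "F = (\<lambda>(x, y). e2pi (of_int (c * d) * x\<^sup>2 / 2 - of_int (b * c) * x * y + of_int (a * b) * y\<^sup>2 / 2)
     * zak_sum h (of_int d * x - of_int b * y + of_int d / 2, - of_int c * x + of_int a * y))"

text \<open>Together with \<open>C\<close>, one of the two factors of an unfolded summand.
  \<open>V\<close> is the integrand of \<open>K\<close> at n - y without its normalisation and sees
  m only through s = m + c x - a y, whereas \<open>C\<close> is arithmetic and sees m only modulo
  c.\<close>

definition V :: "int \<Rightarrow> real \<Rightarrow> real \<Rightarrow> complex" where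
  "V n y s = e2pi (((of_int a * (of_int n - y)\<^sup>2 + of_int d * s\<^sup>2) / 2 - (of_int n - y) * s) / of_int c) * h s"

definition C :: "int \<Rightarrow> int \<Rightarrow> complex" where
  "C n m = gauss_phase c d m * e2pi (of_int n * of_int m / of_int c - of_int a * (of_int n)\<^sup>2 / (2 * of_int c))"

lemma h_measurable [measurable]: "h \<in> borel_measurable borel"
  using h by auto

lemma real_det: "real_of_int a * of_int d = 1 + of_int b * of_int c"
  using det by (metis add_diff_cancel_left' add.commute diff_add_cancel of_int_1 of_int_add of_int_mult)

lemma integrable_V: "integrable lborel (V n y)"
  by (rule Bochner_Integration.integrable_bound[OF h]) (auto simp: V_def[abs_def] norm_mult)

lemma integral_V: "(\<integral>s. V n y s \<partial>lborel) = of_real (sqrt \<bar>of_int c\<bar>) * K (of_int n - y)"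
  using c by (simp add: K_def V_def)

text \<open>An identity of quadratic phases: after multiplication by 2 c it is polynomial and
  follows from a d = 1 + b c. The shift d / 2 in \<open>F\<close> is what produces m (m - c) in
  place of m^2 in the Gauss phase.\<close>

lemma F_term:
  "e2pi (of_int (c * d) * x\<^sup>2 / 2 - of_int (b * c) * x * y + of_int (a * b) * y\<^sup>2 / 2)
     * (h (of_int m - (- of_int c * x + of_int a * y)) * e2pi (of_int m * (of_int d * x - of_int b * y + of_int d / 2)))
     * e2pi (- (of_int n * x)) = C n m * V n y (of_int m + of_int c * x - of_int a * y)"
proof -
  have rc: "real_of_int c \<noteq> 0" using c by simp
  let ?s = "of_int m + of_int c * x - of_int a * y"
  have key: "C * D * x\<^sup>2 / 2 - B * C * x * y + A * B * y\<^sup>2 / 2 + M * (D * x - B * y + D / 2) - N * x =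
      - (D * M * (M - C)) / (2 * C) + (N * M / C - A * N\<^sup>2 / (2 * C)) +
      ((A * (N - y)\<^sup>2 + D * (M + C * x - A * y)\<^sup>2) / 2 - (N - y) * (M + C * x - A * y)) / C"
    if "C \<noteq> 0" "A * D = 1 + B * C" for A B C D M N :: real
  proof -
    have "2 * C * (C * D * x\<^sup>2 / 2 - B * C * x * y + A * B * y\<^sup>2 / 2 + M * (D * x - B * y + D / 2) - N * x) =
       C\<^sup>2 * D * x\<^sup>2 - 2 * B * C\<^sup>2 * x * y + A * B * C * y\<^sup>2 + 2 * C * M * D * x - 2 * C * M * B * y + M * D * C - 2 * C * N * x"
      by (simp add: algebra_simps power2_eq_square)
    moreover have "2 * C * (- (D * M * (M - C)) / (2 * C) + (N * M / C - A * N\<^sup>2 / (2 * C)) +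
      ((A * (N - y)\<^sup>2 + D * (M + C * x - A * y)\<^sup>2) / 2 - (N - y) * (M + C * x - A * y)) / C) =
      - (D * M * (M - C)) + (2 * N * M - A * N\<^sup>2) +
      (A * (N - y)\<^sup>2 + D * (M + C * x - A * y)\<^sup>2 - 2 * (N - y) * (M + C * x - A * y))"
      using that(1) by (simp add: field_simps)
    moreover have "C\<^sup>2 * D * x\<^sup>2 - 2 * B * C\<^sup>2 * x * y + A * B * C * y\<^sup>2 + 2 * C * M * D * x - 2 * C * M * B * y + M * D * C - 2 * C * N * x
      = - (D * M * (M - C)) + (2 * N * M - A * N\<^sup>2) +
      (A * (N - y)\<^sup>2 + D * (M + C * x - A * y)\<^sup>2 - 2 * (N - y) * (M + C * x - A * y))"
      using that(2) by algebra
    ultimately have "2 * C * (C * D * x\<^sup>2 / 2 - B * C * x * y + A * B * y\<^sup>2 / 2 + M * (D * x - B * y + D / 2) - N * x) =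
      2 * C * (- (D * M * (M - C)) / (2 * C) + (N * M / C - A * N\<^sup>2 / (2 * C)) +
      ((A * (N - y)\<^sup>2 + D * (M + C * x - A * y)\<^sup>2) / 2 - (N - y) * (M + C * x - A * y)) / C)" by argo
    then show ?thesis using that(1) by (subst (asm) mult_left_cancel) auto
  qed
  have s: "of_int m - (- of_int c * x + of_int a * y) = ?s" by simp
  have "e2pi p * (z * e2pi q) * e2pi (- r) = e2pi (p + q - r) * z" for p q r z
  proof -
    have "e2pi (p + q - r) = e2pi p * e2pi q * e2pi (- r)" by (simp flip: e2pi_add)
    then show ?thesis by simp
  qed
  then have "e2pi (of_int (c * d) * x\<^sup>2 / 2 - of_int (b * c) * x * y + of_int (a * b) * y\<^sup>2 / 2)
     * (h (of_int m - (- of_int c * x + of_int a * y)) * e2pi (of_int m * (of_int d * x - of_int b * y + of_int d / 2)))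
     * e2pi (- (of_int n * x)) = e2pi (of_int c * of_int d * x\<^sup>2 / 2 - of_int b * of_int c * x * y + of_int a * of_int b * y\<^sup>2 / 2 + 
        of_int m * (of_int d * x - of_int b * y + of_int d / 2) - of_int n * x) * h ?s"
    by (simp only: s of_int_mult)
  also have "\<dots> = C n m * V n y ?s"
    unfolding key[OF rc real_det] e2pi_add C_def V_def gauss_phase_def by (simp only: mult.assoc)
  finally show ?thesis .
qed

lemma C_periodic: "C n (m + c) = C n m"
proof -
  have "e2pi (of_int n * of_int (m + c) / of_int c - of_int a * (of_int n)\<^sup>2 / (2 * of_int c)) = 
      e2pi (of_int n * of_int m / of_int c - of_int a * (of_int n)\<^sup>2 / (2 * of_int c))"
  proof (rule e2pi_cong_Ints)
    have "of_int n * of_int (m + c) / of_int c - of_int a * (of_int n)\<^sup>2 / (2 * of_int c) -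
      (of_int n * of_int m / of_int c - of_int a * (of_int n)\<^sup>2 / (2 * of_int c)) = real_of_int n"
      using c by (simp add: field_simps)
    then show "of_int n * of_int (m + c) / of_int c - of_int a * (of_int n)\<^sup>2 / (2 * of_int c) -
      (of_int n * of_int m / of_int c - of_int a * (of_int n)\<^sup>2 / (2 * of_int c)) \<in> (\<int> :: real set)" by simp
  qed
  then show ?thesis unfolding C_def by (simp only: gauss_phase_periodic[OF c])
qed

text \<open>Completing the square modulo c: a is the inverse of d modulo c, so translating m by a n
  removes the linear term n m / c. What remains of the phase is an integer, apart from n a (b + d) /
  2, which gives the sign in front.\<close>

lemma sum_C: "(\<Sum>r\<in>{0..<\<bar>c\<bar>}. C n r) = e2pi (of_int (n * a * (b + d)) / 2) * (\<Sum>r\<in>{0..<\<bar>c\<bar>}. gauss_phase c d r)"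
proof -
  have rc: "real_of_int c \<noteq> 0" using c by simp
  have k: "\<bar>c\<bar> > 0" using c by simp
  have per: "C n (m + \<bar>c\<bar>) = C n m" for m
    using C_periodic[of n m] C_periodic[of n "m - c"] by (cases "c > 0") auto
  have "C n (r + a * n) = e2pi (of_int (n * a * (b + d)) / 2) * gauss_phase c d r" for r
  proof -
    have key: "- (D * (M + A * N) * (M + A * N - C)) / (2 * C) + (N * (M + A * N) / C - A * N\<^sup>2 / (2 * C)) =
       N * A * (B + D) / 2 + - (D * M * (M - C)) / (2 * C) - (B * M * N + A * B * (N * (N + 1) / 2))"
      if "C \<noteq> 0" "A * D = 1 + B * C" for A B C D M N :: real
    proof -
      have e1: "2 * C * (- (D * (M + A * N) * (M + A * N - C)) / (2 * C) + (N * (M + A * N) / C - A * N\<^sup>2 / (2 * C))) =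
         - (D * (M + A * N) * (M + A * N - C)) + (2 * N * (M + A * N) - A * N\<^sup>2)"
        using that(1) by (simp add: field_simps)
      have e2: "2 * C * (N * A * (B + D) / 2 + - (D * M * (M - C)) / (2 * C) - (B * M * N + A * B * (N * (N + 1) / 2))) =
         C * N * A * (B + D) - (D * M * (M - C)) - (2 * C * B * M * N + C * A * B * N * (N + 1))"
        using that(1) by (simp add: field_simps)
      have e3: "- (D * (M + A * N) * (M + A * N - C)) + (2 * N * (M + A * N) - A * N\<^sup>2) = 
         C * N * A * (B + D) - (D * M * (M - C)) - (2 * C * B * M * N + C * A * B * N * (N + 1))"
      proof -
        have "- (D * (M + A * N) * (M + A * N - C)) + (2 * N * (M + A * N) - A * N\<^sup>2) -
         (C * N * A * (B + D) - (D * M * (M - C)) - (2 * C * B * M * N + C * A * B * N * (N + 1))) =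
          (1 + B * C - A * D) * (2 * M * N + A * N\<^sup>2)"
          by (simp add: algebra_simps power2_eq_square)
        then show ?thesis using that(2) by simp
      qed
      have "2 * C * (- (D * (M + A * N) * (M + A * N - C)) / (2 * C) + (N * (M + A * N) / C - A * N\<^sup>2 / (2 * C))) =
        2 * C * (N * A * (B + D) / 2 + - (D * M * (M - C)) / (2 * C) - (B * M * N + A * B * (N * (N + 1) / 2)))" by (rule trans[OF e1 trans[OF e3 e2[symmetric]]])
      then show ?thesis using that(1) by (subst (asm) mult_left_cancel) auto
    qed
    \<comment> \<open>n (n + 1) / 2 is an integer, so the term a b n (n + 1) / 2 of the phase
      contributes nothing.\<close>
    obtain j where j: "n * (n + 1) = 2 * j" using even_mult_iff by (metis even_add evenE odd_one)
    have j': "of_int n * (of_int n + 1) / 2 = real_of_int j"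
    proof -
      have "real_of_int (n * (n + 1)) = real_of_int (2 * j)" by (simp only: j)
      then show ?thesis by simp
    qed
    have "C n (r + a * n) = e2pi (- (of_int d * (of_int r + of_int a * of_int n) * (of_int r + of_int a * of_int n - of_int c)) / (2 * of_int c) +
        (of_int n * (of_int r + of_int a * of_int n) / of_int c - of_int a * (of_int n)\<^sup>2 / (2 * of_int c)))"
      by (simp only: C_def gauss_phase_def e2pi_add of_int_add of_int_mult)
    also have "\<dots> = e2pi (of_int n * of_int a * (of_int b + of_int d) / 2 + - (of_int d * of_int r * (of_int r - of_int c)) / (2 * of_int c))"
      unfolding key[OF rc real_det] j'
    proof (rule e2pi_cong_Ints)
      let ?X = "of_int n * of_int a * (of_int b + of_int d) / 2 + - (of_int d * of_int r * (of_int r - of_int c)) / (2 * of_int c) :: real"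
      have "?X - (of_int b * of_int r * of_int n + of_int a * of_int b * of_int j) - ?X = - real_of_int (b * r * n + a * b * j)" by simp
      then show "?X - (of_int b * of_int r * of_int n + of_int a * of_int b * of_int j) - ?X \<in> \<int>" by (metis Ints_minus Ints_of_int)
    qed
    also have "\<dots> = e2pi (of_int (n * a * (b + d)) / 2) * gauss_phase c d r"
      by (simp only: gauss_phase_def e2pi_add of_int_add of_int_mult)
    finally show ?thesis .
  qed
  then have "(\<Sum>r\<in>{0..<\<bar>c\<bar>}. C n (r + a * n)) = e2pi (of_int (n * a * (b + d)) / 2) * (\<Sum>r\<in>{0..<\<bar>c\<bar>}. gauss_phase c d r)"
    by (simp only: sum_distrib_left)
  then show ?thesis
    by (simp only: sum_residues_shift[of "\<bar>c\<bar>" "C n", OF k per])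
qed

text \<open>On a fibre \<open>F\<close> is a finite sum; its n-th coefficient collects the terms
  \<open>C n m * V n y s\<close> and unfolds to the integral of \<open>V\<close> over the line times
  the sum of \<open>C\<close> over one period, that is, to \<open>K\<close> times a Gauss
  sum.\<close>

lemma F_integrable: "integrable circle (\<lambda>x. F (x, y) * e2pi (- (of_int n * x)))"
  and F_coefficient: "(\<integral>x. F (x, y) * e2pi (- (of_int n * x)) \<partial>circle) = 
     e2pi (of_int (n * a * (b + d)) / 2) * ((\<Sum>r\<in>{0..<\<bar>c\<bar>}. gauss_phase c d r) / of_real (sqrt \<bar>of_int c\<bar>)) * K (of_int n - y)"
proof -
  \<comment> \<open>Large enough for all x in [0, 1): outside the window, |m + c x - a y| exceeds
    L.\<close>
  define Q where "Q = \<lceil>L + \<bar>of_int c\<bar> + \<bar>of_int a * y\<bar>\<rceil>"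
  have Q: "of_int Q \<ge> L + \<bar>of_int c\<bar> + \<bar>of_int a * y\<bar>" unfolding Q_def by (rule le_of_int_ceiling)
  have Fx: "F (x, y) * e2pi (- (of_int n * x)) = (\<Sum>q\<in>{- Q..Q}. \<Sum>r\<in>{0..<\<bar>c\<bar>}. C n (c * q + r) * V n y (of_int (c * q + r) + of_int c * x - of_int a * y))"
    if x: "x \<in> space circle" for x
  proof -
    have "zak_sum h (of_int d * x - of_int b * y + of_int d / 2, - of_int c * x + of_int a * y) = 
       (\<Sum>m\<in>residue_block c Q. h (of_int m - (- of_int c * x + of_int a * y)) * e2pi (of_int m * (of_int d * x - of_int b * y + of_int d / 2)))"
    proof (rule zak_sum_finite[OF finite_residue_block])
      fix m assume "m \<notin> residue_block c Q"
      then have "\<bar>m\<bar> > Q" using in_residue_block[OF c] by (metis not_le)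
      then have "real_of_int \<bar>m\<bar> \<ge> of_int Q + 1" by linarith
      moreover have "\<bar>of_int c * x\<bar> \<le> \<bar>of_int c\<bar> * 1" unfolding abs_mult using x by (intro mult_left_mono) auto
      ultimately have "\<bar>of_int m - (- of_int c * x + of_int a * y)\<bar> > L" using Q by linarith
      then show "h (of_int m - (- of_int c * x + of_int a * y)) = 0" by (rule supp)
    qed
    then have "F (x, y) * e2pi (- (of_int n * x)) = (\<Sum>m\<in>residue_block c Q. C n m * V n y (of_int m + of_int c * x - of_int a * y))"
      unfolding F_def prod.case by (simp only: sum_distrib_left sum_distrib_right F_term)
    then show ?thesis by (simp only: sum_residue_block[OF c])
  qed
  have Vi: "integrable circle (\<lambda>x. V n y (of_int m + of_int c * x - of_int a * y))" for m
  proof -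
    have "integrable lborel (\<lambda>x. V n y ((of_int m - of_int a * y) + of_int c * x))"
      using c by (intro lborel_integrable_real_affine integrable_V) simp
    then have "integrable lborel (\<lambda>x. V n y (of_int m + of_int c * x - of_int a * y))"
      by (simp add: algebra_simps)
    then show ?thesis
      unfolding circle_def by (subst integrable_restrict_space) (auto simp: set_integrable_def intro: integrable_mult_indicator)
  qed
  have "integrable circle (\<lambda>x. \<Sum>q\<in>{- Q..Q}. \<Sum>r\<in>{0..<\<bar>c\<bar>}. C n (c * q + r) * V n y (of_int (c * q + r) + of_int c * x - of_int a * y))"
    by (intro Bochner_Integration.integrable_sum integrable_mult_right Vi)
  then show "integrable circle (\<lambda>x. F (x, y) * e2pi (- (of_int n * x)))"
    by (subst Bochner_Integration.integrable_cong[OF refl Fx])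
  have "(\<integral>x. F (x, y) * e2pi (- (of_int n * x)) \<partial>circle) = 
     (\<integral>x. (\<Sum>q\<in>{- Q..Q}. \<Sum>r\<in>{0..<\<bar>c\<bar>}. C n (c * q + r) * V n y (of_int (c * q + r) + of_int c * x - of_int a * y)) \<partial>circle)"
    by (rule Bochner_Integration.integral_cong[OF refl Fx])
  also have "\<dots> = (\<Sum>q\<in>{- Q..Q}. \<Sum>r\<in>{0..<\<bar>c\<bar>}. C n (c * q + r) * (\<integral>x. V n y (of_int (c * q + r) + of_int c * x - of_int a * y) \<partial>circle))"
    by (simp only: Bochner_Integration.integral_sum Bochner_Integration.integrable_sum integrable_mult_right[OF Vi] integral_mult_right_zero)
  also have "\<dots> = (\<Sum>r\<in>{0..<\<bar>c\<bar>}. C n r) * (of_real (1 / \<bar>of_int c\<bar>) * (\<integral>s. V n y s \<partial>lborel))"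
    by (rule unfold_circle_sum[where V = "V n y" and L = L and C = "C n", OF integrable_V _ L c C_periodic Q])
       (simp add: V_def supp)
  also have "of_real (1 / \<bar>of_int c\<bar>) * (\<integral>s. V n y s \<partial>lborel) = 1 / of_real (sqrt \<bar>of_int c\<bar>) * K (of_int n - y)"
  proof -
    have "complex_of_real (1 / \<bar>of_int c\<bar>) * of_real (sqrt \<bar>of_int c\<bar>) = of_real (1 / sqrt \<bar>of_int c\<bar>)"
      unfolding of_real_mult[symmetric] of_real_eq_iff using c by (simp add: field_simps)
    then show ?thesis unfolding integral_V by (simp add: mult.assoc[symmetric])
  qed
  finally show "(\<integral>x. F (x, y) * e2pi (- (of_int n * x)) \<partial>circle) = 
     e2pi (of_int (n * a * (b + d)) / 2) * ((\<Sum>r\<in>{0..<\<bar>c\<bar>}. gauss_phase c d r) / of_real (sqrt \<bar>of_int c\<bar>)) * K (of_int n - y)"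
    unfolding sum_C by simp
qed

lemma zak_sum_shift: "zak_sum h (x, y + 1) = e2pi x * zak_sum h (x, y)"
proof -
  define R where "R = \<lceil>L + \<bar>y\<bar>\<rceil>"
  have zero: "h (of_int n - y) = 0" if "n \<notin> {- R..R}" for n
  proof (rule supp)
    have "real_of_int R + 1 \<le> \<bar>real_of_int n\<bar>" using that by auto
    moreover have "L + \<bar>y\<bar> \<le> of_int R" unfolding R_def by (rule le_of_int_ceiling)
    ultimately show "L < \<bar>of_int n - y\<bar>" by linarith
  qed
  have "zak_sum h (x, y + 1) = (\<Sum>n\<in>(\<lambda>n. n + 1) ` {- R..R}. h (of_int n - (y + 1)) * e2pi (of_int n * x))"
  proof (rule zak_sum_finite)
    fix n assume n: "n \<notin> (\<lambda>n. n + 1) ` {- R..R}"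
    have "n - 1 \<notin> {- R..R}"
    proof
      assume "n - 1 \<in> {- R..R}"
      then have "(n - 1) + 1 \<in> (\<lambda>n. n + 1) ` {- R..R}" by (rule imageI)
      with n show False by simp
    qed
    from zero[OF this] show "h (of_int n - (y + 1)) = 0" by (simp add: algebra_simps)
  qed simp
  also have "\<dots> = (\<Sum>n\<in>{- R..R}. h (of_int n - y) * e2pi (of_int (n + 1) * x))"
    by (subst sum.reindex) (auto simp: algebra_simps)
  also have "\<dots> = e2pi x * (\<Sum>n\<in>{- R..R}. h (of_int n - y) * e2pi (of_int n * x))"
    by (simp add: sum_distrib_left e2pi_add algebra_simps)
  also have "(\<Sum>n\<in>{- R..R}. h (of_int n - y) * e2pi (of_int n * x)) = zak_sum h (x, y)"
    by (rule zak_sum_finite[symmetric]) (use zero in auto)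
  finally show ?thesis .
qed

text \<open>Multiplication by e(- x y) turns the quasiperiodicity in y into periodicity, to which
  \<open>periodic_int\<close> applies.\<close>

lemma zak_sum_shift_int: "zak_sum h (x + of_int j, y + of_int k) = e2pi (of_int k * x) * zak_sum h (x, y)"
proof -
  have "zak_sum h (x + of_int j, y + of_int k) = zak_sum h (x, y + of_int k)"
    by (rule periodic_int[of "\<lambda>x. zak_sum h (x, _)"]) (rule zak_sum_periodic)
  moreover have "e2pi (- (x * (y + of_int k))) * zak_sum h (x, y + of_int k) = e2pi (- (x * y)) * zak_sum h (x, y)"
    by (rule periodic_int[of "\<lambda>y. e2pi (- (x * y)) * zak_sum h (x, y)"])
       (simp add: zak_sum_shift distrib_left mult.assoc[symmetric] flip: e2pi_add)
  then have "e2pi (x * (y + of_int k)) * (e2pi (- (x * (y + of_int k))) * zak_sum h (x, y + of_int k)) = 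
      e2pi (x * (y + of_int k)) * (e2pi (- (x * y)) * zak_sum h (x, y))" by simp
  then have "zak_sum h (x, y + of_int k) = e2pi (of_int k * x) * zak_sum h (x, y)"
    unfolding mult.assoc[symmetric] e2pi_add[symmetric] by (simp add: algebra_simps)
  ultimately show ?thesis by simp
qed

text \<open>The arguments of \<open>zak_sum\<close> move by (d, - c). The resulting factor cancels
  the increment of the quadratic phase exactly; the part c d / 2 of that increment is matched by the
  shift d / 2.\<close>

lemma F_periodic: "F (x + 1, y) = F (x, y)"
proof -
  let ?q = "\<lambda>x. of_int (c * d) * x\<^sup>2 / 2 - of_int (b * c) * x * y + of_int (a * b) * y\<^sup>2 / 2"
  let ?x = "of_int d * x - of_int b * y + of_int d / 2" and ?y = "- of_int c * x + of_int a * y"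
  have "F (x + 1, y) = e2pi (?q (x + 1)) * zak_sum h (?x + of_int d, ?y + of_int (- c))"
    unfolding F_def prod.case by (simp add: algebra_simps)
  also have "\<dots> = e2pi (?q (x + 1) + of_int (- c) * ?x) * zak_sum h (?x, ?y)"
    by (simp only: zak_sum_shift_int e2pi_add mult.assoc)
  also have "e2pi (?q (x + 1) + of_int (- c) * ?x) = e2pi (?q x)"
  proof (rule e2pi_cong_Ints)
    have "?q (x + 1) + of_int (- c) * ?x - ?q x = 0"
      by (simp add: field_simps power2_eq_square)
    then show "?q (x + 1) + of_int (- c) * ?x - ?q x \<in> \<int>" by simp
  qed
  finally show ?thesis by (simp add: F_def)
qed

lemma F_measurable: "F \<in> borel_measurable borel"
proof -
  have [measurable]: "zak_sum h \<in> borel_measurable (borel \<Otimes>\<^sub>M borel)"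
    using measurable_zak_sum[OF h_measurable] by (simp add: borel_prod)
  show ?thesis unfolding F_def borel_prod[symmetric] by measurable
qed

text \<open>Translating \<open>x\<close> by \<open>a (b + d) / 2\<close> cancels the signs that the Gauss sums contribute to the Fourier coefficients.\<close>

definition G :: "real \<times> real \<Rightarrow> complex" where
  "G = (\<lambda>(x, y). F (x + of_int (a * (b + d)) / 2, y))"

lemma G_measurable: "G \<in> borel_measurable borel"
proof -
  have [measurable]: "F \<in> borel_measurable (borel \<Otimes>\<^sub>M borel)"
    using F_measurable by (simp add: borel_prod)
  show ?thesis unfolding G_def borel_prod[symmetric] by measurable
qed

lemma G_integrable: "integrable circle (\<lambda>x. G (x, y))"
proof -
  have Fm [measurable]: "(\<lambda>x. F (x, y)) \<in> borel_measurable borel" by (rule measurable_section[OF F_measurable])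
  then have [measurable]: "(\<lambda>x. ennreal (cmod (F (x, y)))) \<in> borel_measurable borel" by measurable
  have "(\<integral>\<^sup>+x. ennreal (cmod (G (x, y))) \<partial>circle) = (\<integral>\<^sup>+x. ennreal (cmod (F (x, y))) \<partial>circle)"
    unfolding G_def prod.case by (rule nn_integral_circle_shift[where f = "\<lambda>x. ennreal (cmod (F (x, y)))"]) (simp_all add: F_periodic)
  also have "\<dots> < \<infinity>" using F_integrable[of y 0] by (simp add: integrable_iff_bounded)
  finally show ?thesis
    unfolding integrable_iff_bounded using measurable_circle[OF measurable_section[OF G_measurable]] by blast
qed

lemma G_coefficient:
  "(\<integral>x. G (x, y) * e2pi (- (of_int n * x)) \<partial>circle) = 
     (\<Sum>r\<in>{0..<\<bar>c\<bar>}. gauss_phase c d r) / of_real (sqrt \<bar>of_int c\<bar>) * K (of_int n - y)"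
proof -
  let ?\<sigma> = "a * (b + d)" and ?g = "\<lambda>x. F (x, y) * e2pi (- (of_int n * x))"
  have Fm [measurable]: "(\<lambda>x. F (x, y)) \<in> borel_measurable borel" by (rule measurable_section[OF F_measurable])
  have gm: "?g \<in> borel_measurable borel" by measurable
  have gper: "?g (x + 1) = ?g x" for x
  proof -
    have "e2pi (- (of_int n * (x + 1))) = e2pi (- (of_int n * x))"
      by (rule e2pi_cong_Ints) (simp add: algebra_simps)
    then show ?thesis by (simp only: F_periodic)
  qed
  have shift: "G (x, y) * e2pi (- (of_int n * x)) = e2pi (of_int n * of_int ?\<sigma> / 2) * ?g (of_int 1 * x + of_int ?\<sigma> / 2)" for x
  proof -
    have "e2pi (- (of_int n * x)) = e2pi (of_int n * of_int ?\<sigma> / 2) * e2pi (- (of_int n * (of_int 1 * x + of_int ?\<sigma> / 2)))"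
      unfolding e2pi_add[symmetric] by (rule arg_cong[where f = e2pi]) (simp add: algebra_simps)
    then show ?thesis unfolding G_def prod.case by (simp only: mult_ac of_int_1 mult_1_left)
  qed
  have "(\<integral>x. G (x, y) * e2pi (- (of_int n * x)) \<partial>circle) = e2pi (of_int n * of_int ?\<sigma> / 2) * (\<integral>x. ?g (of_int 1 * x + of_int ?\<sigma> / 2) \<partial>circle)"
    by (simp only: shift integral_mult_right_zero)
  also have "(\<integral>x. ?g (of_int 1 * x + of_int ?\<sigma> / 2) \<partial>circle) = (\<integral>x. ?g x \<partial>circle)"
    by (rule integral_circle_affine[OF gm gper]) simp
  \<comment> \<open>The sign from the translation and the sign from the Gauss sum are the same, so
    their product is 1.\<close>
  also have "e2pi (of_int n * of_int ?\<sigma> / 2) * \<dots> = (e2pi (of_int n * of_int ?\<sigma> / 2) * e2pi (of_int (n * a * (b + d)) / 2)) * 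
      ((\<Sum>r\<in>{0..<\<bar>c\<bar>}. gauss_phase c d r) / of_real (sqrt \<bar>of_int c\<bar>) * K (of_int n - y))"
    by (simp only: F_coefficient mult.assoc)
  also have "e2pi (of_int n * of_int ?\<sigma> / 2) * e2pi (of_int (n * a * (b + d)) / 2) = e2pi (of_int (n * ?\<sigma>))"
    unfolding e2pi_add[symmetric] by (rule arg_cong[where f = e2pi]) (simp add: algebra_simps)
  finally show ?thesis by (simp only: e2pi_int mult_1_left)
qed

text \<open>On every fibre \<open>G\<close> and \<open>\<kappa> * zak_sum K\<close> have the same
  Fourier coefficients in x. The normalised Gauss sum \<kappa> has modulus 1 and depends on neither
  n nor y.\<close>

lemma norm_zak_sum_K:
  assumes bd: "\<And>w. cmod (K w) \<le> B / (1 + \<bar>w\<bar>)" and Km: "K \<in> borel_measurable borel"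
  shows "AE \<xi> in torus. cmod (G \<xi>) = cmod (zak_sum K \<xi>)"
proof -
  define \<kappa> where "\<kappa> = (\<Sum>r\<in>{0..<\<bar>c\<bar>}. gauss_phase c d r) / of_real (sqrt \<bar>of_int c\<bar>)"
  have "coprime c d" using det by (metis coprimeI dvd_diff dvd_mult dvd_mult2)
  then have \<kappa>: "cmod \<kappa> = 1" using c by (simp add: \<kappa>_def norm_divide norm_gauss_sum)
  have [measurable]: "G \<in> borel_measurable torus" "zak_sum K \<in> borel_measurable torus"
    by (intro measurable_circle2 G_measurable measurable_zak_sum Km)+
  have "AE x in circle. cmod (G (x, y)) = cmod (zak_sum K (x, y))" for y
  proof -
    note z = fourier_coefficient_zak_sum[OF Km bd, of y]
    have m: "integrable circle (\<lambda>x. g x * e2pi (- (of_int n * x)))" if "integrable circle g" for g :: "real \<Rightarrow> complex" and n :: int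
      by (rule Bochner_Integration.integrable_bound[OF that]) (use that in \<open>auto simp: norm_mult intro!: borel_measurable_times measurable_circle\<close>)
    have "AE x in circle. G (x, y) - \<kappa> * zak_sum K (x, y) = 0"
    proof (rule fourier_uniqueness)
      show "integrable circle (\<lambda>x. G (x, y) - \<kappa> * zak_sum K (x, y))"
        by (intro Bochner_Integration.integrable_diff integrable_mult_right G_integrable z(1))
      fix n
      have "(\<integral>x. (G (x, y) - \<kappa> * zak_sum K (x, y)) * e2pi (- (of_int n * x)) \<partial>circle) = 
        (\<integral>x. G (x, y) * e2pi (- (of_int n * x)) \<partial>circle) - \<kappa> * (\<integral>x. zak_sum K (x, y) * e2pi (- (of_int n * x)) \<partial>circle)"
        unfolding left_diff_distrib mult.assoc
        by (subst Bochner_Integration.integral_diff) (simp_all only: m G_integrable z(1) integrable_mult_right integral_mult_right_zero)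
      then show "(\<integral>x. (G (x, y) - \<kappa> * zak_sum K (x, y)) * e2pi (- (of_int n * x)) \<partial>circle) = 0"
        by (simp only: z(2) G_coefficient \<kappa>_def[symmetric] diff_self)
    qed
    then show ?thesis by eventually_elim (simp add: norm_mult \<kappa>)
  qed
  moreover have P: "{\<xi> \<in> space torus. cmod (G (fst \<xi>, snd \<xi>)) = cmod (zak_sum K (fst \<xi>, snd \<xi>))} \<in> sets torus" by measurable
  ultimately show ?thesis
    using circle2.AE_commute[OF P] circle2.AE_pair_iff[OF P] by simp
qed

text \<open>Up to a phase, \<open>G\<close> is \<open>zak_sum h\<close> composed with an affine map
  whose linear part has rows (d, - b) and (- c, a), of determinant 1. The modulus of
  \<open>zak_sum h\<close> is periodic in both variables, so this map preserves the
  integral.\<close>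

lemma integral_rotation_average_zak_sum_K:
  assumes bd: "\<And>w. cmod (K w) \<le> B / (1 + \<bar>w\<bar>)" and Km: "K \<in> borel_measurable borel"
    and J: "J \<in> borel_measurable borel"
  shows "(\<integral>\<xi>. J (cmod (zak_sum K \<xi>)) \<partial>torus) = (\<integral>\<xi>. J (cmod (zak_sum h \<xi>)) \<partial>torus :: real)"
proof -
  note [measurable] = J
  have [measurable]: "G \<in> borel_measurable torus" "zak_sum K \<in> borel_measurable torus"
    by (intro measurable_circle2 G_measurable measurable_zak_sum Km)+
  have hm [measurable]: "zak_sum h \<in> borel_measurable borel" by (rule measurable_zak_sum[OF h_measurable])
  define t where "t = (of_int (a * (b + d)) / 2 :: real)"
  have "(\<integral>\<xi>. J (cmod (zak_sum K \<xi>)) \<partial>torus) = (\<integral>\<xi>. J (cmod (G \<xi>)) \<partial>torus)"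
    by (rule integral_cong_AE) (use norm_zak_sum_K[OF bd Km] in auto)
  also have "\<dots> = (\<integral>\<xi>. J (cmod (zak_sum h (of_int d * fst \<xi> + of_int (- b) * snd \<xi> + (of_int d * t + of_int d / 2), 
      of_int (- c) * fst \<xi> + of_int a * snd \<xi> + (- of_int c * t)))) \<partial>torus)"
    by (intro Bochner_Integration.integral_cong refl)
       (simp only: G_def F_def case_prod_beta' fst_conv snd_conv norm_mult norm_e2pi mult_1_left t_def[symmetric],
        simp add: algebra_simps)
  also have "\<dots> = (\<integral>\<xi>. J (cmod (zak_sum h \<xi>)) \<partial>torus)"
  proof (rule integral_torus_affine[where f = "\<lambda>\<xi>. J (cmod (zak_sum h \<xi>))"])
    show "J (cmod (zak_sum h (x + 1, y))) = J (cmod (zak_sum h (x, y)))" for x y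
      by (simp add: zak_sum_periodic)
    show "J (cmod (zak_sum h (x, y + 1))) = J (cmod (zak_sum h (x, y)))" for x y
      by (simp add: zak_sum_shift norm_mult)
    show "d * a - (- b) * (- c) \<noteq> 0" using det by (simp add: mult.commute)
  qed measurable
  finally show ?thesis .
qed

end

text \<open>The matrix with rows (A, B), (0, 1 / A) is multiplied from the left by an element of the
  modular group. The substitution s -> s / A identifies the transform of the triangular kernel with
  the kernel of the product. Horocycle points are triangular, and so are the members of the limit
  family that must be moved away from c = 0.\<close>

lemma kernel_law_invariant:
  fixes a b c d :: int and F :: "complex \<Rightarrow> real"
  assumes F: "continuous_on UNIV F" "bounded (range F)"
    and A: "A \<noteq> 0" and det: "a * d - b * c = 1" and c: "c \<noteq> 0"
  shows "(\<integral>z. F z \<partial>kernel_law (of_int a * A) (of_int a * B + of_int b / A) (of_int c * A) (of_int c * B + of_int d / A))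
     = (\<integral>z. F z \<partial>kernel_law A B 0 (1 / A))"
proof -
  define h where "h = weil_kernel A B 0 (1 / A)"
  have h: "h s = of_real (sqrt \<bar>A\<bar>) * e2pi (A * B * s\<^sup>2 / 2) * of_real (chi (A * s))" for s
    by (simp add: h_def weil_kernel_def)
  have hm: "h \<in> borel_measurable borel" unfolding h_def by measurable
  have chi_int: "integrable lborel (\<lambda>s. sqrt \<bar>A\<bar> * chi (A * s))"
    using lborel_integrable_real_affine[OF integrable_chi A, of 0] by simp
  have hint: "integrable lborel h"
    by (rule Bochner_Integration.integrable_bound[OF chi_int]) (use hm in \<open>auto simp: h norm_mult abs_mult\<close>)
  have supp: "h s = 0" if "\<bar>s\<bar> > 1 / \<bar>A\<bar>" for s
  proof -
    have "1 < \<bar>A\<bar> * \<bar>s\<bar>" using that A by (simp add: field_simps)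
    then have "\<bar>A * s\<bar> > 1" by (simp only: abs_mult)
    then have "chi (A * s) = 0" by (auto simp: chi_def indicator_def)
    then show ?thesis by (simp add: h)
  qed
  interpret W: weil_transform h "1 / \<bar>A\<bar>" a b c d
    by unfold_locales (use hint supp det c in auto)
  have K: "W.K = weil_kernel (of_int a * A) (of_int a * B + of_int b / A) (of_int c * A) (of_int c * B + of_int d / A)"
  proof
    fix w
    let ?f = "\<lambda>s. e2pi (((of_int a * w\<^sup>2 + of_int d * s\<^sup>2) / 2 - w * s) / of_int c) * h s"
    let ?g = "\<lambda>s. e2pi (((of_int a * A * w\<^sup>2 + (of_int c * B + of_int d / A) * s\<^sup>2) / 2 - w * s) / (of_int c * A)) * of_real (chi s)"
    have "?f (0 + 1 / A * s) = of_real (sqrt \<bar>A\<bar>) * ?g s" for s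
    proof -
      have "((of_int a * w\<^sup>2 + of_int d * (s / A)\<^sup>2) / 2 - w * (s / A)) / of_int c + A * B * (s / A)\<^sup>2 / 2 = 
         ((of_int a * A * w\<^sup>2 + (of_int c * B + of_int d / A) * s\<^sup>2) / 2 - w * s) / (of_int c * A)"
        using A c by (simp add: field_simps power2_eq_square)
      then have "e2pi (((of_int a * w\<^sup>2 + of_int d * (s / A)\<^sup>2) / 2 - w * (s / A)) / of_int c) * e2pi (A * B * (s / A)\<^sup>2 / 2) = 
         e2pi (((of_int a * A * w\<^sup>2 + (of_int c * B + of_int d / A) * s\<^sup>2) / 2 - w * s) / (of_int c * A))"
        by (simp only: e2pi_add[symmetric])
      moreover have "A * (s / A) = s" using A by simp
      ultimately show ?thesis by (simp add: h mult.assoc[symmetric] mult.commute[of _ "complex_of_real (sqrt \<bar>A\<bar>)"])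
    qed
    then have "(\<integral>s. ?f s \<partial>lborel) = \<bar>1 / A\<bar> *\<^sub>R (\<integral>s. of_real (sqrt \<bar>A\<bar>) * ?g s \<partial>lborel)"
      using lborel_integral_real_affine[of "1 / A" ?f 0] A by simp
    also have "\<dots> = of_real (sqrt \<bar>A\<bar> / \<bar>A\<bar>) * (\<integral>s. ?g s \<partial>lborel)"
      by (subst integral_mult_right_zero) (simp add: scaleR_conv_of_real)
    finally have "W.K w = of_real (1 / sqrt \<bar>of_int c\<bar> * (sqrt \<bar>A\<bar> / \<bar>A\<bar>)) * (\<integral>s. ?g s \<partial>lborel)"
      unfolding W.K_def by (simp only: of_real_mult mult.assoc)
    also have "1 / sqrt \<bar>of_int c\<bar> * (sqrt \<bar>A\<bar> / \<bar>A\<bar>) = 1 / sqrt \<bar>of_int c * A\<bar>"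
    proof -
      have "sqrt \<bar>A\<bar> / \<bar>A\<bar> = 1 / sqrt \<bar>A\<bar>" using A by (simp add: field_simps)
      then show ?thesis by (simp add: abs_mult real_sqrt_mult)
    qed
    finally show "W.K w = weil_kernel (of_int a * A) (of_int a * B + of_int b / A) (of_int c * A) (of_int c * B + of_int d / A) w"
      using A c by (simp add: weil_kernel_def)
  qed
  have detK: "of_int a * A * (of_int c * B + of_int d / A) - (of_int a * B + of_int b / A) * (of_int c * A) = 1"
  proof -
    have "of_int a * A * (of_int c * B + of_int d / A) - (of_int a * B + of_int b / A) * (of_int c * A) = real_of_int (a * d - b * c)"
      using A by (simp add: field_simps)
    then show ?thesis by (simp add: det del: of_int_diff of_int_mult)
  qed
  obtain C where C: "\<And>w. cmod (W.K w) \<le> C / (1 + \<bar>w\<bar>)"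
    using kernel_decay[OF detK] unfolding K by blast
  have Km: "W.K \<in> borel_measurable borel" unfolding K by measurable
  have "(\<integral>z. F z \<partial>law (zak_sum W.K)) = (\<integral>z. F z \<partial>law (zak_sum h))"
    unfolding integral_law[OF F measurable_zak_sum[OF Km]] integral_law[OF F measurable_zak_sum[OF hm]]
    by (rule W.integral_rotation_average_zak_sum_K[OF C Km measurable_rotation_average[OF F]])
  then show ?thesis unfolding kernel_law_def K[symmetric] h_def[symmetric] .
qed

section \<open>Birkhoff sums as points on a horocycle\<close>

lemma skew_iterate:
  "\<exists>i j :: int. (skew \<alpha> ^^ n) (p, q) =
     (p + of_nat n * \<alpha> + of_int i, q + of_nat n * p + of_nat n * (of_nat n - 1) / 2 * \<alpha> + of_int j)"
proof (induction n)
  case 0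
  show ?case by (rule exI[of _ 0])+ simp
next
  case (Suc n)
  then obtain i j :: int where ij: "(skew \<alpha> ^^ n) (p, q) =
     (p + of_nat n * \<alpha> + of_int i, q + of_nat n * p + of_nat n * (of_nat n - 1) / 2 * \<alpha> + of_int j)" by blast
  let ?p = "p + of_nat n * \<alpha> + of_int i" and ?q = "q + of_nat n * p + of_nat n * (of_nat n - 1) / 2 * \<alpha> + of_int j"
  have "(skew \<alpha> ^^ Suc n) (p, q) = (?p + \<alpha> - of_int \<lfloor>?p + \<alpha>\<rfloor>, ?q + ?p - of_int \<lfloor>?q + ?p\<rfloor>)"
    by (simp only: funpow.simps comp_apply ij) (simp add: skew_def frac_def)
  also have "\<dots> = (p + of_nat (Suc n) * \<alpha> + of_int (i - \<lfloor>?p + \<alpha>\<rfloor>),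
      q + of_nat (Suc n) * p + of_nat (Suc n) * (of_nat (Suc n) - 1) / 2 * \<alpha> + of_int (i + j - \<lfloor>?q + ?p\<rfloor>))"
    by (simp add: field_simps)
  finally show ?case by blast
qed

text \<open>Reduction modulo 1 is invisible to the character. The half in n (n - 1) / 2 = n^2 / 2 -
  n / 2 is absorbed into the linear phase, so the quadratic phase involves only u = l
  \<alpha>.\<close>

lemma psi_skew_iterate:
  "psi k l ((skew \<alpha> ^^ n) (p, q)) =
     e2pi (of_int l * q) * (e2pi (of_int k * p) *
       e2pi (of_int l * \<alpha> * (of_nat n)\<^sup>2 / 2 + of_nat n * (of_int l * p + (of_int k * \<alpha> - of_int l * \<alpha> / 2))))"
proof -
  obtain i j :: int where ij: "(skew \<alpha> ^^ n) (p, q) =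
     (p + of_nat n * \<alpha> + of_int i, q + of_nat n * p + of_nat n * (of_nat n - 1) / 2 * \<alpha> + of_int j)"
    using skew_iterate by blast
  show ?thesis
    unfolding ij psi_def prod.case e2pi_add[symmetric]
  proof (rule e2pi_cong_Ints)
    have "of_int k * (p + of_nat n * \<alpha> + of_int i) + of_int l * (q + of_nat n * p + of_nat n * (of_nat n - 1) / 2 * \<alpha> + of_int j) -
      (of_int l * q + (of_int k * p + (of_int l * \<alpha> * (of_nat n)\<^sup>2 / 2 + of_nat n * (of_int l * p + (of_int k * \<alpha> - of_int l * \<alpha> / 2)))))
      = of_int (k * i + l * j)"
      by (simp add: field_simps power2_eq_square)
    then show "of_int k * (p + of_nat n * \<alpha> + of_int i) + of_int l * (q + of_nat n * p + of_nat n * (of_nat n - 1) / 2 * \<alpha> + of_int j) -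
      (of_int l * q + (of_int k * p + (of_int l * \<alpha> * (of_nat n)\<^sup>2 / 2 + of_nat n * (of_int l * p + (of_int k * \<alpha> - of_int l * \<alpha> / 2)))))
      \<in> \<int>" by (simp only: Ints_of_int)
  qed
qed

definition weyl_sum :: "nat \<Rightarrow> real \<Rightarrow> real \<Rightarrow> complex" where
  "weyl_sum N u x = of_real (1 / sqrt (of_nat N)) * (\<Sum>n=1..N. e2pi (u * (of_nat n)\<^sup>2 / 2 + of_nat n * x))"

lemma weyl_sum_measurable [measurable]: "weyl_sum N u \<in> borel_measurable borel"
  unfolding weyl_sum_def by measurable

lemma weyl_sum_periodic: "weyl_sum N u (x + 1) = weyl_sum N u x"
proof -
  have "e2pi (u * (of_nat n)\<^sup>2 / 2 + of_nat n * (x + 1)) = e2pi (u * (of_nat n)\<^sup>2 / 2 + of_nat n * x)" for n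
    by (rule e2pi_cong_Ints) (simp add: algebra_simps)
  then show ?thesis by (simp only: weyl_sum_def)
qed

text \<open>The coordinate q enters only through e(l q), a uniform phase; p enters the modulus only
  through l p plus a constant, which is again uniform on the circle. The frequency k contributes a
  phase and a translation, both absorbed in this way.\<close>

lemma integral_rho:
  assumes F: "continuous_on UNIV F" "bounded (range F)" and l: "l \<noteq> 0" and N: "N \<ge> 1"
  shows "(\<integral>z. F z \<partial>rho k l N \<alpha>) = (\<integral>x. rotation_average F (cmod (weyl_sum N (of_int l * \<alpha>) x)) \<partial>circle)"
proof -
  obtain B where B: "\<And>z. \<bar>F z\<bar> \<le> B" by (rule bound_witness[OF F]) auto
  note [measurable] = measurable_F[OF F] measurable_rotation_average[OF F]
  let ?u = "of_int l * \<alpha>"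
  let ?s = "of_int k * \<alpha> - of_int l * \<alpha> / 2"
  have sqrtN: "real N powr (-1/2) = 1 / sqrt (of_nat N)"
    using powr_minus_divide[of "real N" "1/2"] powr_half_sqrt[of "real N"] by simp
  have X: "of_real (real N powr (-1/2)) * birkhoff_sum N \<alpha> (psi k l) (p, q)
      = e2pi (of_int l * q) * (e2pi (of_int k * p) * weyl_sum N ?u (of_int l * p + ?s))" for p q
    unfolding birkhoff_sum_def psi_skew_iterate weyl_sum_def sqrtN
    by (simp add: sum_distrib_left mult_ac)
  have Xm: "(\<lambda>pq. e2pi (of_int l * snd pq) * (e2pi (of_int k * fst pq) * weyl_sum N ?u (of_int l * fst pq + ?s))) \<in> borel_measurable (borel :: (real \<times> real) measure)"
    unfolding borel_prod[symmetric] by measurable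
  have Xt: "(\<lambda>pq. e2pi (of_int l * snd pq) * (e2pi (of_int k * fst pq) * weyl_sum N ?u (of_int l * fst pq + ?s))) \<in> borel_measurable torus"
    by (rule measurable_circle2[OF Xm])
  have Xeq: "(\<lambda>pq. of_real (real N powr (-1/2)) * birkhoff_sum N \<alpha> (psi k l) pq) = 
      (\<lambda>pq. e2pi (of_int l * snd pq) * (e2pi (of_int k * fst pq) * weyl_sum N ?u (of_int l * fst pq + ?s)))"
    using X by (simp add: fun_eq_iff)
  have "(\<integral>z. F z \<partial>rho k l N \<alpha>) = (\<integral>pq. F (e2pi (of_int l * snd pq) * (e2pi (of_int k * fst pq) * weyl_sum N ?u (of_int l * fst pq + ?s))) \<partial>torus)"
    unfolding rho_def Xeq by (rule integral_distr[OF Xt]) measurable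
  also have "\<dots> = (\<integral>p. \<integral>q. F (e2pi (of_int l * q) * (e2pi (of_int k * p) * weyl_sum N ?u (of_int l * p + ?s))) \<partial>circle \<partial>circle)"
  proof -
    have "integrable torus (\<lambda>pq. F (e2pi (of_int l * snd pq) * (e2pi (of_int k * fst pq) * weyl_sum N ?u (of_int l * fst pq + ?s))))"
      by (rule circle2.P.integrable_const_bound[where B = B]) (use B measurable_compose[OF Xt measurable_F[OF F]] in auto)
    from circle2.integral_fst'[OF this] show ?thesis by simp
  qed
  also have "\<dots> = (\<integral>p. rotation_average F (cmod (weyl_sum N ?u (of_int l * p + ?s))) \<partial>circle)"
    by (simp only: rotation_average_rotate[OF F l] norm_mult norm_e2pi mult_1_left)
  also have "\<dots> = (\<integral>x. rotation_average F (cmod (weyl_sum N ?u x)) \<partial>circle)"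
    by (rule integral_circle_affine[where f = "\<lambda>x. rotation_average F (cmod (weyl_sum N ?u x))"]) (simp_all add: weyl_sum_periodic l)
  finally show ?thesis .
qed

text \<open>The matrix has Iwasawa coordinates u + i / N^2 and angle 0, so the kernel is supported
  on (0, N]. On a fibre the Zak transform is a phase times the Weyl sum at x - y u, and the shift by
  y u disappears on integration over x.\<close>

lemma integral_kernel_law_horocycle:
  assumes F: "continuous_on UNIV F" "bounded (range F)" and N: "N \<ge> 1"
  shows "(\<integral>z. F z \<partial>kernel_law (1 / of_nat N) (u * of_nat N) 0 (of_nat N)) = (\<integral>x. rotation_average F (cmod (weyl_sum N u x)) \<partial>circle)"
proof -
  note [measurable] = measurable_F[OF F] measurable_rotation_average[OF F]
  obtain B where B: "\<And>r. \<bar>rotation_average F r\<bar> \<le> B" by (rule rotation_average_bounded[OF F]) auto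
  define h where "h = weil_kernel (1 / of_nat N) (u * of_nat N) 0 (of_nat N)"
  have hm: "h \<in> borel_measurable borel" unfolding h_def by measurable
  have h: "h s = of_real (1 / sqrt (of_nat N)) * e2pi (u * s\<^sup>2 / 2) * of_real (indicator {0<..of_nat N} s)" for s
  proof -
    have "chi (1 / of_nat N * s) = indicator {0<..of_nat N} s"
      using N by (auto simp: chi_def indicator_def field_simps)
    then show ?thesis using N by (simp add: h_def weil_kernel_def real_sqrt_divide)
  qed
  have regroup: "w * e = q * (r * t)" if "w = r * p" "p * e = q * t" for w e q r t p :: complex
    using that by (simp add: mult.assoc mult.left_commute[of q])
  \<comment> \<open>For 0 \<le> y < 1 the half-open interval (0, N] contains n - y exactly when 1
    \<le> n \<le> N; this is where the choice of endpoints in \<open>chi\<close> matters.\<close>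
  have zs: "cmod (zak_sum h (x, y)) = cmod (weyl_sum N u (1 * x + (- y * u)))" if y: "0 \<le> y" "y < 1" for x y
  proof -
    have "zak_sum h (x, y) = (\<Sum>n\<in>{1..int N}. h (of_int n - y) * e2pi (of_int n * x))"
    proof (rule zak_sum_finite)
      fix n assume "n \<notin> {1..int N}"
      then have "n \<le> 0 \<or> n \<ge> int N + 1" by auto
      then have "real_of_int n \<le> 0 \<or> real_of_int n \<ge> of_nat N + 1" by linarith
      then show "h (of_int n - y) = 0" using y by (auto simp: h indicator_def)
    qed simp
    also have "\<dots> = (\<Sum>n\<in>{1..N}. h (of_nat n - y) * e2pi (of_nat n * x))"
      by (rule sum.reindex_bij_witness[of _ int nat]) auto
    also have "\<dots> = (\<Sum>n\<in>{1..N}. e2pi (u * y\<^sup>2 / 2) * (of_real (1 / sqrt (of_nat N)) * e2pi (u * (of_nat n)\<^sup>2 / 2 + of_nat n * (1 * x + (- y * u)))))"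
    proof (intro sum.cong refl)
      fix n assume n: "n \<in> {1..N}"
      have n': "1 \<le> real n" "real n \<le> real N" using n by simp_all
      have "real n - y \<in> {0<..real N}" using n' y by auto
      then have "h (of_nat n - y) = of_real (1 / sqrt (of_nat N)) * e2pi (u * (of_nat n - y)\<^sup>2 / 2)" by (simp add: h)
      moreover have "e2pi (u * (of_nat n - y)\<^sup>2 / 2) * e2pi (of_nat n * x) = e2pi (u * y\<^sup>2 / 2) * e2pi (u * (of_nat n)\<^sup>2 / 2 + of_nat n * (1 * x + (- y * u)))"
        unfolding e2pi_add[symmetric] by (rule arg_cong[where f = e2pi]) (simp add: field_simps power2_eq_square)
      ultimately show "h (of_nat n - y) * e2pi (of_nat n * x) = e2pi (u * y\<^sup>2 / 2) * (of_real (1 / sqrt (of_nat N)) * e2pi (u * (of_nat n)\<^sup>2 / 2 + of_nat n * (1 * x + (- y * u))))"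
        by (rule regroup)
    qed
    also have "\<dots> = e2pi (u * y\<^sup>2 / 2) * weyl_sum N u (1 * x + (- y * u))"
      unfolding weyl_sum_def by (simp only: sum_distrib_left)
    finally show ?thesis by (simp only: norm_mult norm_e2pi mult_1_left)
  qed
  have [measurable]: "zak_sum h \<in> borel_measurable torus" by (intro measurable_circle2 measurable_zak_sum hm)
  have "(\<integral>z. F z \<partial>law (zak_sum h)) = (\<integral>\<xi>. rotation_average F (cmod (zak_sum h \<xi>)) \<partial>torus)"
    by (rule integral_law[OF F measurable_zak_sum[OF hm]])
  also have "\<dots> = (\<integral>y. \<integral>x. rotation_average F (cmod (zak_sum h (x, y))) \<partial>circle \<partial>circle)"
  proof -
    have "integrable torus (\<lambda>(x, y). rotation_average F (cmod (zak_sum h (x, y))))"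
      by (rule circle2.P.integrable_const_bound[where B = B]) (use B in auto)
    from circle2.integral_snd[OF this] show ?thesis by (simp add: case_prod_beta')
  qed
  also have "\<dots> = (\<integral>y. \<integral>x. rotation_average F (cmod (weyl_sum N u (of_int 1 * x + (- y * u)))) \<partial>circle \<partial>circle)"
    by (intro Bochner_Integration.integral_cong refl) (simp add: zs)
  also have "\<dots> = (\<integral>y. \<integral>x. rotation_average F (cmod (weyl_sum N u x)) \<partial>circle \<partial>circle)"
    by (intro Bochner_Integration.integral_cong refl integral_circle_affine[where f = "\<lambda>x. rotation_average F (cmod (weyl_sum N u x))"])
       (simp_all add: weyl_sum_periodic)
  also have "\<dots> = (\<integral>x. rotation_average F (cmod (weyl_sum N u x)) \<partial>circle)"
    using circle.prob_space by simp
  finally show ?thesis unfolding kernel_law_def h_def .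
qed

text \<open>With u = l \<alpha>, the lower row (c / N, (c u + d) N) of the moved point is what
  Diophantine approximation controls.\<close>

lemma integral_rho_eq_kernel_law:
  fixes a b c d :: int and F :: "complex \<Rightarrow> real"
  assumes F: "continuous_on UNIV F" "bounded (range F)" and l: "l \<noteq> 0" and N: "N \<ge> 1"
    and det: "a * d - b * c = 1" and c: "c \<noteq> 0"
  shows "(\<integral>z. F z \<partial>rho k l N \<alpha>) = (\<integral>z. F z \<partial>kernel_law (of_int a / of_nat N) ((of_int a * (of_int l * \<alpha>) + of_int b) * of_nat N)
     (of_int c / of_nat N) ((of_int c * (of_int l * \<alpha>) + of_int d) * of_nat N))"
proof -
  have A: "1 / real N \<noteq> 0" using N by simp
  have eqs: "of_int a * (1 / real N) = of_int a / of_nat N" "of_int c * (1 / real N) = of_int c / of_nat N" "1 / (1 / real N) = of_nat N"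
    "of_int a * (of_int l * \<alpha> * of_nat N) + of_int b / (1 / real N) = (of_int a * (of_int l * \<alpha>) + of_int b) * of_nat N"
    "of_int c * (of_int l * \<alpha> * of_nat N) + of_int d / (1 / real N) = (of_int c * (of_int l * \<alpha>) + of_int d) * of_nat N"
    by (simp_all add: algebra_simps)
  show ?thesis
    using kernel_law_invariant[OF F A det c, of "of_int l * \<alpha> * of_nat N"]
    by (simp only: eqs integral_rho[OF F l N] integral_kernel_law_horocycle[OF F N])
qed

section \<open>Density of horocycle points\<close>

text \<open>If S had positive measure, it would lie in an open W with W - S of measure less than
  \<kappa> times that of S. Disjoint Vitali balls inside W cover almost all of S, and each contains
  a hole of at least the proportion \<kappa>. The holes lie in W - S and have total measure at least
  \<kappa> times that of S, a contradiction.\<close>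

lemma negligible_if_porous:
  fixes S :: "real set"
  assumes S: "S \<in> sets lebesgue" and \<kappa>: "\<kappa> > 0"
    and porous: "\<And>u \<delta>. u \<in> S \<Longrightarrow> \<delta> > 0 \<Longrightarrow>
      \<exists>\<rho> t r. 0 < \<rho> \<and> \<rho> < \<delta> \<and> \<kappa> * \<rho> \<le> r \<and> ball t r \<subseteq> ball u \<rho> - S"
  shows "negligible S"
proof -
  have "emeasure lebesgue S = 0"
  proof (rule ccontr)
    assume nz: "emeasure lebesgue S \<noteq> 0"
    \<comment> \<open>S may have infinite measure; then any positive finite \<open>e\<close>
      serves.\<close>
    obtain e where e: "e > 0" "ennreal e \<le> ennreal \<kappa> * emeasure lebesgue S"
    proof (cases "emeasure lebesgue S = \<infinity>")
      case True
      then show ?thesis using \<kappa> by (intro that[of 1]) (auto simp: ennreal_mult_top)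
    next
      case False
      then have "emeasure lebesgue S = ennreal (measure lebesgue S)" by (intro emeasure_eq_ennreal_measure) auto
      moreover from this have "measure lebesgue S > 0" using nz by (metis ennreal_0 measure_nonneg order_le_less)
      ultimately show ?thesis using \<kappa> by (intro that[of "\<kappa> * measure lebesgue S"]) (auto simp: ennreal_mult)
    qed
    obtain W where W: "open W" "S \<subseteq> W" "emeasure lebesgue (W - S) < ennreal e"
      using sets_lebesgue_outer_open[OF S e(1)] by metis
    \<comment> \<open>The Vitali index carries the hole (t, r) along with its ball, so selecting
      balls selects holes.\<close>
    define I where "I = {(u, \<rho>, t, r). u \<in> S \<and> 0 < \<rho> \<and> ball u \<rho> \<subseteq> W \<and> \<kappa> * \<rho> \<le> r \<and> ball t r \<subseteq> ball u \<rho> - S}"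
    let ?u = "fst :: real \<times> real \<times> real \<times> real \<Rightarrow> real" and ?\<rho> = "\<lambda>i. fst (snd i) :: real"
    obtain C where C: "countable C" "C \<subseteq> I" "pairwise (\<lambda>i j. disjnt (ball (?u i) (?\<rho> i)) (ball (?u j) (?\<rho> j))) C"
      "negligible (S - (\<Union>i\<in>C. ball (?u i) (?\<rho> i)))"
    proof (rule Vitali_covering_theorem_balls[of S I ?u ?\<rho>])
      fix x d :: real assume x: "x \<in> S" and d: "0 < d"
      obtain \<epsilon> where \<epsilon>: "\<epsilon> > 0" "ball x \<epsilon> \<subseteq> W" using W x open_contains_ball by blast
      obtain \<rho> t r where "0 < \<rho>" "\<rho> < min d \<epsilon>" "\<kappa> * \<rho> \<le> r" "ball t r \<subseteq> ball x \<rho> - S"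
        using porous[OF x, of "min d \<epsilon>"] d \<epsilon> by auto
      then have "(x, \<rho>, t, r) \<in> I" using x \<epsilon> subset_ball[of \<rho> \<epsilon> x] by (auto simp: I_def)
      then show "\<exists>i. i \<in> I \<and> x \<in> ball (?u i) (?\<rho> i) \<and> ?\<rho> i < d"
        using \<open>0 < \<rho>\<close> \<open>\<rho> < min d \<epsilon>\<close> by (intro exI[of _ "(x, \<rho>, t, r)"]) auto
    qed
    define B where "B = (\<lambda>i. ball (?u i) (?\<rho> i))"
    define T where "T = (\<lambda>i::real \<times> real \<times> real \<times> real. ball (fst (snd (snd i))) (snd (snd (snd i))))"
    have TB: "T i \<subseteq> B i - S" "B i \<subseteq> W" "\<kappa> * ?\<rho> i \<le> snd (snd (snd i))" "0 < ?\<rho> i" if "i \<in> C" for i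
    proof -
      obtain u \<rho> t r where i: "i = (u, \<rho>, t, r)" by (cases i) auto
      with that C(2) have "(u, \<rho>, t, r) \<in> I" by blast
      then show "T i \<subseteq> B i - S" "B i \<subseteq> W" "\<kappa> * ?\<rho> i \<le> snd (snd (snd i))" "0 < ?\<rho> i"
        by (simp_all add: I_def i T_def B_def)
    qed
    have disjB: "disjoint_family_on B C"
      using C(3) unfolding disjoint_family_on_def pairwise_def disjnt_def B_def by blast
    have disjT: "disjoint_family_on T C"
      unfolding disjoint_family_on_def
    proof (intro ballI impI)
      fix i j assume ij: "i \<in> C" "j \<in> C" "i \<noteq> j"
      then have "B i \<inter> B j = {}" using disjB by (simp add: disjoint_family_on_def)
      then show "T i \<inter> T j = {}" using TB(1)[OF ij(1)] TB(1)[OF ij(2)] by blast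
    qed
    have meas: "B i \<in> sets lebesgue" "T i \<in> sets lebesgue" for i
      by (simp_all add: B_def T_def)
    have ball_em: "emeasure lebesgue (ball x r) = ennreal (2 * r)" if "r > 0" for x r :: real
      using that by (simp add: ball_eq_greaterThanLessThan)
    have le: "ennreal \<kappa> * emeasure lebesgue (B i) \<le> emeasure lebesgue (T i)" if i: "i \<in> C" for i
    proof -
      have "0 < \<kappa> * ?\<rho> i" using TB(4)[OF i] \<kappa> by simp
      then have "0 < snd (snd (snd i))" using TB(3)[OF i] by linarith
      then have "emeasure lebesgue (T i) = ennreal (2 * snd (snd (snd i)))" unfolding T_def by (rule ball_em)
      moreover have "emeasure lebesgue (B i) = ennreal (2 * ?\<rho> i)" unfolding B_def by (rule ball_em[OF TB(4)[OF i]])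
      moreover have "ennreal \<kappa> * ennreal (2 * ?\<rho> i) = ennreal (\<kappa> * (2 * ?\<rho> i))"
        using \<kappa> TB(4)[OF i] by (simp add: ennreal_mult)
      ultimately show ?thesis using TB(3)[OF i] by (simp add: ennreal_leI)
    qed
    have UB: "(\<Union>i\<in>C. B i) \<in> sets lebesgue"
      by (rule sets.countable_UN'[OF C(1)]) (use meas in blast)
    have "emeasure lebesgue S \<le> emeasure lebesgue (\<Union>i\<in>C. B i)"
    proof -
      have "emeasure lebesgue S \<le> emeasure lebesgue ((\<Union>i\<in>C. B i) \<union> (S - (\<Union>i\<in>C. B i)))"
        by (intro emeasure_mono sets.Un sets.Diff S UB) auto
      also have "\<dots> = emeasure lebesgue (\<Union>i\<in>C. B i)"
        using C(1,4) meas by (intro emeasure_Un_null_set) (auto simp: negligible_iff_null_sets B_def)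
      finally show ?thesis .
    qed
    then have "ennreal \<kappa> * emeasure lebesgue S \<le> ennreal \<kappa> * emeasure lebesgue (\<Union>i\<in>C. B i)"
      by (rule mult_left_mono) simp
    also have "\<dots> = (\<integral>\<^sup>+i. ennreal \<kappa> * emeasure lebesgue (B i) \<partial>count_space C)"
      using emeasure_UN_countable[of C B lebesgue] C(1) meas disjB by (simp add: nn_integral_cmult)
    also have "\<dots> \<le> (\<integral>\<^sup>+i. emeasure lebesgue (T i) \<partial>count_space C)"
      by (intro nn_integral_mono) (simp add: le)
    also have "\<dots> = emeasure lebesgue (\<Union>i\<in>C. T i)"
      using emeasure_UN_countable[of C T lebesgue] C(1) meas disjT by simp
    also have "\<dots> \<le> emeasure lebesgue (W - S)"
    proof (rule emeasure_mono)
      show "(\<Union>i\<in>C. T i) \<subseteq> W - S" using TB(1,2) by blast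
      show "W - S \<in> sets lebesgue" using W(1) S by auto
    qed
    also have "\<dots> < ennreal e" by (rule W(3))
    finally show False using e(2) by simp
  qed
  then show ?thesis using S by (simp add: negligible_iff_null_sets null_sets_def)
qed

section \<open>Diophantine approximation of horocycle points\<close>

lemma bezout_bounded:
  fixes x y :: int
  assumes "coprime x y" "y > 0"
  obtains x' y' where "x * y' - x' * y = 1" "1 \<le> y'" "y' \<le> y"
proof -
  obtain s t where st: "s * x + t * y = 1" using bezout_int[of x y] assms by auto
  \<comment> \<open>The offset by 1 takes the residue of s in 1..y instead of 0..y - 1, so that y'
    is positive even when y divides s.\<close>
  define y' where "y' = (s - 1) mod y + 1"
  define x' where "x' = - t - (s - 1) div y * x"
  have "s - 1 = y * ((s - 1) div y) + (s - 1) mod y" by simp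
  then have "s = y' + (s - 1) div y * y" by (simp add: y'_def mult.commute)
  then have "(y' + (s - 1) div y * y) * x + t * y = 1" using st by simp
  then have "x * y' - x' * y = 1" by (simp add: x'_def algebra_simps)
  moreover have "1 \<le> y'" "y' \<le> y" using pos_mod_bound[OF assms(2), of "s - 1"] pos_mod_sign[OF assms(2), of "s - 1"] unfolding y'_def by linarith+
  ultimately show ?thesis by (rule that)
qed

text \<open>With m = floor (r n), the choice P = n t m + 1 and Q = n^2 t gives P / Q = m / n + 1 /
  Q. As P is 1 modulo n t, it is coprime to Q; n makes m / n close to r, and t makes Q
  large.\<close>

lemma coprime_fraction_near:
  fixes r \<epsilon> :: real
  assumes "\<epsilon> > 0"
  obtains P Q :: int where "coprime P Q" "Q > 0" "of_int Q > (B::real)" "\<bar>of_int P / of_int Q - r\<bar> < \<epsilon>"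
proof -
  obtain n0 :: nat where n0: "real n0 > 2 / \<epsilon>" using reals_Archimedean2 by blast
  define n where "n = int n0 + 1"
  have n: "n \<ge> 1" "of_int n > 2 / \<epsilon>" using n0 by (auto simp: n_def)
  obtain t0 :: nat where t0: "real t0 > \<bar>B\<bar> + 2 / \<epsilon>" using reals_Archimedean2 by blast
  define t where "t = int t0 + 1"
  have t: "t \<ge> 1" "of_int t > \<bar>B\<bar> + 2 / \<epsilon>" using t0 by (auto simp: t_def)
  define m where "m = \<lfloor>r * of_int n\<rfloor>"
  define P where "P = n * t * m + 1"
  define Q where "Q = n * (n * t)"
  have npos: "real_of_int n \<ge> 1" and tpos: "real_of_int t \<ge> 1" using n t by simp_all
  have "coprime (n * t * m + 1) (n * t)" 
  proof (rule coprimeI)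
    fix k assume "k dvd n * t * m + 1" "k dvd n * t"
    then have "k dvd (n * t * m + 1) - n * t * m" by (metis dvd_diff dvd_mult2)
    then show "is_unit k" by simp
  qed
  then have "coprime P Q" by (simp add: P_def Q_def coprime_mult_right_iff)
  moreover have "Q > 0" using n t by (simp add: Q_def)
  moreover have Qt: "real_of_int Q \<ge> of_int t"
  proof -
    have "1 * (1 * real_of_int t) \<le> of_int n * (of_int n * of_int t)" using npos tpos by (intro mult_mono) auto
    then show ?thesis by (simp add: Q_def)
  qed
  then have "of_int Q > B" using t assms by (smt (verit) divide_nonneg_pos)
  moreover have "\<bar>of_int P / of_int Q - r\<bar> < \<epsilon>"
  proof -
    have "of_int P / of_int Q = of_int m / of_int n + 1 / real_of_int Q"
      using npos tpos by (simp add: P_def Q_def field_simps)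
    moreover have "\<bar>of_int m / of_int n - r\<bar> < \<epsilon> / 2"
    proof -
      have "\<bar>of_int m - r * of_int n\<bar> < 1" by (simp add: m_def abs_less_iff) linarith
      have "\<bar>of_int m / of_int n - r\<bar> = \<bar>of_int m - r * of_int n\<bar> / of_int n"
      proof -
        have "of_int m / of_int n - r = (of_int m - r * of_int n) / of_int n" using npos by (simp add: field_simps)
        then show ?thesis using npos by simp
      qed
      also have "\<dots> < 1 / of_int n" using npos \<open>\<bar>of_int m - r * of_int n\<bar> < 1\<close> by (intro divide_strict_right_mono) auto
      also have "\<dots> < \<epsilon> / 2" using n assms by (simp add: field_simps)
      finally show ?thesis .
    qed
    moreover have "\<bar>1 / real_of_int Q\<bar> < \<epsilon> / 2"
    proof -
      have "of_int Q > 2 / \<epsilon>" using Qt t assms by linarith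
      moreover have "2 / \<epsilon> > 0" using assms by simp
      ultimately have "real_of_int Q > 0" by linarith
      then show ?thesis using assms \<open>of_int Q > 2 / \<epsilon>\<close> by (simp add: field_simps)
    qed
    ultimately show ?thesis by linarith
  qed
  ultimately show ?thesis by (rule that)
qed

text \<open>For irrational u the distances of q u to the integers, over the finitely many q in
  \<open>M\<close>, have a positive minimum m. Dirichlet's theorem with 1 / N < m then cannot return
  a denominator in \<open>M\<close>, which forces q > B.\<close>

lemma irrational_approximation:
  fixes u :: real
  assumes u: "u \<notin> \<rat>"
  obtains p q :: int where "coprime p q" "q > 0" "of_int q > (B::real)" "\<bar>u - of_int p / of_int q\<bar> < 1 / (of_int q)\<^sup>2"
proof -
  define M where "M = {1..\<lceil>\<bar>B\<bar>\<rceil> + 1}"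
  define D where "D = (\<lambda>q::int. \<bar>of_int q * u - of_int (round (of_int q * u))\<bar>)"
  have Dpos: "D q > 0" if "q \<in> M" for q
  proof -
    have "of_int q * u \<noteq> of_int (round (of_int q * u))"
    proof
      assume "of_int q * u = of_int (round (of_int q * u))"
      then have "u = of_int (round (of_int q * u)) / of_int q" using that by (simp add: M_def field_simps)
      then show False using u by (metis Rats_divide Rats_of_int)
    qed
    then show ?thesis by (simp add: D_def)
  qed
  have fin: "finite M" "M \<noteq> {}" by (auto simp: M_def)
  define m where "m = Min (D ` M)"
  have m: "m > 0" unfolding m_def using fin Dpos by (subst Min_gr_iff) auto
  obtain N :: nat where N: "N > 0" "1 / real N < m"
    using reals_Archimedean[OF m] by (metis inverse_eq_divide zero_less_Suc)
  obtain p q where pq: "coprime p q" "0 < q" "q \<le> int N" "\<bar>of_int q * u - of_int p\<bar> < 1 / real N"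
    using Dirichlet_approx_coprime[OF N(1), of u] by metis
  have "q \<notin> M"
  proof
    assume q: "q \<in> M"
    have "m \<le> D q" unfolding m_def using fin q by (intro Min_le) auto
    also have "D q \<le> \<bar>of_int q * u - of_int p\<bar>"
      unfolding D_def using round_diff_minimal[of "of_int q * u" p] by simp
    finally show False using pq(4) N(2) by linarith
  qed
  then have "q > \<lceil>\<bar>B\<bar>\<rceil> + 1" using pq(2) by (auto simp: M_def)
  then have "real_of_int (\<lceil>\<bar>B\<bar>\<rceil> + 1) < of_int q" by (simp only: of_int_less_iff)
  then have "of_int q > \<bar>B\<bar>" using le_of_int_ceiling[of "\<bar>B\<bar>"] unfolding of_int_add by linarith
  then have "of_int q > B" by linarith
  moreover have "\<bar>u - of_int p / of_int q\<bar> < 1 / (of_int q)\<^sup>2"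
  proof -
    have q0: "real_of_int q > 0" using pq by simp
    have "\<bar>u - of_int p / of_int q\<bar> = \<bar>of_int q * u - of_int p\<bar> / of_int q"
    proof -
      have "u - of_int p / of_int q = (of_int q * u - of_int p) / of_int q" using q0 by (simp add: field_simps)
      then show ?thesis using q0 by simp
    qed
    also have "\<dots> < 1 / real N / of_int q" using pq(4) q0 by (intro divide_strict_right_mono) auto
    also have "\<dots> \<le> 1 / of_int q / of_int q"
    proof -
      have "real_of_int q \<le> real N" using pq(3) by linarith
      then show ?thesis using q0 by (intro divide_right_mono divide_left_mono) auto
    qed
    finally show ?thesis by (simp add: power2_eq_square)
  qed
  ultimately show ?thesis using pq that by blast
qed

text \<open>The parameters are those of the moved horocycle point that do not depend on N: the
  entries a / N, c / N and (c u + d) N give the ratio a / c and the product c (c u + d). So N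
  remains free to adjust c / N, and c > K lets it grow.\<close>

definition horocycle_near :: "real \<Rightarrow> real \<Rightarrow> real \<Rightarrow> nat \<Rightarrow> real \<Rightarrow> bool" where
  "horocycle_near r s \<epsilon> K u \<longleftrightarrow> (\<exists>a b c d :: int. a * d - b * c = 1 \<and> c > int K \<and>
     \<bar>of_int a / of_int c - r\<bar> < \<epsilon> \<and> \<bar>of_int c * (of_int c * u + of_int d) - s\<bar> < \<epsilon>)"

lemma open_horocycle_near: "open {u. horocycle_near r s \<epsilon> K u}"
proof -
  have "{u. horocycle_near r s \<epsilon> K u} = (\<Union>(a, b, c, d) \<in> {(a :: int, b :: int, c :: int, d :: int). a * d - b * c = 1 \<and> c > int K \<and> \<bar>of_int a / of_int c - r\<bar> < \<epsilon>}.
      {u. \<bar>of_int c * (of_int c * u + of_int d) - s\<bar> < \<epsilon>})"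
    by (auto simp: horocycle_near_def)
  moreover have "open {u. \<bar>of_int c * (of_int c * u + of_int d) - s\<bar> < \<epsilon>}" for c d :: int
    by (intro open_Collect_less continuous_intros)
  ultimately show ?thesis by auto
qed

text \<open>A fixed fraction P / Q near r is combined with a variable approximation p / q of u. The
  product of the matrices with rows (P', P), (Q', Q) and (q, - p), (C, - A) has a / c within 1 / Q
  of P / Q and - d / c within Q / q^2 of p / q, while c is comparable to q. The porosity constant
  depends on Q, s and \<epsilon> but not on q.\<close>

lemma horocycle_near_ae:
  assumes \<epsilon>: "\<epsilon> > 0"
  shows "negligible {u. \<not> horocycle_near r s \<epsilon> K u}"
proof -
  obtain P Q :: int where PQ: "coprime P Q" "Q > 0" "of_int Q > 2 / \<epsilon>" "\<bar>of_int P / of_int Q - r\<bar> < \<epsilon> / 2"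
    using coprime_fraction_near[of "\<epsilon> / 2" "2 / \<epsilon>" r] \<epsilon> by auto
  obtain P' Q' where Q': "P * Q' - P' * Q = 1" "1 \<le> Q'" "Q' \<le> Q"
    using bezout_bounded[OF PQ(1,2)] by blast
  \<comment> \<open>The hole lies within R / q^2 of u: Q accounts for - d / c against p / q, |s| for
    the centre, \<epsilon> for the radius, 1 for the approximation of u, and 1 is to spare. As c
    \<le> 2 Q q, its radius \<epsilon> / c^2 is at least \<kappa> R / q^2, which fixes
    \<kappa>.\<close>
  define R where "R = 2 + of_int Q + \<bar>s\<bar> + \<epsilon>"
  define \<kappa> where "\<kappa> = \<epsilon> / (4 * (of_int Q)\<^sup>2 * R)"
  have Qpos: "real_of_int Q > 0" using PQ by simp
  have R: "R > 0" using Qpos \<epsilon> by (simp add: R_def add_pos_nonneg)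
  have \<kappa>: "\<kappa> > 0" using \<epsilon> R Qpos by (simp add: \<kappa>_def)
  \<comment> \<open>A rational number has only finitely many approximations p / q in lowest terms
    with error below 1 / q^2. The rationals are set aside here and restored at the end as a null
    set.\<close>
  define S where "S = - {u. horocycle_near r s \<epsilon> K u} - \<rat>"
  have "countable (\<rat> :: real set)" by (rule countable_rat)
  then have negQ: "negligible (\<rat> :: real set)" by (simp add: negligible_iff_null_sets countable_imp_null_set_lborel null_sets_completionI)
  have S: "S \<in> sets lebesgue"
  proof -
    have "- {u. horocycle_near r s \<epsilon> K u} \<in> sets borel" using open_horocycle_near by (simp add: borel_comp)
    moreover have "(\<rat> :: real set) \<in> sets borel" by (rule sets.countable) (auto intro: countable_rat)
    ultimately have "S \<in> sets borel" unfolding S_def by (rule sets.Diff)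
    then show ?thesis by (simp add: sets_completionI_sets)
  qed
  have "negligible S"
  proof (rule negligible_if_porous[OF S \<kappa>])
    fix u \<delta> :: real assume u: "u \<in> S" and \<delta>: "\<delta> > 0"
    then have irr: "u \<notin> \<rat>" by (simp add: S_def)
    obtain p q :: int where pq: "coprime p q" "q > 0" "of_int q > max (real K) (R / \<delta>)" "\<bar>u - of_int p / of_int q\<bar> < 1 / (of_int q)\<^sup>2"
      using irrational_approximation[OF irr] by blast
    have "coprime (- p) q" using pq by simp
    then obtain x' C where x'C: "- p * C - x' * q = 1" "1 \<le> C" "C \<le> q"
      using bezout_bounded pq(2) by blast
    define A where "A = - x'"
    have AC: "A * q - p * C = 1" using x'C by (simp add: A_def)
    \<comment> \<open>The entries of the matrix product; both factors have determinant -1.\<close>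
    define a where "a = P' * q + P * C"
    define b where "b = - P' * p - P * A"
    define c where "c = Q' * q + Q * C"
    define d where "d = - Q' * p - Q * A"
    have det: "a * d - b * c = 1"
    proof -
      have "a * d - b * c = (P * Q' - P' * Q) * (A * q - p * C)"
        by (simp add: a_def b_def c_def d_def algebra_simps)
      then show ?thesis by (simp add: Q' AC)
    qed
    have cq: "q \<le> c" "c \<le> 2 * Q * q"
    proof -
      have "1 * q \<le> Q' * q" using Q' pq by (intro mult_right_mono) auto
      moreover have "0 \<le> Q * C" using PQ x'C by simp
      ultimately show "q \<le> c" by (simp add: c_def)
      have "Q' * q \<le> Q * q" using Q' pq by (intro mult_right_mono) auto
      moreover have "Q * C \<le> Q * q" using x'C PQ by (intro mult_left_mono) auto
      ultimately show "c \<le> 2 * Q * q" by (simp add: c_def)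
    qed
    have rq: "real_of_int q > 0" "real_of_int q \<ge> 1" using pq by simp_all
    have rc: "real_of_int c \<ge> of_int q" "real_of_int c \<le> 2 * of_int Q * of_int q"
    proof -
      show "real_of_int c \<ge> of_int q" using cq(1) by simp
      have "real_of_int c \<le> of_int (2 * Q * q)" using cq(2) by (simp only: of_int_le_iff)
      then show "real_of_int c \<le> 2 * of_int Q * of_int q" by simp
    qed
    have rc0: "real_of_int c > 0" using rc rq by linarith
    have cK: "c > int K" using pq(3) rc by linarith
    have ar: "\<bar>of_int a / of_int c - r\<bar> < \<epsilon>"
    proof -
      have e: "of_int a * of_int Q - of_int P * of_int c = real_of_int (- q)"
      proof -
        have "a * Q - P * c = - q * (P * Q' - P' * Q)" by (simp add: a_def c_def algebra_simps)
        then have "a * Q - P * c = - q" by (simp add: Q')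
        then show ?thesis by (metis of_int_diff of_int_mult)
      qed
      have "of_int a / of_int c - of_int P / of_int Q = - (of_int q / (real_of_int c * of_int Q))"
      proof -
        have "of_int a / of_int c - of_int P / of_int Q = (of_int a * of_int Q - of_int P * of_int c) / (real_of_int c * of_int Q)"
          using rc0 Qpos by (simp add: field_simps)
        then show ?thesis unfolding e by simp
      qed
      moreover have "\<bar>of_int q / (real_of_int c * of_int Q)\<bar> < \<epsilon> / 2"
      proof -
        have "of_int q / (real_of_int c * of_int Q) \<le> of_int c / (real_of_int c * of_int Q)"
          using rc rc0 Qpos by (intro divide_right_mono) auto
        also have "\<dots> = 1 / of_int Q" using rc0 by simp
        also have "\<dots> < \<epsilon> / 2" using PQ(3) Qpos \<epsilon> by (simp add: field_simps)
        finally show ?thesis using rq rc0 Qpos by simp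
      qed
      ultimately show ?thesis using PQ(4) by linarith
    qed
    define \<rho> where "\<rho> = R / (of_int q)\<^sup>2"
    \<comment> \<open>The solution of c (c t + d) = s; the map z -> c (c z + d) has slope c^2, which
      gives the radius.\<close>
    define t where "t = - of_int d / of_int c + s / (of_int c)\<^sup>2"
    define r' where "r' = \<epsilon> / (of_int c)\<^sup>2"
    have \<rho>: "0 < \<rho>" "\<rho> < \<delta>"
    proof -
      show "0 < \<rho>" using R rq by (simp add: \<rho>_def)
      have "R < \<delta> * of_int q" using pq(3) \<delta> by (simp add: field_simps)
      also have "\<dots> \<le> \<delta> * (of_int q)\<^sup>2" using rq \<delta> by (intro mult_left_mono) (auto simp: power2_eq_square)
      finally show "\<rho> < \<delta>" using rq by (simp add: \<rho>_def divide_less_eq)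
    qed
    have "\<kappa> * \<rho> \<le> r'"
    proof -
      have "\<kappa> * \<rho> = \<epsilon> / (2 * of_int Q * of_int q)\<^sup>2"
        using R rq Qpos by (simp add: \<kappa>_def \<rho>_def power_mult_distrib)
      also have "\<dots> \<le> r'" unfolding r'_def
        using rc rc0 \<epsilon> pq(2) PQ(2) by (intro divide_left_mono power_mono) (auto intro!: mult_pos_pos zero_less_power)
      finally show ?thesis .
    qed
    moreover have "ball t r' \<subseteq> ball u \<rho> - S"
    proof
      fix z assume z: "z \<in> ball t r'"
      then have zt: "\<bar>z - t\<bar> < \<epsilon> / (of_int c)\<^sup>2" by (simp add: r'_def dist_real_def abs_minus_commute)
      have "of_int c * (of_int c * z + of_int d) - s = (of_int c)\<^sup>2 * (z - t)"
        using rc0 by (simp add: t_def field_simps power2_eq_square)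
      moreover have "\<bar>(of_int c)\<^sup>2 * (z - t)\<bar> < \<epsilon>"
      proof -
        have "(of_int c)\<^sup>2 * \<bar>z - t\<bar> < (of_int c)\<^sup>2 * (\<epsilon> / (of_int c)\<^sup>2)"
          using zt rc0 by (intro mult_strict_left_mono) auto
        then show ?thesis using rc0 by (simp add: abs_mult)
      qed
      ultimately have "horocycle_near r s \<epsilon> K z"
        unfolding horocycle_near_def using det cK ar by metis
      then have "z \<notin> S" by (simp add: S_def)
      have c2: "1 / (real_of_int c)\<^sup>2 \<le> 1 / (of_int q)\<^sup>2"
        using rc rq by (intro divide_left_mono power_mono mult_pos_pos zero_less_power) auto
      have "\<bar>- of_int d / of_int c - of_int p / of_int q\<bar> \<le> of_int Q / (real_of_int q)\<^sup>2"
      proof -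
        have "d * q + p * c = - Q * (A * q - p * C)" by (simp add: d_def c_def algebra_simps)
        then have "d * q + p * c = - Q" by (simp add: AC)
        then have "of_int d * of_int q + of_int p * of_int c = - real_of_int Q"
          by (metis of_int_add of_int_minus of_int_mult)
        then have e: "- of_int d / of_int c - of_int p / of_int q = of_int Q / (real_of_int c * of_int q)"
          using rc0 rq by (simp add: field_simps)
        have "\<bar>- of_int d / of_int c - of_int p / of_int q\<bar> = of_int Q / (real_of_int c * of_int q)"
          unfolding e using rc0 rq Qpos by simp
        also have "\<dots> \<le> of_int Q / (of_int q * of_int q)"
          using rc rc0 rq Qpos by (intro divide_left_mono mult_right_mono mult_pos_pos) auto
        finally show ?thesis by (simp add: power2_eq_square)
      qed
      moreover have "\<bar>s / (of_int c)\<^sup>2\<bar> \<le> \<bar>s\<bar> / (of_int q)\<^sup>2"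
        using mult_left_mono[OF c2, of "\<bar>s\<bar>"] by (simp add: abs_mult)
      moreover have "\<epsilon> / (of_int c)\<^sup>2 \<le> \<epsilon> / (of_int q)\<^sup>2"
        using mult_left_mono[OF c2, of \<epsilon>] \<epsilon> by simp
      ultimately have "\<bar>z - u\<bar> < of_int Q / (of_int q)\<^sup>2 + \<bar>s\<bar> / (of_int q)\<^sup>2 + \<epsilon> / (of_int q)\<^sup>2 + 1 / (of_int q)\<^sup>2"
        using zt pq(4) unfolding t_def by linarith
      also have "\<dots> = (R - 1) / (of_int q)\<^sup>2" by (simp add: R_def add_divide_distrib diff_divide_distrib)
      also have "\<dots> \<le> \<rho>" unfolding \<rho>_def by (intro divide_right_mono) auto
      finally show "z \<in> ball u \<rho> - S" using \<open>z \<notin> S\<close> by (simp add: dist_real_def abs_minus_commute)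
    qed
    ultimately show "\<exists>\<rho> t r. 0 < \<rho> \<and> \<rho> < \<delta> \<and> \<kappa> * \<rho> \<le> r \<and> ball t r \<subseteq> ball u \<rho> - S"
      using \<rho> by blast
  qed
  then have "negligible (S \<union> \<rat>)" using negQ by (rule negligible_Un)
  then show ?thesis by (rule negligible_subset) (auto simp: S_def)
qed

lemma horocycle_near_mono:
  assumes "horocycle_near r' s' (\<epsilon> / 2) K u" "\<bar>r' - r\<bar> < \<epsilon> / 2" "\<bar>s' - s\<bar> < \<epsilon> / 2"
  shows "horocycle_near r s \<epsilon> K u"
proof -
  obtain a b c d :: int where *: "a * d - b * c = 1" "c > int K"
     "\<bar>of_int a / of_int c - r'\<bar> < \<epsilon> / 2" "\<bar>of_int c * (of_int c * u + of_int d) - s'\<bar> < \<epsilon> / 2"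
    using assms(1) by (auto simp: horocycle_near_def)
  have "\<bar>of_int a / of_int c - r\<bar> < \<epsilon>" "\<bar>of_int c * (of_int c * u + of_int d) - s\<bar> < \<epsilon>"
    using *(3,4) assms(2,3) by linarith+
  then show ?thesis unfolding horocycle_near_def using *(1,2) by blast
qed

text \<open>One null set for all parameters: rational r and s with tolerances 1 / (n + 1) form a
  countable family, and other parameters are reached by approximation.\<close>

lemma horocycle_dense_ae:
  obtains E :: "real set" where "negligible E"
    "\<And>u r s \<epsilon> K. u \<notin> E \<Longrightarrow> \<epsilon> > 0 \<Longrightarrow> horocycle_near r s \<epsilon> K u"
proof -
  define I where "I = (\<rat> :: real set) \<times> (\<rat> :: real set) \<times> (UNIV :: (nat \<times> nat) set)"
  define E where "E = (\<Union>(r, s, n, K)\<in>I. {u. \<not> horocycle_near r s (1 / (real n + 1)) K u})"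
  have "countable I" unfolding I_def by (intro countable_SIGMA countable_rat) auto
  then have "negligible E"
    unfolding E_def by (intro negligible_countable_Union countable_image) (auto intro: horocycle_near_ae)
  moreover have "horocycle_near r s \<epsilon> K u" if u: "u \<notin> E" and \<epsilon>: "\<epsilon> > 0" for u r s \<epsilon> K
  proof -
    obtain n :: nat where n: "1 / (real n + 1) < \<epsilon> / 2"
      using reals_Archimedean[of "\<epsilon> / 2"] \<epsilon> by (auto simp: inverse_eq_divide add.commute)
    define \<epsilon>' where "\<epsilon>' = 2 * (1 / (real n + 1))"
    have \<epsilon>': "\<epsilon>' > 0" "\<epsilon>' \<le> \<epsilon>" using n by (auto simp: \<epsilon>'_def)
    obtain r' where r': "r' \<in> \<rat>" "r < r'" "r' < r + \<epsilon>' / 2" using Rats_dense_in_real[of r "r + \<epsilon>' / 2"] \<epsilon>' by auto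
    obtain s' where s': "s' \<in> \<rat>" "s < s'" "s' < s + \<epsilon>' / 2" using Rats_dense_in_real[of s "s + \<epsilon>' / 2"] \<epsilon>' by auto
    have "horocycle_near r' s' (\<epsilon>' / 2) K u"
    proof -
      have e: "\<epsilon>' / 2 = 1 / (real n + 1)" unfolding \<epsilon>'_def by (rule nonzero_mult_div_cancel_left) simp
      show ?thesis unfolding e using u r'(1) s'(1) by (auto simp: E_def I_def)
    qed
    then have "horocycle_near r s \<epsilon>' K u"
      by (rule horocycle_near_mono) (use r' s' in auto)
    then show ?thesis
      using \<epsilon>'(2) unfolding horocycle_near_def by (meson order_less_le_trans)
  qed
  ultimately show ?thesis by (rule that)
qed

section \<open>Limit laws\<close>

lemma real_det_scaled:
  fixes a b c d :: int
  assumes "a * d - b * c = 1" "M \<ge> 1"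
  shows "of_int a / real M * ((of_int c * u + of_int d) * real M) - (of_int a * u + of_int b) * real M * (of_int c / real M) = 1"
proof -
  have "of_int a / real M * ((of_int c * u + of_int d) * real M) - (of_int a * u + of_int b) * real M * (of_int c / real M) = real_of_int (a * d - b * c)"
    using assms(2) by (simp add: field_simps)
  then show ?thesis by (simp add: assms(1) del: of_int_diff of_int_mult)
qed

lemma rho_converges:
  fixes a b c d :: "nat \<Rightarrow> int" and k l :: int
  assumes l: "l \<noteq> 0" and M: "\<And>j. M j \<ge> 1" and det: "\<And>j. a j * d j - b j * c j = 1" and c: "\<And>j. c j \<noteq> 0"
    and A: "(\<lambda>j. of_int (a j) / of_nat (M j)) \<longlonglongrightarrow> A0" and C: "(\<lambda>j. of_int (c j) / of_nat (M j)) \<longlonglongrightarrow> C0"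
    and D: "(\<lambda>j. (of_int (c j) * (of_int l * \<alpha>) + of_int (d j)) * of_nat (M j)) \<longlonglongrightarrow> D0" and C0: "C0 \<noteq> 0"
  shows "weak_conv_complex (\<lambda>j. rho k l (M j) \<alpha>) (kernel_law A0 ((A0 * D0 - 1) / C0) C0 D0)"
proof -
  have "weak_conv_complex (\<lambda>j. kernel_law (of_int (a j) / of_nat (M j)) ((of_int (a j) * (of_int l * \<alpha>) + of_int (b j)) * of_nat (M j))
     (of_int (c j) / of_nat (M j)) ((of_int (c j) * (of_int l * \<alpha>) + of_int (d j)) * of_nat (M j))) (kernel_law A0 ((A0 * D0 - 1) / C0) C0 D0)"
    by (rule kernel_law_continuous[OF _ _ C0 A C D]) (rule real_det_scaled[OF det M], use C0 in simp)
  note conv = this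
  show ?thesis
    unfolding weak_conv_complex_def
  proof (intro allI impI)
    fix F :: "complex \<Rightarrow> real" assume F: "continuous_on UNIV F \<and> bounded (range F)"
    have eq: "(\<integral>z. F z \<partial>rho k l (M j) \<alpha>) = (\<integral>z. F z \<partial>kernel_law (of_int (a j) / of_nat (M j)) ((of_int (a j) * (of_int l * \<alpha>) + of_int (b j)) * of_nat (M j))
     (of_int (c j) / of_nat (M j)) ((of_int (c j) * (of_int l * \<alpha>) + of_int (d j)) * of_nat (M j)))" for j
      by (rule integral_rho_eq_kernel_law[OF conjunct1[OF F] conjunct2[OF F] l M det c])
    show "(\<lambda>j. \<integral>z. F z \<partial>rho k l (M j) \<alpha>) \<longlonglongrightarrow> (\<integral>z. F z \<partial>kernel_law A0 ((A0 * D0 - 1) / C0) C0 D0)"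
      unfolding eq using conv F by (simp only: weak_conv_complex_def)
  qed
qed

lemma rho_converges_cusp:
  fixes a b c d :: "nat \<Rightarrow> int" and k l :: int
  assumes l: "l \<noteq> 0" and M: "\<And>j. M j \<ge> 1" and det: "\<And>j. a j * d j - b j * c j = 1" and c: "\<And>j. c j \<noteq> 0"
    and C: "(\<lambda>j. of_int (c j) / real (M j)) \<longlonglongrightarrow> 0"
    and D: "(\<lambda>j. (of_int (c j) * (of_int l * \<alpha>) + of_int (d j)) * of_nat (M j)) \<longlonglongrightarrow> 0"
  shows "weak_conv_complex (\<lambda>j. rho k l (M j) \<alpha>) (return borel 0)"
proof -
  have cM: "of_int (c j) / real (M j) \<noteq> 0" for j using c[of j] M[of j] by simp
  have "weak_conv_complex (\<lambda>j. kernel_law (of_int (a j) / of_nat (M j)) ((of_int (a j) * (of_int l * \<alpha>) + of_int (b j)) * of_nat (M j))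
     (of_int (c j) / of_nat (M j)) ((of_int (c j) * (of_int l * \<alpha>) + of_int (d j)) * of_nat (M j))) (return borel 0)"
    by (rule kernel_law_cusp[OF _ cM C D]) (rule real_det_scaled[OF det M])
  note conv = this
  show ?thesis
    unfolding weak_conv_complex_def
  proof (intro allI impI)
    fix F :: "complex \<Rightarrow> real" assume F: "continuous_on UNIV F \<and> bounded (range F)"
    have eq: "(\<integral>z. F z \<partial>rho k l (M j) \<alpha>) = (\<integral>z. F z \<partial>kernel_law (of_int (a j) / of_nat (M j)) ((of_int (a j) * (of_int l * \<alpha>) + of_int (b j)) * of_nat (M j))
     (of_int (c j) / of_nat (M j)) ((of_int (c j) * (of_int l * \<alpha>) + of_int (d j)) * of_nat (M j)))" for j
      by (rule integral_rho_eq_kernel_law[OF conjunct1[OF F] conjunct2[OF F] l M det c])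
    show "(\<lambda>j. \<integral>z. F z \<partial>rho k l (M j) \<alpha>) \<longlonglongrightarrow> (\<integral>z. F z \<partial>return borel 0)"
      unfolding eq using conv F by (simp only: weak_conv_complex_def)
  qed
qed

text \<open>Dirichlet's theorem bounds only the lower row (C, D). The upper row is free up to
  integral multiples t of the lower one, and t is used to bound what remains. A nonzero limit of C
  gives a matrix limit by continuity, and a vanishing limit of both gives the cusp. If only C tends
  to 0, the rows are exchanged up to sign: the new lower left entry tends to 1 / D0, and continuity
  away from c = 0 applies again.\<close>

lemma rho_convergent_subsequence:
  fixes k l :: int and N :: "nat \<Rightarrow> nat"
  assumes l: "l \<noteq> 0" and N: "\<And>i. N i \<ge> 1"
  obtains r \<nu> where "strict_mono r" "\<nu> \<in> limit_family" "weak_conv_complex (\<lambda>i. rho k l (N (r i)) \<alpha>) \<nu>"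
proof -
  define u where "u = of_int l * \<alpha>"
  have "\<exists>a b c d :: int. a * d - b * c = 1 \<and> 0 < c \<and> c \<le> int (N i) \<and> \<bar>of_int c * u + of_int d\<bar> < 1 / real (N i)" for i
  proof -
    obtain h c :: int where hc: "coprime h c" "0 < c" "c \<le> int (N i)" "\<bar>of_int c * u - of_int h\<bar> < 1 / real (N i)"
      using Dirichlet_approx_coprime[of "N i" u] N[of i] by auto
    obtain s t where "s * (- h) + t * c = 1" using bezout_int[of "- h" c] hc(1) by auto
    then have "s * (- h) - (- t) * c = 1" by simp
    then show ?thesis using hc by (intro exI[of _ s] exI[of _ "- t"] exI[of _ c] exI[of _ "- h"]) simp
  qed
  then obtain a b c d :: "nat \<Rightarrow> int" where det: "\<And>i. a i * d i - b i * c i = 1" and c: "\<And>i. 0 < c i" "\<And>i. c i \<le> int (N i)"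
    and small: "\<And>i. \<bar>of_int (c i) * u + of_int (d i)\<bar> < 1 / real (N i)"
    by metis
  define C where "C = (\<lambda>i. of_int (c i) / real (N i))"
  define D where "D = (\<lambda>i. (of_int (c i) * u + of_int (d i)) * real (N i))"
  have Npos: "real (N i) > 0" for i using N[of i] by simp
  have bdd: "(C i, D i) \<in> cbox (0, - 1) (1, 1)" for i
  proof -
    have "real_of_int (c i) \<le> real (N i)" using c(2)[of i] by linarith
    then have "0 \<le> C i" "C i \<le> 1" using c(1)[of i] Npos[of i] by (simp_all add: C_def)
    moreover have "\<bar>D i\<bar> \<le> 1"
    proof -
      have "\<bar>D i\<bar> = \<bar>of_int (c i) * u + of_int (d i)\<bar> * real (N i)" by (simp add: D_def abs_mult)
      also have "\<dots> \<le> 1 / real (N i) * real (N i)" using small[of i] by (intro mult_right_mono) auto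
      also have "\<dots> = 1" using Npos[of i] by simp
      finally show ?thesis .
    qed
    ultimately show ?thesis by (auto simp: cbox_Pair_eq abs_le_iff)
  qed
  have sc: "seq_compact (cbox (0, - 1) (1, 1) :: (real \<times> real) set)"
    by (rule compact_imp_seq_compact[OF compact_cbox])
  obtain L r where r: "strict_mono r" and L: "((\<lambda>i. (C i, D i)) \<circ> r) \<longlonglongrightarrow> L"
    using seq_compactE[OF sc, of "\<lambda>i. (C i, D i)"] bdd by metis
  define C0 where "C0 = fst L"
  define D0 where "D0 = snd L"
  have Clim: "(\<lambda>i. C (r i)) \<longlonglongrightarrow> C0" and Dlim: "(\<lambda>i. D (r i)) \<longlonglongrightarrow> D0"
    using tendsto_fst[OF L] tendsto_snd[OF L] by (simp_all add: o_def C0_def D0_def)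
  have unit: "seq_compact {0..1::real}" by (rule compact_imp_seq_compact) simp
  consider "C0 \<noteq> 0" | "C0 = 0" "D0 = 0" | "C0 = 0" "D0 \<noteq> 0" by blast
  then show ?thesis
  proof cases
    case 1
    \<comment> \<open>Adding t times the lower row brings a / c into [0, 1).\<close>
    define t where "t = (\<lambda>i. - \<lfloor>of_int (a i) / real_of_int (c i)\<rfloor>)"
    define f where "f = (\<lambda>i. frac (of_int (a i) / real_of_int (c i)))"
    have "f i \<in> {0..1}" for i using frac_lt_1[of "of_int (a i) / real_of_int (c i)"] by (auto simp: f_def)
    then obtain f0 r2 where r2: "strict_mono r2" and f0: "((\<lambda>i. f (r i)) \<circ> r2) \<longlonglongrightarrow> f0"
      using seq_compactE[OF unit, of "\<lambda>i. f (r i)"] by metis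
    let ?R = "\<lambda>i. r (r2 i)"
    have A: "of_int (a i + t i * c i) / real (N i) = f i * C i" for i
    proof -
      have "of_int (a i + t i * c i) = f i * of_int (c i)"
        using c(1)[of i] by (simp add: f_def t_def frac_def left_diff_distrib)
      then show ?thesis by (simp only: C_def times_divide_eq_right)
    qed
    have "weak_conv_complex (\<lambda>j. rho k l (N (?R j)) \<alpha>) (kernel_law (f0 * C0) ((f0 * C0 * D0 - 1) / C0) C0 D0)"
    proof (rule rho_converges[OF l N, where a = "\<lambda>j. a (?R j) + t (?R j) * c (?R j)" and b = "\<lambda>j. b (?R j) + t (?R j) * d (?R j)"
          and c = "\<lambda>j. c (?R j)" and d = "\<lambda>j. d (?R j)"])
      show "(a (?R j) + t (?R j) * c (?R j)) * d (?R j) - (b (?R j) + t (?R j) * d (?R j)) * c (?R j) = 1" for j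
        using det[of "?R j"] by (simp add: algebra_simps)
      show "c (?R j) \<noteq> 0" for j using c(1)[of "?R j"] by simp
      have C': "(\<lambda>j. C (?R j)) \<longlonglongrightarrow> C0" using LIMSEQ_subseq_LIMSEQ[OF Clim r2] by (simp add: o_def)
      then show "(\<lambda>j. of_int (c (?R j)) / real (N (?R j))) \<longlonglongrightarrow> C0" by (simp add: C_def)
      show "(\<lambda>j. (of_int (c (?R j)) * (of_int l * \<alpha>) + of_int (d (?R j))) * real (N (?R j))) \<longlonglongrightarrow> D0"
        using LIMSEQ_subseq_LIMSEQ[OF Dlim r2] by (simp add: o_def D_def u_def)
      show "(\<lambda>j. of_int (a (?R j) + t (?R j) * c (?R j)) / real (N (?R j))) \<longlonglongrightarrow> f0 * C0"
        unfolding A using tendsto_mult[OF f0 C'] by (simp add: o_def)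
    qed (rule 1)
    moreover have "kernel_law (f0 * C0) ((f0 * C0 * D0 - 1) / C0) C0 D0 \<in> limit_family"
      by (rule kernel_law_in_limit_family) (use 1 in simp)
    moreover have "strict_mono ?R" using strict_mono_o[OF r r2] by (simp add: o_def)
    ultimately show ?thesis using that by blast
  next
    case 2
    have "weak_conv_complex (\<lambda>j. rho k l (N (r j)) \<alpha>) (return borel 0)"
    proof (rule rho_converges_cusp[OF l N, where a = "\<lambda>j. a (r j)" and b = "\<lambda>j. b (r j)" and c = "\<lambda>j. c (r j)" and d = "\<lambda>j. d (r j)"])
      show "c (r j) \<noteq> 0" for j using c(1)[of "r j"] by simp
      show "(\<lambda>j. of_int (c (r j)) / real (N (r j))) \<longlonglongrightarrow> 0" using Clim 2 by (simp add: C_def)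
      show "(\<lambda>j. (of_int (c (r j)) * (of_int l * \<alpha>) + of_int (d (r j))) * real (N (r j))) \<longlonglongrightarrow> 0"
        using Dlim 2 by (simp add: D_def u_def)
    qed (rule det)
    moreover have "return borel 0 \<in> limit_family" by (simp add: limit_family_def)
    ultimately show ?thesis using that r by blast
  next
    case 3
    define B where "B = (\<lambda>i. (of_int (a i) * u + of_int (b i)) * real (N i))"
    \<comment> \<open>Here C tends to 0, so the second column is normalised instead, and the
      determinant recovers the first entry as (1 + B C) / D with the new B. Indices with D = 0,
      where the quotient is 0 by convention, are eventually absent.\<close>
    define t where "t = (\<lambda>i. - \<lfloor>B i / D i\<rfloor>)"
    define f where "f = (\<lambda>i. frac (B i / D i))"
    have "f i \<in> {0..1}" for i using frac_lt_1[of "B i / D i"] by (auto simp: f_def)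
    then obtain f0 r2 where r2: "strict_mono r2" and f0: "((\<lambda>i. f (r i)) \<circ> r2) \<longlonglongrightarrow> f0"
      using seq_compactE[OF unit, of "\<lambda>i. f (r i)"] by metis
    have C': "(\<lambda>i. C (r (r2 i))) \<longlonglongrightarrow> 0" and D': "(\<lambda>i. D (r (r2 i))) \<longlonglongrightarrow> D0"
      using LIMSEQ_subseq_LIMSEQ[OF Clim r2] LIMSEQ_subseq_LIMSEQ[OF Dlim r2] 3 by (simp_all add: o_def)
    have Bf: "(of_int (a i + t i * c i) * u + of_int (b i + t i * d i)) * real (N i) = f i * D i" if "D i \<noteq> 0" for i
    proof -
      have "(of_int (a i + t i * c i) * u + of_int (b i + t i * d i)) * real (N i) = B i + of_int (t i) * D i"
        by (simp add: B_def D_def algebra_simps)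
      also have "\<dots> = f i * D i" using that by (simp add: f_def t_def frac_def left_diff_distrib)
      finally show ?thesis .
    qed
    have Af: "of_int (a i + t i * c i) / real (N i) = (1 + f i * D i * C i) / D i" if Di: "D i \<noteq> 0" for i
    proof -
      have "(a i + t i * c i) * d i - (b i + t i * d i) * c i = 1" using det[of i] by (simp add: algebra_simps)
      from real_det_scaled[OF this N, of i u]
      have "of_int (a i + t i * c i) / real (N i) * D i - f i * D i * C i = 1"
        unfolding Bf[OF Di] C_def[symmetric] D_def[symmetric] by (simp add: D_def C_def)
      then show ?thesis using Di by (simp add: field_simps)
    qed
    have evD: "\<forall>\<^sub>F i in sequentially. D (r (r2 i)) \<noteq> 0" by (rule tendsto_imp_eventually_ne[OF D']) (use 3 in simp)
    have flim: "(\<lambda>i. f (r (r2 i))) \<longlonglongrightarrow> f0" using f0 by (simp add: o_def)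
    have "(\<lambda>i. (1 + f (r (r2 i)) * D (r (r2 i)) * C (r (r2 i))) / D (r (r2 i))) \<longlonglongrightarrow> (1 + f0 * D0 * 0) / D0"
      by (intro tendsto_intros flim C' D') (use 3 in simp)
    then have "(\<lambda>i. (1 + f (r (r2 i)) * D (r (r2 i)) * C (r (r2 i))) / D (r (r2 i))) \<longlonglongrightarrow> 1 / D0" by simp
    then have Alim: "(\<lambda>i. of_int (a (r (r2 i)) + t (r (r2 i)) * c (r (r2 i))) / real (N (r (r2 i)))) \<longlonglongrightarrow> 1 / D0"
      by (rule Lim_transform_eventually) (rule eventually_mono[OF evD], rule Af[symmetric])
    have "(\<lambda>i. f (r (r2 i)) * D (r (r2 i))) \<longlonglongrightarrow> f0 * D0" by (intro tendsto_intros flim D')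
    then have Blim: "(\<lambda>i. (of_int (a (r (r2 i)) + t (r (r2 i)) * c (r (r2 i))) * u + of_int (b (r (r2 i)) + t (r (r2 i)) * d (r (r2 i)))) * real (N (r (r2 i)))) \<longlonglongrightarrow> f0 * D0"
      by (rule Lim_transform_eventually) (rule eventually_mono[OF evD], rule Bf[symmetric])
    have "\<forall>\<^sub>F i in sequentially. of_int (a (r (r2 i)) + t (r (r2 i)) * c (r (r2 i))) / real (N (r (r2 i))) \<noteq> 0"
      by (rule tendsto_imp_eventually_ne[OF Alim]) (use 3 in simp)
    then obtain m where m: "\<And>i. i \<ge> m \<Longrightarrow> of_int (a (r (r2 i)) + t (r (r2 i)) * c (r (r2 i))) / real (N (r (r2 i))) \<noteq> 0"
      unfolding eventually_sequentially by blast
    \<comment> \<open>Dropping m terms makes the new lower left entry nonzero throughout, as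
      invariance requires.\<close>
    let ?R = "\<lambda>i. r (r2 (i + m))"
    have "weak_conv_complex (\<lambda>j. rho k l (N (?R j)) \<alpha>) (kernel_law (- 0) ((- 0 * (f0 * D0) - 1) / (1 / D0)) (1 / D0) (f0 * D0))"
    proof (rule rho_converges[OF l N, where a = "\<lambda>j. - c (?R j)" and b = "\<lambda>j. - d (?R j)"
          and c = "\<lambda>j. a (?R j) + t (?R j) * c (?R j)" and d = "\<lambda>j. b (?R j) + t (?R j) * d (?R j)"])
      show "- c (?R j) * (b (?R j) + t (?R j) * d (?R j)) - - d (?R j) * (a (?R j) + t (?R j) * c (?R j)) = 1" for j
        using det[of "?R j"] by (simp add: algebra_simps)
      show "a (?R j) + t (?R j) * c (?R j) \<noteq> 0" for j
      proof
        assume "a (?R j) + t (?R j) * c (?R j) = 0"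
        then have "of_int (a (?R j) + t (?R j) * c (?R j)) / real (N (?R j)) = 0" by (simp only: of_int_0 div_0)
        with m[OF le_add2, of j] show False by blast
      qed
      show "(\<lambda>j. of_int (- c (?R j)) / real (N (?R j))) \<longlonglongrightarrow> - 0"
        using tendsto_minus[OF LIMSEQ_ignore_initial_segment[OF C', of m]] by (simp add: C_def)
      show "(\<lambda>j. of_int (a (?R j) + t (?R j) * c (?R j)) / real (N (?R j))) \<longlonglongrightarrow> 1 / D0"
        by (rule LIMSEQ_ignore_initial_segment[OF Alim])
      show "(\<lambda>j. (of_int (a (?R j) + t (?R j) * c (?R j)) * (of_int l * \<alpha>) + of_int (b (?R j) + t (?R j) * d (?R j))) * real (N (?R j))) \<longlonglongrightarrow> f0 * D0"
        using LIMSEQ_ignore_initial_segment[OF Blim, of m] by (simp only: u_def)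
      show "1 / D0 \<noteq> 0" using 3 by simp
    qed
    moreover have "kernel_law (- 0) ((- 0 * (f0 * D0) - 1) / (1 / D0)) (1 / D0) (f0 * D0) \<in> limit_family"
      by (rule kernel_law_in_limit_family) (use 3 in simp)
    moreover have "strict_mono ?R"
      using r r2 by (auto simp: strict_mono_def)
    ultimately show ?thesis using that by blast
  qed
qed

text \<open>The subsequential limit has the same integrals as the given limit, so the full sequence
  converges to it as well.\<close>

lemma weakly_convergent_rho:
  fixes k l :: int and N :: "nat \<Rightarrow> nat"
  assumes l: "l \<noteq> 0" and N: "\<And>i. N i \<ge> 1" and conv: "weakly_convergent_complex (\<lambda>i. rho k l (N i) \<alpha>)"
  shows "\<exists>\<nu>\<in>limit_family. weak_conv_complex (\<lambda>i. rho k l (N i) \<alpha>) \<nu>"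
proof -
  obtain \<mu> where \<mu>: "weak_conv_complex (\<lambda>i. rho k l (N i) \<alpha>) \<mu>"
    using conv by (auto simp: weakly_convergent_complex_def)
  obtain r \<nu> where r: "strict_mono r" and \<nu>: "\<nu> \<in> limit_family" "weak_conv_complex (\<lambda>i. rho k l (N (r i)) \<alpha>) \<nu>"
    by (rule rho_convergent_subsequence[OF l N])
  have "weak_conv_complex (\<lambda>i. rho k l (N i) \<alpha>) \<nu>"
    unfolding weak_conv_complex_def
  proof (intro allI impI)
    fix F :: "complex \<Rightarrow> real" assume F: "continuous_on UNIV F \<and> bounded (range F)"
    have 1: "(\<lambda>i. \<integral>z. F z \<partial>rho k l (N i) \<alpha>) \<longlonglongrightarrow> (\<integral>z. F z \<partial>\<mu>)" using \<mu> F by (simp add: weak_conv_complex_def)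
    have 2: "(\<lambda>i. \<integral>z. F z \<partial>rho k l (N (r i)) \<alpha>) \<longlonglongrightarrow> (\<integral>z. F z \<partial>\<nu>)" using \<nu>(2) F by (simp add: weak_conv_complex_def)
    have "(\<integral>z. F z \<partial>\<mu>) = (\<integral>z. F z \<partial>\<nu>)"
      using LIMSEQ_unique[OF LIMSEQ_subseq_LIMSEQ[OF 1 r]] 2 by (simp add: o_def)
    with 1 show "(\<lambda>i. \<integral>z. F z \<partial>rho k l (N i) \<alpha>) \<longlonglongrightarrow> (\<integral>z. F z \<partial>\<nu>)" by simp
  qed
  with \<nu>(1) show ?thesis by blast
qed

section \<open>Realising every member of the limit family\<close>

lemma tendsto_of_int_inverse:
  assumes "\<And>j. c j > int j"
  shows "(\<lambda>j. 1 / real_of_int (c j)) \<longlonglongrightarrow> 0"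
proof (rule tendsto_sandwich[OF always_eventually always_eventually tendsto_const LIMSEQ_inverse_real_of_nat])
  have cj: "real_of_int (c j) \<ge> real (Suc j)" for j using assms[of j] by linarith
  then have pos: "real_of_int (c j) > 0" for j by (meson less_le_trans of_nat_0_less_iff zero_less_Suc)
  show "\<forall>j. 0 \<le> 1 / real_of_int (c j)" using pos by (simp add: less_imp_le)
  show "\<forall>j. 1 / real_of_int (c j) \<le> inverse (real (Suc j))"
    using cj pos by (auto simp: inverse_eq_divide intro!: divide_left_mono mult_pos_pos)
qed

context
  fixes k l :: int and \<alpha> :: real
  assumes l: "l \<noteq> 0" and near: "\<And>r s \<epsilon> K. \<epsilon> > 0 \<Longrightarrow> horocycle_near r s \<epsilon> K (of_int l * \<alpha>)"
begin

text \<open>With |c (c u + d)| below (j + 1)^-2, the choice N = (j + 1) c makes both entries of the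
  lower row at most 1 / (j + 1) in absolute value.\<close>

lemma rho_reaches_cusp:
  "\<exists>N. strict_mono N \<and> (\<forall>i. 1 \<le> N i) \<and> weak_conv_complex (\<lambda>i. rho k l (N i) \<alpha>) (return borel 0)"
proof -
  let ?u = "of_int l * \<alpha>"
  define P where "P = (\<lambda>j (a, b, c, d). a * d - b * c = 1 \<and> c > int j \<and> \<bar>of_int c * (of_int c * ?u + of_int d)\<bar> < 1 / (real j + 1)\<^sup>2)"
  have ex: "\<exists>a b c d. P j (a, b, c, d) \<and> c > int K" for j K
    using near[of "1 / (real j + 1)\<^sup>2" 0 0 "j + K"] by (force simp: P_def horocycle_near_def)
  \<comment> \<open>Dependent choice makes N strictly increasing: at each step c alone is taken
    larger than the previous N.\<close>
  have "\<exists>x. \<forall>j. P j (x j) \<and> (j + 1) * nat (fst (snd (snd (x j)))) < (Suc j + 1) * nat (fst (snd (snd (x (Suc j)))))"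
  proof (rule dependent_nat_choice)
    show "\<exists>x. P 0 x" using ex by blast
    fix x j assume "P j x"
    obtain a b c d where abcd: "P (Suc j) (a, b, c, d)" "c > int ((j + 1) * nat (fst (snd (snd x))))" using ex by blast
    have "(j + 1) * nat (fst (snd (snd x))) < nat c" using abcd(2) by linarith
    also have "nat c \<le> (Suc j + 1) * nat c" by simp
    finally show "\<exists>y. P (Suc j) y \<and> (j + 1) * nat (fst (snd (snd x))) < (Suc j + 1) * nat (fst (snd (snd y)))"
      using abcd(1) by (intro exI[of _ "(a, b, c, d)"]) simp
  qed
  then obtain x where x: "\<And>j. P j (x j)" "\<And>j. (j + 1) * nat (fst (snd (snd (x j)))) < (Suc j + 1) * nat (fst (snd (snd (x (Suc j)))))"
    by blast
  define a where "a = (\<lambda>j. fst (x j))"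
  define b where "b = (\<lambda>j. fst (snd (x j)))"
  define c where "c = (\<lambda>j. fst (snd (snd (x j))))"
  define d where "d = (\<lambda>j. snd (snd (snd (x j))))"
  define N where "N = (\<lambda>j. (j + 1) * nat (c j))"
  have P: "a j * d j - b j * c j = 1" "c j > int j" "\<bar>of_int (c j) * (of_int (c j) * ?u + of_int (d j))\<bar> < 1 / (real j + 1)\<^sup>2" for j
    using x(1)[of j] by (auto simp: P_def a_def b_def c_def d_def split: prod.splits)
  have mono: "strict_mono N" using x(2) by (simp add: strict_mono_Suc_iff N_def c_def)
  have cpos: "c j > 0" for j using P(2)[of j] by linarith
  have N1: "N j \<ge> 1" for j using cpos[of j] by (simp add: N_def)
  have Nreal: "real (N j) = (real j + 1) * of_int (c j)" for j using cpos[of j] by (simp add: N_def algebra_simps)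
  have inv: "(\<lambda>j. 1 / (real j + 1)) \<longlonglongrightarrow> 0"
    using LIMSEQ_inverse_real_of_nat by (simp add: inverse_eq_divide add.commute)
  have "weak_conv_complex (\<lambda>i. rho k l (N i) \<alpha>) (return borel 0)"
  proof (rule rho_converges_cusp[OF l N1 P(1)])
    show "c j \<noteq> 0" for j using cpos[of j] by simp
    have "of_int (c j) / real (N j) = 1 / (real j + 1)" for j
      using cpos[of j] by (simp add: Nreal)
    then show "(\<lambda>j. of_int (c j) / real (N j)) \<longlonglongrightarrow> 0" using inv by simp
    have "\<bar>(of_int (c j) * ?u + of_int (d j)) * real (N j)\<bar> \<le> 1 / (real j + 1)" for j
    proof -
      have "\<bar>(of_int (c j) * ?u + of_int (d j)) * real (N j)\<bar> = (real j + 1) * \<bar>of_int (c j) * (of_int (c j) * ?u + of_int (d j))\<bar>"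
        unfolding Nreal abs_mult by (simp add: mult_ac)
      also have "\<dots> \<le> (real j + 1) * (1 / (real j + 1)\<^sup>2)" using P(3)[of j] by (intro mult_left_mono) auto
      also have "\<dots> = 1 / (real j + 1)" by (simp add: power2_eq_square)
      finally show ?thesis .
    qed
    then have "\<forall>j. norm ((of_int (c j) * ?u + of_int (d j)) * real (N j)) \<le> 1 / (real j + 1)" by simp
    then show "(\<lambda>j. (of_int (c j) * ?u + of_int (d j)) * real (N j)) \<longlonglongrightarrow> 0"
      by (rule Lim_null_comparison[OF always_eventually inv])
  qed
  then show ?thesis using mono N1 by blast
qed

text \<open>If N is c / |c0| rounded up, then c / N tends to |c0|, a / N to |c0| a0 / c0 and (c u +
  d) N to c0 d0 / |c0|: the target entries up to the sign of c0. Rounding is harmless because c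
  tends to infinity.\<close>

lemma rho_reaches_kernel_law:
  assumes det0: "a0 * d0 - b0 * c0 = 1" and c0: "c0 \<noteq> 0"
  shows "\<exists>N. strict_mono N \<and> (\<forall>i. 1 \<le> N i) \<and> weak_conv_complex (\<lambda>i. rho k l (N i) \<alpha>) (kernel_law a0 b0 c0 d0)"
proof -
  let ?u = "of_int l * \<alpha>"
  define \<kappa> where "\<kappa> = \<bar>c0\<bar>"
  have \<kappa>: "\<kappa> > 0" using c0 by (simp add: \<kappa>_def)
  define r where "r = a0 / c0"
  define s where "s = c0 * d0"
  define n where "n = (\<lambda>c::int. nat \<lceil>of_int c / \<kappa>\<rceil>)"
  define P where "P = (\<lambda>j (a, b, c, d). a * d - b * c = 1 \<and> c > int j \<and> \<bar>of_int a / of_int c - r\<bar> < 1 / (real j + 1)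
      \<and> \<bar>of_int c * (of_int c * ?u + of_int d) - s\<bar> < 1 / (real j + 1))"
  have ex: "\<exists>a b c d. P j (a, b, c, d) \<and> c > int K" for j K
    using near[of "1 / (real j + 1)" r s "j + K"] by (force simp: P_def horocycle_near_def)
  have nbd: "of_int c / \<kappa> \<le> real (n c)" "real (n c) < of_int c / \<kappa> + 1" if "c > 0" for c
  proof -
    have "of_int c / \<kappa> > 0" using that \<kappa> by simp
    then have "\<lceil>of_int c / \<kappa>\<rceil> > 0" by simp
    then have e: "real (n c) = of_int \<lceil>of_int c / \<kappa>\<rceil>" by (simp add: n_def)
    show "of_int c / \<kappa> \<le> real (n c)" "real (n c) < of_int c / \<kappa> + 1" unfolding e by linarith+
  qed
  have "\<exists>x. \<forall>j. P j (x j) \<and> n (fst (snd (snd (x j)))) < n (fst (snd (snd (x (Suc j)))))"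
  proof (rule dependent_nat_choice)
    show "\<exists>x. P 0 x" using ex by blast
    fix x j assume "P j x"
    let ?m = "n (fst (snd (snd x)))"
    \<comment> \<open>Taking c above \<kappa> times the previous N puts c / \<kappa>, hence its
      ceiling, above that N.\<close>
    obtain K :: nat where K: "real K > \<kappa> * real ?m" using reals_Archimedean2 by blast
    obtain a b c d where abcd: "P (Suc j) (a, b, c, d)" "c > int K" using ex by blast
    have "real_of_int c > real K" using abcd(2) by linarith
    then have "real ?m < of_int c / \<kappa>" using K \<kappa> by (simp add: field_simps)
    also have "\<dots> \<le> real (n c)" using abcd(2) by (intro nbd) linarith
    finally show "\<exists>y. P (Suc j) y \<and> ?m < n (fst (snd (snd y)))"
      using abcd(1) by (intro exI[of _ "(a, b, c, d)"]) simp
  qed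
  then obtain x where x: "\<And>j. P j (x j)" "\<And>j. n (fst (snd (snd (x j)))) < n (fst (snd (snd (x (Suc j)))))"
    by blast
  define a where "a = (\<lambda>j. fst (x j))"
  define b where "b = (\<lambda>j. fst (snd (x j)))"
  define c where "c = (\<lambda>j. fst (snd (snd (x j))))"
  define d where "d = (\<lambda>j. snd (snd (snd (x j))))"
  define N where "N = (\<lambda>j. n (c j))"
  have P: "a j * d j - b j * c j = 1" "c j > int j" "\<bar>of_int (a j) / of_int (c j) - r\<bar> < 1 / (real j + 1)"
     "\<bar>of_int (c j) * (of_int (c j) * ?u + of_int (d j)) - s\<bar> < 1 / (real j + 1)" for j
    using x(1)[of j] by (auto simp: P_def a_def b_def c_def d_def split: prod.splits)
  have mono: "strict_mono N" using x(2) by (simp add: strict_mono_Suc_iff N_def c_def)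
  have cpos: "c j > 0" for j using P(2)[of j] by linarith
  have cr: "real_of_int (c j) > 0" for j using cpos[of j] by simp
  have Nbd: "of_int (c j) / \<kappa> \<le> real (N j)" "real (N j) < of_int (c j) / \<kappa> + 1" for j
    unfolding N_def by (rule nbd[OF cpos])+
  have Npos: "real (N j) > 0" for j
    using Nbd(1)[of j] cr[of j] \<kappa> by (smt (verit) divide_pos_pos)
  then have N1: "N j \<ge> 1" for j by (metis Suc_leI One_nat_def of_nat_0_less_iff)
  have inv: "(\<lambda>j. 1 / (real j + 1)) \<longlonglongrightarrow> 0"
    using LIMSEQ_inverse_real_of_nat by (simp add: inverse_eq_divide add.commute)
  have cinv: "(\<lambda>j. 1 / real_of_int (c j)) \<longlonglongrightarrow> 0" by (rule tendsto_of_int_inverse) (rule P(2))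
  have Nc: "(\<lambda>j. real (N j) / of_int (c j)) \<longlonglongrightarrow> 1 / \<kappa>"
  proof (rule tendsto_sandwich[OF always_eventually always_eventually tendsto_const])
    show "\<forall>j. 1 / \<kappa> \<le> real (N j) / of_int (c j)"
      using Nbd(1) cr \<kappa> by (simp add: field_simps)
    show "\<forall>j. real (N j) / of_int (c j) \<le> 1 / \<kappa> + 1 / of_int (c j)"
    proof
      fix j
      have "real (N j) / of_int (c j) \<le> (of_int (c j) / \<kappa> + 1) / of_int (c j)"
        using Nbd(2)[of j] cr[of j] by (intro divide_right_mono) auto
      then show "real (N j) / of_int (c j) \<le> 1 / \<kappa> + 1 / of_int (c j)" using cr[of j] by (simp add: add_divide_distrib)
    qed
    show "(\<lambda>j. 1 / \<kappa> + 1 / real_of_int (c j)) \<longlonglongrightarrow> 1 / \<kappa>"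
      using tendsto_add[OF tendsto_const cinv] by simp
  qed
  have cN: "(\<lambda>j. of_int (c j) / real (N j)) \<longlonglongrightarrow> \<kappa>"
    using tendsto_inverse[OF Nc] \<kappa> by (simp add: inverse_eq_divide)
  have ac: "(\<lambda>j. of_int (a j) / real_of_int (c j)) \<longlonglongrightarrow> r"
    by (rule LIM_zero_cancel, rule Lim_null_comparison[OF always_eventually inv]) (use P(3) in \<open>auto intro: less_imp_le\<close>)
  have cs: "(\<lambda>j. of_int (c j) * (of_int (c j) * ?u + of_int (d j))) \<longlonglongrightarrow> s"
    by (rule LIM_zero_cancel, rule Lim_null_comparison[OF always_eventually inv]) (use P(4) in \<open>auto intro: less_imp_le\<close>)
  \<comment> \<open>For negative c0 the matrix is replaced by its negative, again integral of
    determinant 1.\<close>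
  define \<sigma> :: int where "\<sigma> = (if c0 > 0 then 1 else - 1)"
  have \<sigma>: "\<sigma> * \<sigma> = 1" "real_of_int \<sigma> * \<kappa> = c0" "real_of_int \<sigma> / \<kappa> = 1 / c0"
    using c0 by (auto simp: \<sigma>_def \<kappa>_def)
  have "weak_conv_complex (\<lambda>i. rho k l (N i) \<alpha>) (kernel_law a0 ((a0 * d0 - 1) / c0) c0 d0)"
  proof (rule rho_converges[OF l N1, where a = "\<lambda>j. \<sigma> * a j" and b = "\<lambda>j. \<sigma> * b j" and c = "\<lambda>j. \<sigma> * c j" and d = "\<lambda>j. \<sigma> * d j"])
    fix j
    have "\<sigma> * a j * (\<sigma> * d j) - \<sigma> * b j * (\<sigma> * c j) = \<sigma> * \<sigma> * (a j * d j - b j * c j)" by (simp add: algebra_simps)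
    then show "\<sigma> * a j * (\<sigma> * d j) - \<sigma> * b j * (\<sigma> * c j) = 1" by (simp add: \<sigma> P)
    show "\<sigma> * c j \<noteq> 0" using cpos[of j] by (simp add: \<sigma>_def)
  next
    have f1: "(\<lambda>j. of_int \<sigma> * ((of_int (a j) / real_of_int (c j)) * (of_int (c j) / real (N j)))) \<longlonglongrightarrow> of_int \<sigma> * (r * \<kappa>)"
      by (intro tendsto_intros ac cN)
    have f2: "of_int \<sigma> * ((of_int (a j) / real_of_int (c j)) * (of_int (c j) / real (N j))) = of_int (\<sigma> * a j) / real (N j)" for j
      using cr[of j] by simp
    have f3: "of_int \<sigma> * (r * \<kappa>) = a0"
    proof -
      have "of_int \<sigma> * (r * \<kappa>) = r * (of_int \<sigma> * \<kappa>)" by simp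
      then show ?thesis using c0 by (simp only: \<sigma>(2)) (simp add: r_def)
    qed
    show "(\<lambda>j. of_int (\<sigma> * a j) / real (N j)) \<longlonglongrightarrow> a0" using f1 unfolding f2 f3 .
  next
    have "(\<lambda>j. of_int \<sigma> * (of_int (c j) / real (N j))) \<longlonglongrightarrow> of_int \<sigma> * \<kappa>"
      by (intro tendsto_intros cN)
    then show "(\<lambda>j. of_int (\<sigma> * c j) / real (N j)) \<longlonglongrightarrow> c0" by (simp add: \<sigma>(2))
  next
    have f1: "(\<lambda>j. of_int \<sigma> * ((of_int (c j) * (of_int (c j) * ?u + of_int (d j))) * (real (N j) / of_int (c j)))) \<longlonglongrightarrow> of_int \<sigma> * (s * (1 / \<kappa>))"
      by (intro tendsto_intros cs Nc)
    have f2: "of_int \<sigma> * ((of_int (c j) * (of_int (c j) * ?u + of_int (d j))) * (real (N j) / of_int (c j))) =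
        (of_int (\<sigma> * c j) * ?u + of_int (\<sigma> * d j)) * real (N j)" for j
      using cr[of j] by (simp add: field_simps)
    have f3: "of_int \<sigma> * (s * (1 / \<kappa>)) = d0"
    proof -
      have "of_int \<sigma> * (s * (1 / \<kappa>)) = s * (of_int \<sigma> / \<kappa>)" by simp
      then show ?thesis using c0 by (simp only: \<sigma>(3)) (simp add: s_def)
    qed
    show "(\<lambda>j. (of_int (\<sigma> * c j) * ?u + of_int (\<sigma> * d j)) * real (N j)) \<longlonglongrightarrow> d0" using f1 unfolding f2 f3 .
  qed (rule c0)
  moreover have "(a0 * d0 - 1) / c0 = b0" using det0 c0 by (simp add: field_simps)
  ultimately show ?thesis using mono N1 by auto
qed

text \<open>A triangular target is moved by the quarter turn with rows (0, - 1), (1, 0) to a matrix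
  with lower left entry a \<noteq> 0, which has the same integrals by invariance.\<close>

lemma rho_reaches_limit_family:
  assumes "\<nu> \<in> limit_family"
  shows "\<exists>N. strict_mono N \<and> (\<forall>i. 1 \<le> N i) \<and> weak_conv_complex (\<lambda>i. rho k l (N i) \<alpha>) \<nu>"
  using assms
proof (cases rule: limit_family_cases)
  case 1
  then show ?thesis using rho_reaches_cusp by simp
next
  case (2 a b c d)
  show ?thesis
  proof (cases "c = 0")
    case False
    then show ?thesis using rho_reaches_kernel_law[OF 2(1)] 2(2) by simp
  next
    case True
    then have ad: "a * d = 1" using 2(1) by simp
    then have a: "a \<noteq> 0" and d: "d = 1 / a" by (auto simp: eq_divide_eq mult.commute)
    have "0 * b - (- 1 / a) * a = 1" using a by simp
    then obtain N where N: "strict_mono N" "\<forall>i. 1 \<le> N i" "weak_conv_complex (\<lambda>i. rho k l (N i) \<alpha>) (kernel_law 0 (- 1 / a) a b)"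
      using rho_reaches_kernel_law[OF _ a] by blast
    have "(\<integral>z. F z \<partial>kernel_law 0 (- 1 / a) a b) = (\<integral>z. F z \<partial>\<nu>)" if "continuous_on UNIV F" "bounded (range F)" for F :: "complex \<Rightarrow> real"
      using kernel_law_invariant[OF that a, of 0 0 "- 1" 1 b] by (simp add: 2(2) True d)
    then have "weak_conv_complex (\<lambda>i. rho k l (N i) \<alpha>) \<nu>"
      using N(3) by (auto simp: weak_conv_complex_def)
    then show ?thesis using N by blast
  qed
qed

end

theorem theorem2:
  fixes k l :: int
  assumes "l \<noteq> 0"
  shows "(\<forall>\<alpha>::real. \<forall>N::nat \<Rightarrow> nat.
            strict_mono N \<and> (\<forall>i. 1 \<le> N i) \<and>
            weakly_convergent_complex (\<lambda>i. rho k l (N i) \<alpha>) \<longrightarrow>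
            (\<exists>\<nu>\<in>limit_family. weak_conv_complex (\<lambda>i. rho k l (N i) \<alpha>) \<nu>))
       \<and> (\<exists>E\<in>null_sets (lebesgue :: real measure). \<forall>\<alpha>::real. \<alpha> \<notin> E \<longrightarrow>
            (\<forall>\<nu>\<in>limit_family. \<exists>N::nat \<Rightarrow> nat.
               strict_mono N \<and> (\<forall>i. 1 \<le> N i) \<and>
               weak_conv_complex (\<lambda>i. rho k l (N i) \<alpha>) \<nu>))"
proof
  show "\<forall>\<alpha>::real. \<forall>N::nat \<Rightarrow> nat.
            strict_mono N \<and> (\<forall>i. 1 \<le> N i) \<and>
            weakly_convergent_complex (\<lambda>i. rho k l (N i) \<alpha>) \<longrightarrow>
            (\<exists>\<nu>\<in>limit_family. weak_conv_complex (\<lambda>i. rho k l (N i) \<alpha>) \<nu>)"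
    using weakly_convergent_rho[OF assms] by blast
next
  obtain E0 :: "real set" where E0: "negligible E0"
    and near: "\<And>u r s \<epsilon> K. u \<notin> E0 \<Longrightarrow> \<epsilon> > 0 \<Longrightarrow> horocycle_near r s \<epsilon> K u"
    by (rule horocycle_dense_ae) blast
  \<comment> \<open>The density statement concerns u = l \<alpha>; dividing by l \<noteq> 0 keeps
    the exceptional set null.\<close>
  define E where "E = (\<lambda>u. 1 / of_int l * u) ` E0"
  have "negligible E"
    unfolding E_def
    by (intro negligible_differentiable_image_negligible[OF order_refl E0] differentiable_on_mult differentiable_on_const differentiable_on_ident)
  moreover have "\<exists>N::nat \<Rightarrow> nat. strict_mono N \<and> (\<forall>i. 1 \<le> N i) \<and> weak_conv_complex (\<lambda>i. rho k l (N i) \<alpha>) \<nu>"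
    if \<alpha>: "\<alpha> \<notin> E" and \<nu>: "\<nu> \<in> limit_family" for \<alpha> \<nu>
  proof (rule rho_reaches_limit_family[OF assms _ \<nu>])
    have "of_int l * \<alpha> \<notin> E0"
    proof
      assume "of_int l * \<alpha> \<in> E0"
      then have "1 / of_int l * (of_int l * \<alpha>) \<in> E" unfolding E_def by (rule imageI)
      with \<alpha> assms show False by simp
    qed
    then show "horocycle_near r s \<epsilon> K (of_int l * \<alpha>)" if "\<epsilon> > 0" for r s \<epsilon> K using near that by blast
  qed
  ultimately show "\<exists>E\<in>null_sets (lebesgue :: real measure). \<forall>\<alpha>::real. \<alpha> \<notin> E \<longrightarrow>
            (\<forall>\<nu>\<in>limit_family. \<exists>N::nat \<Rightarrow> nat.
               strict_mono N \<and> (\<forall>i. 1 \<le> N i) \<and>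
               weak_conv_complex (\<lambda>i. rho k l (N i) \<alpha>) \<nu>)"
    unfolding negligible_iff_null_sets by blast
qed

end
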